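(* Let $\sigma>0$, let $f=(f_1,\dots,f_d):\mathbb{R}^d\to\mathbb{R}^d$ be of class $C^\infty$, let $p\in\mathbb{R}^d$ with $f(p)=p$, and let $H$ be the RKHS on $\mathbb{R}^d$ of $k(x,y)=e^{(x-p)^\top(y-p)/\sigma^2}$. Assume $f^\alpha:=f_1^{\alpha_1}\cdots f_d^{\alpha_d}\in H$ for all $\alpha\in\mathbb{Z}_{\ge0}^d$. Let $x_1,x_2,\dots$ be i.i.d. random variables with law $\rho(x)\,\mathrm{d}x$, where $\rho$ is compactly supported and $\operatorname{ess\,inf}_{x\in U}\rho(x)>0$ for some nonempty open $U\subset\mathbb{R}^d$, and let $y_i=f(x_i)$. For $m\le n$ and $N\ge r_n$ let $\widehat{\mathbf{C}}(m,n,N)\in\mathbb{C}^{r_m\times r_m}$ be the matrix formed by the first $r_m$ columns of $\mathbf{V}_m^Y(\mathbf{V}_n^X)^\dagger$, where $X=(x_1,\dots,x_N)$, $Y=(y_1,\dots,y_N)$. Then for every $m\ge0$, almost surely, $$\lim_{n\to\infty}\lim_{N\to\infty}\big\|\widehat{\mathbf{C}}(m,n,N)-\mathbf{G}_m\mathbf{C}_{f,m}^\star\mathbf{G}_m^{-1}\big\|=0 .$$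
   Context: Conventions: $k_x:=k(x,\cdot)\in H$, $\langle h,k_x\rangle_H=h(x)$. $C_fh:=h\circ f$ with domain $D(C_f)=\{h\in H:h\circ f\in H\}$; $C_f^*$ is its adjoint. $V_{p,n}:=\mathrm{span}\{\partial_x^\alpha k(x,\cdot)|_{x=p}:|\alpha|\le n\}\subset H$ (here the space of polynomials of degree $\le n$), $V_p:=\bigcup_nV_{p,n}$, $r_n:=\dim V_{p,n}=\binom{n+d}{d}$. Under the hypotheses $V_p\subset D(C_f)$, $C_f$ is densely defined, and $C_f^*$ maps $V_{p,m}$ into itself. Fix a basis $\{v_i\}_{i\ge1}$ of $V_p$, orthogonal in $H$, such that $\{v_1,\dots,v_{r_n}\}$ is a basis of $V_{p,n}$ for every $n$. Put $\mathbf{v}_n(x):=(\overline{v_i(x)})_{i=1}^{r_n}$, $\mathbf{V}_n^X:=(\mathbf{v}_n(x_1),\dots,\mathbf{v}_n(x_N))$ for $X=(x_1,\dots,x_N)$, and $\mathbf{G}_m:=(\langle v_i,v_j\rangle_H)_{i,j=1}^{r_m}$ (diagonal). $\mathbf{C}_{f,m}^\star$ is the matrix of $C_f^*|_{V_{p,m}}$ in the basis $\{v_1,\dots,v_{r_m}\}$. $\dagger$ is the Moore–Penrose pseudo-inverse and $\|\cdot\|$ the Frobenius norm. *)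

theory Defs
  imports
    "HOL-Probability.Probability"
    "HOL-Library.Function_Algebras"
    "Jordan_Normal_Form.Gauss_Jordan_Elimination"
    "Jordan_Normal_Form.Schur_Decomposition"
begin

(* These Jordan_Normal_Form notations clash with the ones of HOL-Analysis. *)
no_notation Matrix.vec_index (infixl \<open>$\<close> 100)
no_notation Matrix.scalar_prod (infix \<open>\<bullet>\<close> 70)


section \<open>Complex vector spaces of functions\<close>

definition cscale :: "complex \<Rightarrow> ('a \<Rightarrow> complex) \<Rightarrow> 'a \<Rightarrow> complex" where
  "cscale c g = (\<lambda>x. c * g x)"

global_interpretation cfun: vector_space "cscale :: complex \<Rightarrow> ('a \<Rightarrow> complex) \<Rightarrow> 'a \<Rightarrow> complex"
  by unfold_locales (auto simp: cscale_def algebra_simps fun_eq_iff)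

text \<open>The family \<open>(v\<^sub>i)\<close>, \<open>i \<in> I\<close>, is a basis of the space \<open>V\<close>.\<close>

definition is_basis :: "('i \<Rightarrow> 'a \<Rightarrow> complex) \<Rightarrow> 'i set \<Rightarrow> ('a \<Rightarrow> complex) set \<Rightarrow> bool" where
  "is_basis v I V \<longleftrightarrow> inj_on v I \<and> cfun.independent (v ` I) \<and> cfun.span (v ` I) = V"

text \<open>Matrix of \<open>T\<close> in the basis \<open>v 0, \<dots>, v (r - 1)\<close>: column \<open>j\<close> holds the coordinates
  of \<open>T (v j)\<close>.\<close>

definition matrix_in_basis ::
  "(nat \<Rightarrow> 'a \<Rightarrow> complex) \<Rightarrow> nat \<Rightarrow> (('a \<Rightarrow> complex) \<Rightarrow> 'a \<Rightarrow> complex) \<Rightarrow> complex mat" where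
  "matrix_in_basis v r T =
     Matrix.mat r r (\<lambda>(i, j). cfun.representation (v ` {..<r}) (T (v j)) (v i))"


section \<open>Reproducing kernel Hilbert spaces\<close>

text \<open>\<open>H\<close> with inner product \<open>ip\<close> (linear in the first argument) is the complex RKHS of the
  kernel \<open>k\<close>; the kernel section \<open>k\<^sub>x = k(x, \<cdot>)\<close> is \<open>k x\<close>. Only the values of
  \<open>ip\<close> on \<open>H\<close> matter.\<close>

locale rkhs =
  fixes k :: "'a \<Rightarrow> 'a \<Rightarrow> complex"
    and H :: "('a \<Rightarrow> complex) set"
    and ip :: "('a \<Rightarrow> complex) \<Rightarrow> ('a \<Rightarrow> complex) \<Rightarrow> complex"
  assumes subspace: "cfun.subspace H"
    and ip_add: "\<lbrakk>g \<in> H; h \<in> H; u \<in> H\<rbrakk> \<Longrightarrow> ip (g + h) u = ip g u + ip h u"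
    and ip_scale: "\<lbrakk>g \<in> H; u \<in> H\<rbrakk> \<Longrightarrow> ip (cscale c g) u = c * ip g u"
    and ip_commute: "\<lbrakk>g \<in> H; h \<in> H\<rbrakk> \<Longrightarrow> ip g h = cnj (ip h g)"
    and ip_nonneg: "g \<in> H \<Longrightarrow> 0 \<le> Re (ip g g)"
    and ip_definite: "\<lbrakk>g \<in> H; ip g g = 0\<rbrakk> \<Longrightarrow> g = 0"
    and complete: "\<lbrakk>\<forall>n. s n \<in> H;
        \<forall>e>0. \<exists>N. \<forall>m\<ge>N. \<forall>n\<ge>N. sqrt (Re (ip (s m - s n) (s m - s n))) < e\<rbrakk>
      \<Longrightarrow> \<exists>g\<in>H. (\<lambda>n. sqrt (Re (ip (s n - g) (s n - g)))) \<longlonglongrightarrow> 0"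
    and kernel_in: "k x \<in> H"
    and reproducing: "h \<in> H \<Longrightarrow> ip h (k x) = h x"

definition exp_kernel :: "real \<Rightarrow> real ^ 'd \<Rightarrow> real ^ 'd \<Rightarrow> real ^ 'd \<Rightarrow> complex" where
  "exp_kernel \<sigma> p x y = complex_of_real (exp (((x - p) \<bullet> (y - p)) / \<sigma>\<^sup>2))"

text \<open>The adjoint of the operator \<open>T\<close> with domain \<open>D\<close>; \<open>h\<close> is unique if \<open>D\<close> is dense in
  \<open>H\<close>, and exists if \<open>g\<close> is in the domain of the adjoint.\<close>

definition adjoint_op ::
  "('a \<Rightarrow> complex) set \<Rightarrow> (('a \<Rightarrow> complex) \<Rightarrow> ('a \<Rightarrow> complex) \<Rightarrow> complex) \<Rightarrow> ('a \<Rightarrow> complex) set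
    \<Rightarrow> (('a \<Rightarrow> complex) \<Rightarrow> 'a \<Rightarrow> complex) \<Rightarrow> ('a \<Rightarrow> complex) \<Rightarrow> 'a \<Rightarrow> complex" where
  "adjoint_op H ip D T g = (THE h. h \<in> H \<and> (\<forall>u\<in>D. ip (T u) g = ip u h))"

definition comp_op :: "('a \<Rightarrow> 'a) \<Rightarrow> ('a \<Rightarrow> complex) \<Rightarrow> 'a \<Rightarrow> complex" where
  "comp_op f h = h \<circ> f"

definition comp_dom :: "('a \<Rightarrow> complex) set \<Rightarrow> ('a \<Rightarrow> 'a) \<Rightarrow> ('a \<Rightarrow> complex) set" where
  "comp_dom H f = {h \<in> H. h \<circ> f \<in> H}"


section \<open>Partial derivatives and jets\<close>

definition partial_deriv ::
  "'d \<Rightarrow> (real ^ 'd \<Rightarrow> 'b) \<Rightarrow> real ^ 'd \<Rightarrow> 'b::real_normed_vector" where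
  "partial_deriv i g x = vector_derivative (\<lambda>t. g (x + t *\<^sub>R axis i 1)) (at 0)"

primrec C_diff :: "nat \<Rightarrow> (real ^ 'd \<Rightarrow> 'b::real_normed_vector) \<Rightarrow> bool" where
  "C_diff 0 g \<longleftrightarrow> continuous_on UNIV g"
| "C_diff (Suc n) g \<longleftrightarrow>
     (\<forall>i x. (\<lambda>t::real. g (x + t *\<^sub>R axis i 1)) differentiable (at 0)) \<and>
     (\<forall>i. C_diff n (partial_deriv i g))"

definition C_infinity :: "(real ^ 'd \<Rightarrow> 'b::real_normed_vector) \<Rightarrow> bool" where
  "C_infinity g \<longleftrightarrow> (\<forall>n. C_diff n g)"

text \<open>\<open>\<partial>\<^sup>\<alpha> g\<close> for a multi-index \<open>\<alpha>\<close>. The index type carries no order, so an enumeration of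
  the coordinates is chosen; for smooth \<open>g\<close> the result does not depend on it.\<close>

definition multi_deriv ::
  "('d \<Rightarrow> nat) \<Rightarrow> (real ^ 'd::finite \<Rightarrow> 'b) \<Rightarrow> real ^ 'd \<Rightarrow> 'b::real_normed_vector" where
  "multi_deriv \<alpha> g =
     foldr (\<lambda>i. partial_deriv i ^^ \<alpha> i) (SOME is. distinct is \<and> set is = UNIV) g"

definition jet_space ::
  "(real ^ 'd \<Rightarrow> real ^ 'd \<Rightarrow> complex) \<Rightarrow> real ^ 'd::finite \<Rightarrow> nat \<Rightarrow> (real ^ 'd \<Rightarrow> complex) set" where
  "jet_space k p n = cfun.span {(\<lambda>y. multi_deriv \<alpha> (\<lambda>x. k x y) p) | \<alpha>. (\<Sum>i\<in>UNIV. \<alpha> i) \<le> n}"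

definition jet_dim :: "(real ^ 'd \<Rightarrow> real ^ 'd \<Rightarrow> complex) \<Rightarrow> real ^ 'd::finite \<Rightarrow> nat \<Rightarrow> nat" where
  "jet_dim k p n = cfun.dim (jet_space k p n)"


section \<open>Matrices\<close>

definition pseudo_inverse :: "complex mat \<Rightarrow> complex mat" where
  "pseudo_inverse A = (THE B. B \<in> carrier_mat (dim_col A) (dim_row A) \<and>
     A * B * A = A \<and> B * A * B = B \<and>
     mat_adjoint (A * B) = A * B \<and> mat_adjoint (B * A) = B * A)"

definition frobenius_norm :: "complex mat \<Rightarrow> real" where
  "frobenius_norm A = sqrt (\<Sum>i<dim_row A. \<Sum>j<dim_col A. (cmod (A $$ (i, j)))\<^sup>2)"

definition gram_matrix ::
  "(('a \<Rightarrow> complex) \<Rightarrow> ('a \<Rightarrow> complex) \<Rightarrow> complex) \<Rightarrow> (nat \<Rightarrow> 'a \<Rightarrow> complex) \<Rightarrow> nat \<Rightarrow> complex mat" where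
  "gram_matrix ip v r = Matrix.mat r r (\<lambda>(i, j). ip (v i) (v j))"

definition feature_matrix :: "(nat \<Rightarrow> 'a \<Rightarrow> complex) \<Rightarrow> nat \<Rightarrow> nat \<Rightarrow> (nat \<Rightarrow> 'a) \<Rightarrow> complex mat" where
  "feature_matrix v r N x = Matrix.mat r N (\<lambda>(i, j). cnj (v i (x j)))"

definition first_columns :: "nat \<Rightarrow> complex mat \<Rightarrow> complex mat" where
  "first_columns r A = Matrix.mat (dim_row A) r (\<lambda>(i, j). A $$ (i, j))"

text \<open>The estimator, with \<open>rm\<close>, \<open>rn\<close> the dimensions of the two jet spaces and \<open>N\<close> samples.\<close>

definition C_hat ::
  "(nat \<Rightarrow> 'a \<Rightarrow> complex) \<Rightarrow> nat \<Rightarrow> nat \<Rightarrow> nat \<Rightarrow> (nat \<Rightarrow> 'a) \<Rightarrow> (nat \<Rightarrow> 'a) \<Rightarrow> complex mat" where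
  "C_hat v rm rn N x y =
     first_columns rm (feature_matrix v rm N y * pseudo_inverse (feature_matrix v rn N x))"


section \<open>Essential infimum\<close>

definition ess_inf :: "'a measure \<Rightarrow> ('a \<Rightarrow> ereal) \<Rightarrow> ereal" where
  "ess_inf M g = Sup {c. AE x in M. c \<le> g x}"

end

theory Submission
  imports Defs
begin

text \<open>For fixed \<open>n\<close> the law of large numbers identifies the limit in \<open>N\<close>: its rows are the conjugated
  coefficients of the \<open>L\<^sup>2(\<rho>)\<close>-projection \<open>P\<^sub>n h\<close> of \<open>h = v\<^sub>i \<circ> f\<close> onto the polynomials of degree at
  most \<open>n\<close>, while the target holds the coefficients of the \<open>H\<close>-orthogonal projection, the Taylor
  polynomial \<open>T\<^sub>n h\<close> at \<open>p\<close>. On the compact support \<open>h - T\<^sub>n h\<close> is of order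
  \<open>(C\<^sup>n / n!)\<^sup>1\<^sup>/\<^sup>2\<close>, hence so is the \<open>L\<^sup>2(\<rho>)\<close>-norm of the polynomial \<open>P\<^sub>n h - T\<^sub>n h\<close>. Since \<open>\<rho>\<close> is bounded
  below on an open set, Lagrange interpolation on translated grids recovers a coefficient of a
  polynomial of degree \<open>n\<close> from its \<open>L\<^sup>2(\<rho>)\<close>-norm with loss at most \<open>A\<^sup>n\<close>, and the factorial wins.

  That the adjoint preserves jets needs no chain rule of higher order: \<open>u\<close> orthogonal to \<open>V\<^sub>m\<close>
  means \<open>u(x) = O(|x - p|\<^sup>m\<^sup>+\<^sup>1)\<close>, which composition with \<open>f\<close> preserves as \<open>f\<close> fixes \<open>p\<close> and is
  Lipschitz there, and inner products with monomials are limits of finite differences at \<open>p\<close>.\<close>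

section \<open>Elementary Hilbert space geometry\<close>

text \<open>No formula for the inner product of H is given, only completeness and the reproducing
  property. So the monomials and their norms are extracted from kernel sections by finite
  differences at p, and the Taylor error is estimated by duality: h(x) - T_n h(x) is the inner
  product of h with k_x minus the projection of k_x. The square of the norm of that difference is a
  remainder of the exponential series at |x - p|^2 / \<sigma>^2, whence the square root in the rate.
  Passing from the Taylor error to P_n h - T_n h costs nothing: T_n h is itself a polynomial of
  degree at most n, so this difference is P_n (h - T_n h), and an orthogonal projection is a
  contraction. An integral does not control point values, so the interpolation inequality is
  averaged over translates of the grid. Its loss stays exponential because (n + 1)^n / n! is at most
  e^(n + 1). The degree m stays fixed while n grows, so constants that depend on the tested
  polynomial of degree m are harmless; only their growth in n matters.\<close>

context rkhs
begin

definition hnorm :: "('a \<Rightarrow> complex) \<Rightarrow> real" where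
  "hnorm g = sqrt (Re (ip g g))"

lemma zero_in [simp, intro]: "0 \<in> H"
  and add_in [simp, intro]: "g \<in> H \<Longrightarrow> h \<in> H \<Longrightarrow> g + h \<in> H"
  and scale_in [simp, intro]: "g \<in> H \<Longrightarrow> cscale c g \<in> H"
  and diff_in [simp, intro]: "g \<in> H \<Longrightarrow> h \<in> H \<Longrightarrow> g - h \<in> H"
  and sum_in: "(\<And>i. i \<in> I \<Longrightarrow> e i \<in> H) \<Longrightarrow> (\<Sum>i\<in>I. e i) \<in> H"
  using subspace
  by (auto intro: cfun.subspace_0 cfun.subspace_add cfun.subspace_scale cfun.subspace_diff
      cfun.subspace_sum)

lemma span_in: "S \<subseteq> H \<Longrightarrow> cfun.span S \<subseteq> H"
  using subspace by (rule cfun.span_minimal[rotated])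

lemma ip_self_real: "g \<in> H \<Longrightarrow> ip g g = complex_of_real (Re (ip g g))"
  using ip_commute[of g g] by (auto simp: complex_eq_iff)

lemma ip_self: "g \<in> H \<Longrightarrow> ip g g = complex_of_real ((hnorm g)\<^sup>2)"
  using ip_self_real ip_nonneg by (simp add: hnorm_def)

lemma hnorm_nonneg [simp]: "g \<in> H \<Longrightarrow> 0 \<le> hnorm g"
  by (simp add: hnorm_def ip_nonneg)

lemma hnorm_eq_0: "g \<in> H \<Longrightarrow> hnorm g = 0 \<Longrightarrow> g = 0"
  using ip_self[of g] ip_definite[of g] by simp

lemma ip_add_right: "\<lbrakk>u \<in> H; g \<in> H; h \<in> H\<rbrakk> \<Longrightarrow> ip u (g + h) = ip u g + ip u h"
  using ip_commute[of u "g + h"] ip_add[of g h u] ip_commute[of u g] ip_commute[of u h] by auto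

lemma ip_scale_right: "\<lbrakk>u \<in> H; g \<in> H\<rbrakk> \<Longrightarrow> ip u (cscale c g) = cnj c * ip u g"
  using ip_commute[of u "cscale c g"] ip_scale[of g u c] ip_commute[of u g] by auto

lemma ip_zero_left [simp]: "u \<in> H \<Longrightarrow> ip 0 u = 0"
  using ip_scale[of 0 u 0] by (simp add: cfun.scale_zero_right)

lemma ip_zero_right [simp]: "u \<in> H \<Longrightarrow> ip u 0 = 0"
  using ip_scale_right[of u 0 0] by (simp add: cfun.scale_zero_right)

lemma ip_diff: "\<lbrakk>g \<in> H; h \<in> H; u \<in> H\<rbrakk> \<Longrightarrow> ip (g - h) u = ip g u - ip h u"
  using ip_add[of "g - h" h u] by auto

lemma ip_diff_right: "\<lbrakk>u \<in> H; g \<in> H; h \<in> H\<rbrakk> \<Longrightarrow> ip u (g - h) = ip u g - ip u h"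
  using ip_add_right[of u "g - h" h] by auto

lemma ip_sum: "\<lbrakk>\<And>i. i \<in> I \<Longrightarrow> e i \<in> H; u \<in> H\<rbrakk> \<Longrightarrow> ip (\<Sum>i\<in>I. e i) u = (\<Sum>i\<in>I. ip (e i) u)"
  by (induction I rule: infinite_finite_induct) (auto simp: ip_add sum_in)

lemma ip_sum_right: "\<lbrakk>\<And>i. i \<in> I \<Longrightarrow> e i \<in> H; u \<in> H\<rbrakk> \<Longrightarrow> ip u (\<Sum>i\<in>I. e i) = (\<Sum>i\<in>I. ip u (e i))"
  by (induction I rule: infinite_finite_induct) (auto simp: ip_add_right sum_in)

text \<open>The hypothesis \<open>ip g q = ip q q\<close> says that \<open>g - q\<close> is
  orthogonal to \<open>q\<close>, so this is Pythagoras. It serves both the Cauchy-Schwarz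
  inequality and the projections \<open>oproj\<close>.\<close>

lemma hnorm_diff_le:
  assumes "g \<in> H" "q \<in> H" "ip g q = ip q q"
  shows "(hnorm (g - q))\<^sup>2 = (hnorm g)\<^sup>2 - (hnorm q)\<^sup>2"
proof -
  have "ip q g = ip q q"
    using ip_commute[of q g] assms ip_commute[of q q] by auto
  then have "ip (g - q) (g - q) = ip g g - ip q q"
    using assms by (simp add: ip_diff ip_diff_right diff_in)
  then have "complex_of_real ((hnorm (g - q))\<^sup>2) = complex_of_real ((hnorm g)\<^sup>2 - (hnorm q)\<^sup>2)"
    using assms ip_self[of "g - q"] ip_self[of g] ip_self[of q] diff_in by simp
  then show ?thesis
    unfolding of_real_eq_iff .
qed

lemma cauchy_schwarz:
  assumes "g \<in> H" "h \<in> H"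
  shows "cmod (ip g h) \<le> hnorm g * hnorm h"
proof (cases "h = 0")
  case True
  then show ?thesis using assms by simp
next
  case False
  define C where "C = (hnorm h)\<^sup>2"
  have "hnorm h \<noteq> 0" using False assms(2) hnorm_eq_0 by blast
  then have C: "C > 0" "ip h h = of_real C"
    using ip_self[OF assms(2)] by (simp_all add: C_def)
  \<comment> \<open>\<open>q\<close> is the orthogonal projection of \<open>g\<close> onto the line
    through \<open>h\<close>; the bound expresses that the squared norm of \<open>g - q\<close> is
    nonnegative.\<close>
  define q where "q = cscale (ip g h / C) h"
  have q: "q \<in> H" "ip g q = ip q q"
    using assms C by (auto simp: q_def ip_scale ip_scale_right scale_in)
  have "ip q q = (ip g h / C) * (cnj (ip g h / C) * C)"
    using assms C by (simp add: q_def ip_scale ip_scale_right scale_in)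
  also have "\<dots> = ip g h * cnj (ip g h) / C"
    using C by (simp add: field_simps)
  also have "\<dots> = of_real ((cmod (ip g h))\<^sup>2 / C)"
    unfolding of_real_divide complex_norm_square ..
  finally have "of_real ((hnorm q)\<^sup>2) = complex_of_real ((cmod (ip g h))\<^sup>2 / C)"
    using ip_self[OF q(1)] by simp
  then have "(hnorm q)\<^sup>2 = (cmod (ip g h))\<^sup>2 / C"
    unfolding of_real_eq_iff .
  with hnorm_diff_le[OF assms(1) q] have "(cmod (ip g h))\<^sup>2 / C \<le> (hnorm g)\<^sup>2"
    using zero_le_power2[of "hnorm (g - q)"] by linarith
  then have "(cmod (ip g h))\<^sup>2 \<le> (hnorm g * hnorm h)\<^sup>2"
    using C(1) by (simp add: pos_divide_le_eq power_mult_distrib flip: C_def)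
  then show ?thesis
    using assms by (auto intro: power2_le_imp_le)
qed

lemma eval_le: "g \<in> H \<Longrightarrow> cmod (g x) \<le> hnorm g * hnorm (k x)"
  using cauchy_schwarz[of g "k x"] kernel_in reproducing by auto

section \<open>Orthogonal projection onto a finite orthogonal family\<close>

definition oproj :: "('i \<Rightarrow> 'a \<Rightarrow> complex) \<Rightarrow> 'i set \<Rightarrow> ('a \<Rightarrow> complex) \<Rightarrow> 'a \<Rightarrow> complex" where
  "oproj e I h = (\<Sum>i\<in>I. cscale (ip h (e i) / ip (e i) (e i)) (e i))"

context
  fixes e :: "'i \<Rightarrow> 'a \<Rightarrow> complex" and I :: "'i set"
  assumes fin: "finite I"
    and e_in: "\<And>i. i \<in> I \<Longrightarrow> e i \<in> H"
    and orth: "\<And>i j. \<lbrakk>i \<in> I; j \<in> I; i \<noteq> j\<rbrakk> \<Longrightarrow> ip (e i) (e j) = 0"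
    and nz: "\<And>i. i \<in> I \<Longrightarrow> e i \<noteq> 0"
begin

lemma oproj_in: "oproj e I h \<in> H"
  unfolding oproj_def by (auto intro!: sum_in e_in scale_in)

lemma ip_comb:
  assumes "j \<in> I"
  shows "ip (\<Sum>i\<in>I. cscale (c i) (e i)) (e j) = c j * ip (e j) (e j)"
proof -
  have "ip (\<Sum>i\<in>I. cscale (c i) (e i)) (e j) = (\<Sum>i\<in>I. c i * ip (e i) (e j))"
    using assms by (subst ip_sum) (auto intro!: sum.cong simp: ip_scale e_in)
  also have "\<dots> = (\<Sum>i\<in>I. if i = j then c j * ip (e j) (e j) else 0)"
    using assms by (auto intro!: sum.cong simp: orth)
  finally show ?thesis using fin assms by simp
qed

lemma ip_self_nz: "j \<in> I \<Longrightarrow> ip (e j) (e j) \<noteq> 0"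
  using ip_definite[of "e j"] e_in[of j] nz[of j] by blast

lemma ip_oproj: "h \<in> H \<Longrightarrow> j \<in> I \<Longrightarrow> ip (oproj e I h) (e j) = ip h (e j)"
  unfolding oproj_def using ip_comb ip_self_nz by simp

lemma ip_oproj_eq:
  assumes "h \<in> H"
  shows "ip h (oproj e I h) = ip (oproj e I h) (oproj e I h)"
proof -
  have "ip h (oproj e I h) = (\<Sum>i\<in>I. ip h (cscale (ip h (e i) / ip (e i) (e i)) (e i)))"
    unfolding oproj_def using assms by (intro ip_sum_right) (auto intro!: e_in scale_in)
  also have "\<dots> = (\<Sum>i\<in>I. ip (oproj e I h) (cscale (ip h (e i) / ip (e i) (e i)) (e i)))"
    using assms oproj_in by (intro sum.cong) (auto simp: ip_scale_right e_in ip_oproj)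
  also have "\<dots> = ip (oproj e I h) (oproj e I h)"
    unfolding oproj_def using assms 
    by (intro ip_sum_right[symmetric]) (auto intro!: e_in scale_in sum_in)
  finally show ?thesis .
qed

lemma hnorm_oproj: "h \<in> H \<Longrightarrow> (hnorm (h - oproj e I h))\<^sup>2 = (hnorm h)\<^sup>2 - (hnorm (oproj e I h))\<^sup>2"
  using hnorm_diff_le[OF _ oproj_in ip_oproj_eq] .

lemma hnorm_oproj_le: "h \<in> H \<Longrightarrow> hnorm (h - oproj e I h) \<le> hnorm h"
  using hnorm_oproj[of h] zero_le_power2[of "hnorm (oproj e I h)"]
  by (intro power2_le_imp_le[OF _ hnorm_nonneg]) linarith+

text \<open>Parseval for the projection: in \<open>ip h (oproj e I h)\<close> each coefficient meets
  its own conjugate.\<close>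

lemma hnorm_oproj_sq:
  assumes "h \<in> H"
  shows "(hnorm (oproj e I h))\<^sup>2 = (\<Sum>i\<in>I. (cmod (ip h (e i)))\<^sup>2 / (hnorm (e i))\<^sup>2)"
proof -
  have "of_real ((hnorm (oproj e I h))\<^sup>2) = ip h (oproj e I h)"
    using ip_self[OF oproj_in] ip_oproj_eq[OF assms] by simp
  also have "\<dots> = (\<Sum>i\<in>I. ip h (cscale (ip h (e i) / ip (e i) (e i)) (e i)))"
    unfolding oproj_def using assms by (intro ip_sum_right) (auto intro!: e_in scale_in)
  also have "\<dots> = (\<Sum>i\<in>I. of_real ((cmod (ip h (e i)))\<^sup>2 / (hnorm (e i))\<^sup>2))"
  proof (intro sum.cong refl)
    fix i assume i: "i \<in> I"
    have "ip h (cscale (ip h (e i) / ip (e i) (e i)) (e i))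
        = ip h (e i) * cnj (ip h (e i)) / cnj (ip (e i) (e i))"
      using i assms by (simp add: ip_scale_right e_in)
    also have "\<dots> = of_real ((cmod (ip h (e i)))\<^sup>2) / of_real ((hnorm (e i))\<^sup>2)"
      unfolding complex_norm_square ip_self[OF e_in[OF i]] by simp
    finally show "ip h (cscale (ip h (e i) / ip (e i) (e i)) (e i))
        = of_real ((cmod (ip h (e i)))\<^sup>2 / (hnorm (e i))\<^sup>2)"
      by simp
  qed
  finally show ?thesis
    unfolding of_real_sum[symmetric] of_real_eq_iff .
qed

text \<open>The difference \<open>u\<close> of \<open>h\<close> and its projection is orthogonal to
  every \<open>e i\<close> and lies in their span, hence is orthogonal to itself.\<close>

lemma oproj_span:
  assumes "h \<in> cfun.span (e ` I)"
  shows "h = (\<Sum>i\<in>I. cscale (ip h (e i) / ip (e i) (e i)) (e i))"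
proof -
  have "cfun.span (e ` I) \<subseteq> H" by (rule span_in) (auto intro: e_in)
  then have h: "h \<in> H" using assms by auto
  define S where "S = {g \<in> H. \<forall>i\<in>I. ip g (e i) = 0}"
  define u where "u = h - oproj e I h"
  have u: "u \<in> H" using h oproj_in unfolding u_def by blast
  have u0: "ip u (e i) = 0" if "i \<in> I" for i
    using that h oproj_in by (simp add: u_def ip_diff e_in ip_oproj)
  have us: "u \<in> cfun.span (e ` I)"
    unfolding u_def oproj_def
    by (intro cfun.span_diff assms cfun.span_sum cfun.span_scale cfun.span_base) auto
  have "cfun.span (e ` I) \<subseteq> {g \<in> H. ip u g = 0}"
  proof (rule cfun.span_minimal)
    show "cfun.subspace {g \<in> H. ip u g = 0}"
      using u by (auto simp: cfun.subspace_def ip_add_right ip_scale_right)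
  qed (use u0 e_in in auto)
  then have "ip u u = 0" using us by blast
  then have "u = 0" by (rule ip_definite[OF u])
  then show ?thesis by (simp add: u_def oproj_def)
qed

end

end

section \<open>Finite differences\<close>

definition shifted_monomial :: "real ^ 'd \<Rightarrow> ('d::finite \<Rightarrow> nat) \<Rightarrow> real ^ 'd \<Rightarrow> complex" where
  "shifted_monomial p \<alpha> x = complex_of_real (\<Prod>i\<in>UNIV. (x $ i - p $ i) ^ \<alpha> i)"

definition mdeg :: "('d::finite \<Rightarrow> nat) \<Rightarrow> nat" where
  "mdeg \<alpha> = (\<Sum>i\<in>UNIV. \<alpha> i)"

text \<open>The forward difference of order \<open>n\<close> at 0 with unit step.\<close>

definition fdiff :: "nat \<Rightarrow> (real \<Rightarrow> real) \<Rightarrow> real" where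
  "fdiff n \<phi> = (\<Sum>a\<le>n. (-1) ^ (n - a) * real (n choose a) * \<phi> (real a))"

lemma fdiff_exp: "fdiff n (\<lambda>a. exp (a * w)) = (exp w - 1) ^ n"
proof -
  have "(exp w - 1) ^ n = (exp w + (-1)) ^ n" by simp
  also have "\<dots> = (\<Sum>a\<le>n. real (n choose a) * exp w ^ a * (-1) ^ (n - a))"
    by (rule binomial_ring)
  finally show ?thesis
    by (simp add: fdiff_def exp_of_nat_mult[symmetric] mult_ac)
qed

text \<open>A generating function: the difference of \<open>a ^ b\<close> is b! times the
  coefficient of X^b in (e^X - 1)^n, and this power series begins with X^n.\<close>

lemma fdiff_power:
  assumes "b \<le> n"
  shows "fdiff n (\<lambda>a. a ^ b) = (if b = n then fact n else 0)"
proof -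
  define E :: "real fps" where "E = fps_exp 1 - 1"
  have E: "fps_nth E 0 = 0" "fps_nth E 1 = 1" by (simp_all add: E_def)
  have "E ^ n = (fps_exp 1 + (-1)) ^ n" by (simp add: E_def)
  also have "\<dots> = (\<Sum>a\<le>n. of_nat (n choose a) * fps_exp 1 ^ a * (-1) ^ (n - a))"
    by (rule binomial_ring)
  also have "\<dots> = (\<Sum>a\<le>n. fps_const (real (n choose a) * (-1) ^ (n - a)) * fps_exp (real a))"
  proof (intro sum.cong refl)
    fix a
    have "(-1 :: real fps) ^ (n - a) = fps_const ((-1) ^ (n - a))"
      by (simp flip: fps_const_power fps_const_neg)
    then show "of_nat (n choose a) * fps_exp 1 ^ a * (-1) ^ (n - a)
        = fps_const (real (n choose a) * (-1) ^ (n - a)) * fps_exp (real a)"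
      by (simp add: fps_exp_power_mult fps_of_nat mult_ac flip: fps_const_mult)
  qed
  finally have "fps_nth (E ^ n) b = (\<Sum>a\<le>n. real (n choose a) * (-1) ^ (n - a) * (real a ^ b / fact b))"
    by (simp add: fps_sum_nth)
  also have "\<dots> = fdiff n (\<lambda>a. a ^ b) / fact b"
    by (simp add: fdiff_def sum_divide_distrib mult_ac)
  finally have *: "fdiff n (\<lambda>a. a ^ b) = fact b * fps_nth (E ^ n) b" by simp
  show ?thesis
  proof (cases "b = n")
    case True
    then show ?thesis using * startsby_zero_power_nth_same[OF E(1), of n] E(2) by simp
  next
    case False
    then show ?thesis using * startsby_zero_power_prefix[OF E(1), of n] assms by simp
  qed
qed

definition grid_pt :: "real ^ 'd \<Rightarrow> real \<Rightarrow> ('d \<Rightarrow> nat) \<Rightarrow> real ^ 'd" where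
  "grid_pt p t s = p + t *\<^sub>R (\<chi> i. real (s i))"

definition mdiff_weight :: "('d::finite \<Rightarrow> nat) \<Rightarrow> ('d \<Rightarrow> nat) \<Rightarrow> real" where
  "mdiff_weight \<alpha> s = (\<Prod>i\<in>UNIV. (-1) ^ (\<alpha> i - s i) * real (\<alpha> i choose s i))"

text \<open>The difference quotient of order \<alpha> at \<open>p\<close>: forward differences with
  step \<open>t\<close> in all coordinates, divided by the matching power of \<open>t\<close>. It
  approximates the partial derivative of order \<alpha>.\<close>

definition mdiff :: "real ^ 'd \<Rightarrow> real \<Rightarrow> ('d::finite \<Rightarrow> nat) \<Rightarrow> (real ^ 'd \<Rightarrow> complex) \<Rightarrow> complex" where
  "mdiff p t \<alpha> h = complex_of_real (1 / t ^ mdeg \<alpha>) *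
     (\<Sum>s \<in> PiE UNIV (\<lambda>i. {..\<alpha> i}). complex_of_real (mdiff_weight \<alpha> s) * h (grid_pt p t s))"

lemma finite_PiE_atMost [simp]: "finite (PiE (UNIV :: 'd::finite set) (\<lambda>i. {..\<alpha> i :: nat}))"
  by (intro finite_PiE) auto

text \<open>Both the weights and the grid are products over the coordinates, so the sum factors for
  a product function. Monomials and the exponential kernel have this form.\<close>

lemma mdiff_prod:
  "mdiff p t \<alpha> (\<lambda>x. complex_of_real (\<Prod>i\<in>UNIV. \<phi> i (x $ i - p $ i)))
    = complex_of_real (\<Prod>i\<in>UNIV. fdiff (\<alpha> i) (\<lambda>a. \<phi> i (t * a)) / t ^ \<alpha> i)"
proof -
  have "(\<Sum>s \<in> PiE UNIV (\<lambda>i. {..\<alpha> i}). mdiff_weight \<alpha> s * (\<Prod>i\<in>UNIV. \<phi> i (t * real (s i))))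
      = (\<Sum>s \<in> PiE UNIV (\<lambda>i. {..\<alpha> i}).
          \<Prod>i\<in>UNIV. (-1) ^ (\<alpha> i - s i) * real (\<alpha> i choose s i) * \<phi> i (t * real (s i)))"
    by (simp add: mdiff_weight_def prod.distrib)
  also have "\<dots> = (\<Prod>i\<in>UNIV. fdiff (\<alpha> i) (\<lambda>a. \<phi> i (t * a)))"
    unfolding fdiff_def by (rule prod_sum_PiE[symmetric]) auto
  finally have "(\<Sum>s \<in> PiE UNIV (\<lambda>i. {..\<alpha> i}). mdiff_weight \<alpha> s * (\<Prod>i\<in>UNIV. \<phi> i (t * real (s i))))
      = (\<Prod>i\<in>UNIV. fdiff (\<alpha> i) (\<lambda>a. \<phi> i (t * a)))" .
  moreover have "1 / t ^ mdeg \<alpha> = (\<Prod>i\<in>UNIV. 1 / t ^ \<alpha> i)"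
    by (simp add: mdeg_def power_sum prod_dividef)
  ultimately have "1 / t ^ mdeg \<alpha> * (\<Sum>s \<in> PiE UNIV (\<lambda>i. {..\<alpha> i}).
       mdiff_weight \<alpha> s * (\<Prod>i\<in>UNIV. \<phi> i (t * real (s i))))
     = (\<Prod>i\<in>UNIV. fdiff (\<alpha> i) (\<lambda>a. \<phi> i (t * a)) / t ^ \<alpha> i)"
    by (simp add: prod_dividef)
  then show ?thesis
    unfolding mdiff_def grid_pt_def of_real_eq_iff[where 'a = complex, symmetric] of_real_mult of_real_sum
    by simp
qed

section \<open>Monomials in the exponential RKHS\<close>

lemma exp_kernel_sym: "exp_kernel \<sigma> p x y = exp_kernel \<sigma> p y x"
  by (simp add: exp_kernel_def inner_commute)

lemma exp_kernel_prod:
  "exp_kernel \<sigma> p x y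
    = complex_of_real (\<Prod>i\<in>UNIV. exp ((y $ i - p $ i) * ((x $ i - p $ i) / \<sigma>\<^sup>2)))"
proof -
  have "((x - p) \<bullet> (y - p)) / \<sigma>\<^sup>2 = (\<Sum>i\<in>UNIV. (y $ i - p $ i) * ((x $ i - p $ i) / \<sigma>\<^sup>2))"
    by (simp add: inner_vec_def sum_divide_distrib mult_ac)
  then show ?thesis by (simp add: exp_kernel_def exp_sum)
qed

lemma sum_fun_apply: "(\<Sum>i\<in>I. e i) x = (\<Sum>i\<in>I. e i x)"
  by (induction I rule: infinite_finite_induct) auto

locale exp_rkhs = rkhs "exp_kernel \<sigma> p" H ip
  for \<sigma> :: real and p :: "real ^ 'd::finite" and H ip +
  assumes sigma_pos: "\<sigma> > 0"
begin

abbreviation mon :: "('d \<Rightarrow> nat) \<Rightarrow> real ^ 'd \<Rightarrow> complex" where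
  "mon \<equiv> shifted_monomial p"

text \<open>The element of \<open>H\<close> that represents the functional
  \<open>mdiff p t \<alpha>\<close>. Being a finite combination of kernel sections, it lies in
  \<open>H\<close> before anything is known about derivatives of the kernel.\<close>

definition kdiff :: "('d \<Rightarrow> nat) \<Rightarrow> real \<Rightarrow> real ^ 'd \<Rightarrow> complex" where
  "kdiff \<alpha> t = cscale (complex_of_real (1 / t ^ mdeg \<alpha>))
     (\<Sum>s \<in> PiE UNIV (\<lambda>i. {..\<alpha> i}).
        cscale (complex_of_real (mdiff_weight \<alpha> s)) (exp_kernel \<sigma> p (grid_pt p t s)))"

lemma kdiff_in [simp]: "kdiff \<alpha> t \<in> H"
  unfolding kdiff_def by (intro scale_in sum_in kernel_in)

lemma ip_kdiff: "h \<in> H \<Longrightarrow> ip h (kdiff \<alpha> t) = mdiff p t \<alpha> h"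
  unfolding kdiff_def mdiff_def
  by (simp add: ip_scale_right sum_in kernel_in ip_sum_right reproducing)

lemma kdiff_apply:
  "kdiff \<alpha> t y = complex_of_real (\<Prod>i\<in>UNIV. ((exp (t * ((y $ i - p $ i) / \<sigma>\<^sup>2)) - 1) / t) ^ \<alpha> i)"
proof -
  have "kdiff \<alpha> t y = mdiff p t \<alpha> (\<lambda>x. exp_kernel \<sigma> p y x)"
    unfolding kdiff_def mdiff_def cscale_def sum_fun_apply by (simp add: exp_kernel_sym[of _ _ y])
  also have "\<dots> = mdiff p t \<alpha> (\<lambda>x. complex_of_real
      (\<Prod>i\<in>UNIV. (\<lambda>u. exp (u * ((y $ i - p $ i) / \<sigma>\<^sup>2))) (x $ i - p $ i)))"
    by (simp add: exp_kernel_prod)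
  also have "\<dots> = complex_of_real
      (\<Prod>i\<in>UNIV. fdiff (\<alpha> i) (\<lambda>a. exp (t * a * ((y $ i - p $ i) / \<sigma>\<^sup>2))) / t ^ \<alpha> i)"
    by (rule mdiff_prod)
  also have "\<dots> = complex_of_real (\<Prod>i\<in>UNIV. ((exp (t * ((y $ i - p $ i) / \<sigma>\<^sup>2)) - 1) / t) ^ \<alpha> i)"
    using fdiff_exp[of _ "t * ((y $ i - p $ i) / \<sigma>\<^sup>2)" for i] by (simp add: mult_ac power_divide)
  finally show ?thesis .
qed

text \<open>The inner product of two difference quotients of the kernel depends only on the product of the
  step sizes, so a single limit at \<open>0\<close> shows that they form a Cauchy family.\<close>

definition kdiff_gram :: "('d \<Rightarrow> nat) \<Rightarrow> real \<Rightarrow> real" where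
  "kdiff_gram \<alpha> \<tau> = (\<Prod>i\<in>UNIV. fdiff (\<alpha> i) (\<lambda>a. ((exp (\<tau> * (a / \<sigma>\<^sup>2)) - 1) / \<tau>) ^ \<alpha> i))"

lemma ip_kdiff_kdiff: "ip (kdiff \<alpha> t) (kdiff \<alpha> s) = complex_of_real (kdiff_gram \<alpha> (t * s))"
proof -
  have "ip (kdiff \<alpha> t) (kdiff \<alpha> s) = mdiff p s \<alpha> (\<lambda>y. complex_of_real
      (\<Prod>i\<in>UNIV. (\<lambda>u. ((exp (t * (u / \<sigma>\<^sup>2)) - 1) / t) ^ \<alpha> i) (y $ i - p $ i)))"
    unfolding ip_kdiff[OF kdiff_in] by (simp add: kdiff_apply[abs_def])
  also have "\<dots> = complex_of_real
      (\<Prod>i\<in>UNIV. fdiff (\<alpha> i) (\<lambda>a. ((exp (t * (s * a / \<sigma>\<^sup>2)) - 1) / t) ^ \<alpha> i) / s ^ \<alpha> i)"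
    by (rule mdiff_prod)
  also have "\<dots> = complex_of_real (kdiff_gram \<alpha> (t * s))"
    unfolding kdiff_gram_def fdiff_def sum_divide_distrib
    by (simp add: power_divide power_mult_distrib mult_ac)
  finally show ?thesis .
qed

lemma difference_quotient_exp: "((\<lambda>\<tau>. (exp (\<tau> * c) - 1) / \<tau>) \<longlongrightarrow> c) (at (0::real))"
proof -
  have "((\<lambda>\<tau>. exp (\<tau> * c)) has_real_derivative exp (0 * c) * c) (at 0)"
    by (auto intro!: derivative_eq_intros)
  then show ?thesis
    by (simp add: has_field_derivative_iff)
qed

lemma kdiff_gram_tendsto:
  "\<exists>l. (kdiff_gram \<alpha> \<longlongrightarrow> l) (at 0)"
proof -
  have "(kdiff_gram \<alpha> \<longlongrightarrow> (\<Prod>i\<in>UNIV. fdiff (\<alpha> i) (\<lambda>a. (a / \<sigma>\<^sup>2) ^ \<alpha> i))) (at 0)"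
    unfolding kdiff_gram_def[abs_def] fdiff_def
    by (intro tendsto_intros difference_quotient_exp)
  then show ?thesis by blast
qed

text \<open>Completeness of \<open>H\<close> speaks of sequences, so the limit of vanishing step
  size is taken along this one. Its values are nonzero and at most 1.\<close>

definition step :: "nat \<Rightarrow> real" where "step n = 1 / real (Suc n)"

lemma step_pos [simp]: "step n > 0" "step n \<noteq> 0"
  by (simp_all add: step_def)

lemma step_tendsto: "step \<longlonglongrightarrow> 0"
  unfolding step_def using LIMSEQ_inverse_real_of_nat by (simp add: inverse_eq_divide)

lemma step_at: "filterlim step (at 0) sequentially"
  using step_tendsto by (auto simp: filterlim_at)

lemma kdiff_step_norm:
  "(hnorm (kdiff \<alpha> (step m) - kdiff \<alpha> (step n)))\<^sup>2
    = kdiff_gram \<alpha> (step m * step m) - 2 * kdiff_gram \<alpha> (step m * step n) + kdiff_gram \<alpha> (step n * step n)"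
proof -
  have "complex_of_real ((hnorm (kdiff \<alpha> (step m) - kdiff \<alpha> (step n)))\<^sup>2)
    = complex_of_real (kdiff_gram \<alpha> (step m * step m) - 2 * kdiff_gram \<alpha> (step m * step n) + kdiff_gram \<alpha> (step n * step n))"
    unfolding ip_self[OF diff_in[OF kdiff_in kdiff_in], symmetric]
    by (simp add: ip_diff ip_diff_right ip_kdiff_kdiff mult.commute)
  then show ?thesis unfolding of_real_eq_iff .
qed

lemma kdiff_cauchy:
  assumes "e > 0"
  shows "\<exists>N. \<forall>m\<ge>N. \<forall>n\<ge>N. hnorm (kdiff \<alpha> (step m) - kdiff \<alpha> (step n)) < e"
proof -
  obtain l where l: "(kdiff_gram \<alpha> \<longlongrightarrow> l) (at 0)" using kdiff_gram_tendsto by blast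
  \<comment> \<open>The squared distance is a combination of Gram values with weights 1, -2, 1: the
    limit \<open>l\<close> cancels and the errors add up to less than four times this bound.\<close>
  have "e\<^sup>2 / 4 > 0" using assms by simp
  from LIM_D[OF l this] obtain d where d: "d > 0"
    and dl: "\<And>\<tau>. \<tau> \<noteq> 0 \<Longrightarrow> \<bar>\<tau>\<bar> < d \<Longrightarrow> \<bar>kdiff_gram \<alpha> \<tau> - l\<bar> < e\<^sup>2 / 4" by auto
  \<comment> \<open>Steps below 1 make the product of two steps smaller than either of them, hence
    below \<open>d\<close>.\<close>
  obtain N where N: "\<And>n. n \<ge> N \<Longrightarrow> step n < min 1 d"
    using order_tendstoD(2)[OF step_tendsto, of "min 1 d"] d
    by (auto simp: eventually_sequentially)
  have small: "\<bar>kdiff_gram \<alpha> (step m * step n) - l\<bar> < e\<^sup>2 / 4" if "m \<ge> N" "n \<ge> N" for m n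
  proof (rule dl)
    have "step m * step n \<le> step m * 1"
      using N[OF that(2)] by (intro mult_left_mono) (auto intro: less_imp_le)
    moreover have "step m * step n > 0" by simp
    ultimately show "\<bar>step m * step n\<bar> < d"
      using N[OF that(1)] by linarith
  qed simp
  have "hnorm (kdiff \<alpha> (step m) - kdiff \<alpha> (step n)) < e" if "m \<ge> N" "n \<ge> N" for m n
  proof -
    have "(hnorm (kdiff \<alpha> (step m) - kdiff \<alpha> (step n)))\<^sup>2 < e\<^sup>2"
      unfolding kdiff_step_norm
      using small[OF that(1,1)] small[OF that] small[OF that(2,2)] by (auto simp: abs_if split: if_splits)
    then show ?thesis using assms by (simp add: power2_less_imp_less)
  qed
  then show ?thesis by blast
qed

text \<open>Completeness provides a norm limit of the difference quotients. Evaluation at a point is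
  continuous on \<open>H\<close>, so this limit has to be their pointwise limit, a multiple of the
  monomial.\<close>

lemma scaled_mon:
  obtains "cscale (complex_of_real (1 / (\<sigma>\<^sup>2) ^ mdeg \<alpha>)) (mon \<alpha>) \<in> H"
    "(\<lambda>n. hnorm (kdiff \<alpha> (step n) - cscale (complex_of_real (1 / (\<sigma>\<^sup>2) ^ mdeg \<alpha>)) (mon \<alpha>))) \<longlonglongrightarrow> 0"
proof -
  have "\<exists>g\<in>H. (\<lambda>n. sqrt (Re (ip (kdiff \<alpha> (step n) - g) (kdiff \<alpha> (step n) - g)))) \<longlonglongrightarrow> 0"
    using kdiff_cauchy[of _ \<alpha>] by (intro complete) (simp_all add: hnorm_def)
  then obtain g where g: "g \<in> H" "(\<lambda>n. hnorm (kdiff \<alpha> (step n) - g)) \<longlonglongrightarrow> 0"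
    unfolding hnorm_def by blast
  have "g y = cscale (complex_of_real (1 / (\<sigma>\<^sup>2) ^ mdeg \<alpha>)) (mon \<alpha>) y" for y
  proof -
    have "(\<lambda>n. kdiff \<alpha> (step n) y - g y) \<longlonglongrightarrow> 0"
    proof (rule tendsto_0_le[where K = "hnorm (exp_kernel \<sigma> p y)"])
      show "(\<lambda>n. hnorm (kdiff \<alpha> (step n) - g)) \<longlonglongrightarrow> 0" by (rule g(2))
      show "\<forall>\<^sub>F n in sequentially. norm (kdiff \<alpha> (step n) y - g y)
          \<le> norm (hnorm (kdiff \<alpha> (step n) - g)) * hnorm (exp_kernel \<sigma> p y)"
        using eval_le[of "kdiff \<alpha> (step n) - g" y for n] g(1)
        by (intro always_eventually allI) (simp add: abs_of_nonneg)
    qed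
    then have "(\<lambda>n. kdiff \<alpha> (step n) y) \<longlonglongrightarrow> g y"
      by (simp add: LIM_zero_iff)
    moreover have "(\<lambda>n. kdiff \<alpha> (step n) y) \<longlonglongrightarrow>
        complex_of_real (\<Prod>i\<in>UNIV. ((y $ i - p $ i) / \<sigma>\<^sup>2) ^ \<alpha> i)"
      unfolding kdiff_apply
      by (intro tendsto_intros filterlim_compose[OF difference_quotient_exp step_at])
    ultimately have "g y = complex_of_real (\<Prod>i\<in>UNIV. ((y $ i - p $ i) / \<sigma>\<^sup>2) ^ \<alpha> i)"
      by (rule LIMSEQ_unique)
    also have "\<dots> = complex_of_real (1 / (\<sigma>\<^sup>2) ^ mdeg \<alpha>) * mon \<alpha> y"
      by (simp add: shifted_monomial_def mdeg_def power_divide prod_dividef power_sum)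
    finally show ?thesis by (simp add: cscale_def)
  qed
  then have "g = cscale (complex_of_real (1 / (\<sigma>\<^sup>2) ^ mdeg \<alpha>)) (mon \<alpha>)" by blast
  with g show ?thesis using that by blast
qed

lemma mon_in [simp]: "mon \<alpha> \<in> H"
proof -
  have "cscale (complex_of_real ((\<sigma>\<^sup>2) ^ mdeg \<alpha>)) (cscale (complex_of_real (1 / (\<sigma>\<^sup>2) ^ mdeg \<alpha>)) (mon \<alpha>)) \<in> H"
    using scaled_mon[of \<alpha>] by blast
  then show ?thesis using sigma_pos by (simp add: cfun.scale_scale)
qed

text \<open>Continuity of the inner product along the norm limit of \<open>kdiff\<close>. It makes
  \<open>ip h (mon \<alpha>)\<close> depend only on values of \<open>h\<close> near
  \<open>p\<close>, which is what composition with \<open>f\<close> can be tested on.\<close>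

lemma ip_mon_tendsto:
  assumes "h \<in> H"
  shows "(\<lambda>n. mdiff p (step n) \<alpha> h) \<longlonglongrightarrow> ip h (mon \<alpha>) / (\<sigma>\<^sup>2) ^ mdeg \<alpha>"
proof -
  define g where "g = cscale (complex_of_real (1 / (\<sigma>\<^sup>2) ^ mdeg \<alpha>)) (mon \<alpha>)"
  have g: "g \<in> H" "(\<lambda>n. hnorm (kdiff \<alpha> (step n) - g)) \<longlonglongrightarrow> 0"
    using scaled_mon[of \<alpha>] unfolding g_def by blast+
  have "(\<lambda>n. ip h (kdiff \<alpha> (step n)) - ip h g) \<longlonglongrightarrow> 0"
  proof (rule tendsto_0_le[where K = "hnorm h"])
    show "(\<lambda>n. hnorm (kdiff \<alpha> (step n) - g)) \<longlonglongrightarrow> 0" by (rule g(2))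
    show "\<forall>\<^sub>F n in sequentially. norm (ip h (kdiff \<alpha> (step n)) - ip h g)
        \<le> norm (hnorm (kdiff \<alpha> (step n) - g)) * hnorm h"
      using cauchy_schwarz[of h "kdiff \<alpha> (step n) - g" for n] g(1) assms
      by (intro always_eventually allI) (simp add: abs_of_nonneg ip_diff_right mult.commute)
  qed
  then have "(\<lambda>n. ip h (kdiff \<alpha> (step n))) \<longlonglongrightarrow> ip h g"
    by (simp add: LIM_zero_iff)
  then show ?thesis using assms by (simp add: ip_kdiff g_def ip_scale_right)
qed

text \<open>The squared norm of the monomial in \<open>H\<close>, see
  \<open>hnorm_mon\<close>.\<close>

definition mon_sq :: "('d \<Rightarrow> nat) \<Rightarrow> real" where
  "mon_sq \<alpha> = (\<Prod>i\<in>UNIV. fact (\<alpha> i)) * (\<sigma>\<^sup>2) ^ mdeg \<alpha>"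

lemma mon_sq_pos [simp]: "mon_sq \<alpha> > 0" "mon_sq \<alpha> \<noteq> 0"
  using sigma_pos by (auto simp: mon_sq_def intro!: mult_pos_pos prod_pos)

lemma mdiff_mon:
  assumes "t \<noteq> 0"
  shows "mdiff p t \<alpha> (mon \<beta>) = complex_of_real (\<Prod>i\<in>UNIV. fdiff (\<alpha> i) (\<lambda>a. a ^ \<beta> i) * t ^ \<beta> i / t ^ \<alpha> i)"
proof -
  have "fdiff (\<alpha> i) (\<lambda>a. (t * a) ^ \<beta> i) = fdiff (\<alpha> i) (\<lambda>a. a ^ \<beta> i) * t ^ \<beta> i" for i
    by (simp add: fdiff_def sum_distrib_left sum_distrib_right power_mult_distrib mult_ac)
  then show ?thesis
    unfolding shifted_monomial_def[abs_def] using mdiff_prod[of p t \<alpha> "\<lambda>i u. u ^ \<beta> i"] by simp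
qed

text \<open>Evaluate the limit in \<open>ip_mon_tendsto\<close> on a monomial. If some \<beta> i is
  below \<alpha> i, a one-dimensional difference annihilates it; if \<beta> dominates \<alpha> and
  differs from it, a positive power of the step is left over; for equality the factorials
  remain.\<close>

lemma ip_mon_mon: "ip (mon \<beta>) (mon \<alpha>) = (if \<alpha> = \<beta> then complex_of_real (mon_sq \<alpha>) else 0)"
proof -
  have lim: "(\<lambda>n. mdiff p (step n) \<alpha> (mon \<beta>)) \<longlonglongrightarrow> ip (mon \<beta>) (mon \<alpha>) / (\<sigma>\<^sup>2) ^ mdeg \<alpha>"
    by (rule ip_mon_tendsto) simp
  consider (eq) "\<alpha> = \<beta>" | (lt) "\<exists>i. \<beta> i < \<alpha> i" | (gt) "\<alpha> \<noteq> \<beta>" "\<And>i. \<alpha> i \<le> \<beta> i"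
    by (meson linorder_not_less)
  then show ?thesis
  proof cases
    case eq
    have "ip (mon \<beta>) (mon \<alpha>) / (\<sigma>\<^sup>2) ^ mdeg \<alpha> = complex_of_real (\<Prod>i\<in>UNIV. fact (\<alpha> i))"
      using lim unfolding eq by (intro LIMSEQ_unique[OF lim[unfolded eq]]) (simp add: mdiff_mon fdiff_power)
    then have "ip (mon \<beta>) (mon \<alpha>) = complex_of_real (\<Prod>i\<in>UNIV. fact (\<alpha> i)) * (\<sigma>\<^sup>2) ^ mdeg \<alpha>"
      using sigma_pos by (simp add: field_simps)
    then show ?thesis using eq by (simp add: mon_sq_def)
  next
    case lt
    then obtain j where "\<beta> j < \<alpha> j" by blast
    then have "fdiff (\<alpha> j) (\<lambda>a. a ^ \<beta> j) = 0"
      by (simp add: fdiff_power)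
    then have "mdiff p (step n) \<alpha> (mon \<beta>) = 0" for n
      by (auto simp: mdiff_mon)
    then have "ip (mon \<beta>) (mon \<alpha>) / (\<sigma>\<^sup>2) ^ mdeg \<alpha> = 0"
      using LIMSEQ_unique[OF lim, of 0] by simp
    then show ?thesis using sigma_pos \<open>\<beta> j < \<alpha> j\<close> by auto
  next
    case gt
    then obtain j where j: "\<alpha> j < \<beta> j" by (metis ext le_neq_implies_less)
    have eq: "step n ^ \<beta> i / step n ^ \<alpha> i = step n ^ (\<beta> i - \<alpha> i)" for i n
      using gt(2)[of i] by (simp add: power_diff)
    have "(\<lambda>n. \<Prod>i\<in>UNIV. fdiff (\<alpha> i) (\<lambda>a. a ^ \<beta> i) * step n ^ (\<beta> i - \<alpha> i))
        \<longlonglongrightarrow> (\<Prod>i\<in>UNIV. fdiff (\<alpha> i) (\<lambda>a. a ^ \<beta> i) * 0 ^ (\<beta> i - \<alpha> i))"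
      by (intro tendsto_intros step_tendsto)
    also have "(\<Prod>i\<in>UNIV. fdiff (\<alpha> i) (\<lambda>a. a ^ \<beta> i) * 0 ^ (\<beta> i - \<alpha> i)) = (0::real)"
      using j by (auto intro!: prod_zero bexI[of _ j])
    finally have "(\<lambda>n. mdiff p (step n) \<alpha> (mon \<beta>)) \<longlonglongrightarrow> complex_of_real 0"
      unfolding mdiff_mon[OF step_pos(2)] times_divide_eq_right[symmetric] eq
      by (rule tendsto_of_real)
    then have "ip (mon \<beta>) (mon \<alpha>) / (\<sigma>\<^sup>2) ^ mdeg \<alpha> = 0"
      using LIMSEQ_unique[OF lim, of 0] by simp
    then show ?thesis using sigma_pos gt by auto
  qed
qed

lemma mon_nonzero: "mon \<alpha> \<noteq> 0"
  using ip_mon_mon[of \<alpha> \<alpha>] by auto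

lemma hnorm_mon: "(hnorm (mon \<alpha>))\<^sup>2 = mon_sq \<alpha>"
  using ip_self[OF mon_in, of \<alpha>] ip_mon_mon[of \<alpha> \<alpha>] of_real_eq_iff[where 'a=complex] by metis

end

section \<open>Taylor expansion of the kernel\<close>

text \<open>The multi-indices are functions on the whole index type that vanish off
  \<open>A\<close>, so that an induction over finite sets of coordinates can enlarge
  \<open>A\<close> without changing types.\<close>

definition supp_deg :: "'d set \<Rightarrow> nat \<Rightarrow> ('d \<Rightarrow> nat) set" where
  "supp_deg A n = {\<alpha>. (\<forall>i. i \<notin> A \<longrightarrow> \<alpha> i = 0) \<and> sum \<alpha> A = n}"

lemma supp_deg_empty: "supp_deg {} n = (if n = 0 then {\<lambda>_. 0} else {})"
  by (auto simp: supp_deg_def)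

lemma bij_supp_deg_insert:
  assumes "finite A" "j \<notin> A"
  shows "bij_betw (\<lambda>(k, \<alpha>). \<alpha>(j := k)) (Sigma {..n} (\<lambda>k. supp_deg A (n - k))) (supp_deg (insert j A) n)"
proof (rule bij_betwI[where g = "\<lambda>\<alpha>. (\<alpha> j, \<alpha>(j := 0))"])
  have *: "sum (\<alpha>(j := k)) A = sum \<alpha> A" for \<alpha> :: "'a \<Rightarrow> nat" and k
    using assms by (intro sum.cong) auto
  show "(\<lambda>(k, \<alpha>). \<alpha>(j := k)) \<in> Sigma {..n} (\<lambda>k. supp_deg A (n - k)) \<rightarrow> supp_deg (insert j A) n"
    using assms * by (auto simp: supp_deg_def)
  show "(\<lambda>\<alpha>. (\<alpha> j, \<alpha>(j := 0))) \<in> supp_deg (insert j A) n \<rightarrow> Sigma {..n} (\<lambda>k. supp_deg A (n - k))"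
    using assms * by (auto simp: supp_deg_def)
  show "(case (\<alpha> j, \<alpha>(j := 0)) of (k, \<alpha>) \<Rightarrow> \<alpha>(j := k)) = \<alpha>" for \<alpha> :: "'a \<Rightarrow> nat"
    by simp
  show "(\<lambda>\<alpha>. (\<alpha> j, \<alpha>(j := 0))) (case x of (k, \<alpha>) \<Rightarrow> \<alpha>(j := k)) = x"
    if "x \<in> Sigma {..n} (\<lambda>k. supp_deg A (n - k))" for x
    using that assms by (auto simp: supp_deg_def fun_eq_iff)
qed

lemma finite_supp_deg: "finite A \<Longrightarrow> finite (supp_deg A n)"
proof (induction A arbitrary: n rule: finite_induct)
  case empty
  then show ?case by (simp add: supp_deg_empty)
next
  case (insert j A)
  then show ?case
    using bij_betw_finite[OF bij_supp_deg_insert[OF insert.hyps]] by blast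
qed

text \<open>The multinomial theorem divided by n!. Splitting off the exponent of the new coordinate
  reduces the induction step to the binomial theorem.\<close>

lemma multinomial:
  fixes z :: "'d \<Rightarrow> real"
  shows "finite A \<Longrightarrow> (\<Sum>\<alpha>\<in>supp_deg A n. \<Prod>i\<in>A. z i ^ \<alpha> i / fact (\<alpha> i)) = (\<Sum>i\<in>A. z i) ^ n / fact n"
proof (induction A arbitrary: n rule: finite_induct)
  case empty
  then show ?case by (simp add: supp_deg_empty)
next
  case (insert j A)
  define F where "F \<alpha> = (\<Prod>i\<in>A. z i ^ \<alpha> i / fact (\<alpha> i))" for \<alpha> :: "'d \<Rightarrow> nat"
  have F: "F (\<alpha>(j := k)) = F \<alpha>" for \<alpha> k
    unfolding F_def using insert.hyps by (intro prod.cong) auto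
  have "(\<Sum>\<alpha>\<in>supp_deg (insert j A) n. \<Prod>i\<in>insert j A. z i ^ \<alpha> i / fact (\<alpha> i))
      = (\<Sum>\<alpha>\<in>supp_deg (insert j A) n. z j ^ \<alpha> j / fact (\<alpha> j) * F \<alpha>)"
    using insert.hyps by (simp add: F_def)
  also have "\<dots> = (\<Sum>(k, \<alpha>)\<in>Sigma {..n} (\<lambda>k. supp_deg A (n - k)). z j ^ k / fact k * F \<alpha>)"
    by (subst sum.reindex_bij_betw[OF bij_supp_deg_insert[OF insert.hyps], symmetric])
      (auto simp: F intro!: sum.cong)
  also have "\<dots> = (\<Sum>k\<le>n. \<Sum>\<alpha>\<in>supp_deg A (n - k). z j ^ k / fact k * F \<alpha>)"
    by (rule sum.Sigma[symmetric]) (auto simp: finite_supp_deg insert.hyps)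
  also have "\<dots> = (\<Sum>k\<le>n. z j ^ k / fact k * ((\<Sum>i\<in>A. z i) ^ (n - k) / fact (n - k)))"
    by (intro sum.cong refl) (simp only: sum_distrib_left[symmetric] F_def insert.IH)
  also have "\<dots> = (\<Sum>k\<le>n. real (n choose k) * z j ^ k * (\<Sum>i\<in>A. z i) ^ (n - k)) / fact n"
    by (simp add: sum_divide_distrib binomial_fact field_simps)
  also have "\<dots> = (z j + (\<Sum>i\<in>A. z i)) ^ n / fact n"
    by (simp add: binomial_ring)
  finally show ?case using insert.hyps by simp
qed

definition multi_upto :: "nat \<Rightarrow> ('d::finite \<Rightarrow> nat) set" where
  "multi_upto n = {\<alpha>. mdeg \<alpha> \<le> n}"

lemma multi_upto_UN: "multi_upto n = (\<Union>j\<in>{..n}. supp_deg UNIV j)"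
  by (auto simp: multi_upto_def supp_deg_def mdeg_def)

lemma finite_multi_upto [simp]: "finite (multi_upto n)"
  unfolding multi_upto_UN by (simp add: finite_supp_deg)

lemma multi_upto_mono: "m \<le> n \<Longrightarrow> multi_upto m \<subseteq> multi_upto n"
  by (auto simp: multi_upto_def)

lemma sum_multi_upto:
  fixes z :: "'d::finite \<Rightarrow> real"
  shows "(\<Sum>\<alpha>\<in>multi_upto n. \<Prod>i\<in>UNIV. z i ^ \<alpha> i / fact (\<alpha> i)) = (\<Sum>j\<le>n. (\<Sum>i\<in>UNIV. z i) ^ j / fact j)"
proof -
  have "(\<Sum>\<alpha>\<in>multi_upto n. \<Prod>i\<in>UNIV. z i ^ \<alpha> i / fact (\<alpha> i))
      = (\<Sum>j\<le>n. \<Sum>\<alpha>\<in>supp_deg UNIV j. \<Prod>i\<in>UNIV. z i ^ \<alpha> i / fact (\<alpha> i))"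
    unfolding multi_upto_UN
    by (rule sum.UNION_disjoint) (auto simp: finite_supp_deg, auto simp: supp_deg_def)
  then show ?thesis by (simp add: multinomial)
qed

lemma exp_remainder_le:
  fixes c :: real
  assumes "c \<ge> 0"
  shows "exp c - (\<Sum>j\<le>n. c ^ j / fact j) \<le> exp c * c ^ Suc n / fact (Suc n)"
proof -
  obtain t where t: "\<bar>t\<bar> \<le> \<bar>c\<bar>"
    "exp c = (\<Sum>m<Suc n. c ^ m / fact m) + (exp t / fact (Suc n)) * c ^ Suc n"
    using Maclaurin_exp_le by blast
  have "(exp t / fact (Suc n)) * c ^ Suc n \<le> (exp c / fact (Suc n)) * c ^ Suc n"
    using t(1) assms by (intro mult_right_mono divide_right_mono) auto
  then show ?thesis using t(2) by (simp add: lessThan_Suc_atMost)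
qed

section \<open>Taylor polynomials at p as orthogonal projections, and their error\<close>

context exp_rkhs
begin

text \<open>By \<open>ip_mon_tendsto\<close> the coefficients are limits of difference quotients of
  \<open>h\<close> at \<open>p\<close> divided by factorials, that is, Taylor coefficients. The
  projection form requires no differentiability of \<open>h\<close>.\<close>

definition taylor :: "nat \<Rightarrow> (real ^ 'd \<Rightarrow> complex) \<Rightarrow> real ^ 'd \<Rightarrow> complex" where
  "taylor n h = oproj mon (multi_upto n) h"

definition rad :: "real ^ 'd \<Rightarrow> real" where
  "rad x = (norm (x - p))\<^sup>2 / \<sigma>\<^sup>2"

text \<open>Lagrange's bound for the remainder of the exponential series after degree
  \<open>n\<close>, at the point \<open>rad x\<close>; the full series has the value k(x,
  x).\<close>

definition tail :: "nat \<Rightarrow> real ^ 'd \<Rightarrow> real" where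
  "tail n x = exp (rad x) * rad x ^ Suc n / fact (Suc n)"

lemma rad_nonneg [simp]: "rad x \<ge> 0"
  by (simp add: rad_def)

lemma tail_nonneg [simp]: "tail n x \<ge> 0"
  by (simp add: tail_def)

lemma mon_orth: "\<alpha> \<noteq> \<beta> \<Longrightarrow> ip (mon \<alpha>) (mon \<beta>) = 0"
  by (simp add: ip_mon_mon)

lemma ip_mon_self: "ip (mon \<alpha>) (mon \<alpha>) = complex_of_real (mon_sq \<alpha>)"
  by (simp add: ip_mon_mon)

lemma taylor_in [simp]: "taylor n h \<in> H"
  unfolding taylor_def by (rule oproj_in) (auto simp: mon_nonzero mon_orth)

lemma ip_taylor: "h \<in> H \<Longrightarrow> \<alpha> \<in> multi_upto n \<Longrightarrow> ip (taylor n h) (mon \<alpha>) = ip h (mon \<alpha>)"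
  unfolding taylor_def by (rule ip_oproj) (auto simp: mon_nonzero mon_orth)

lemma hnorm_taylor_le: "h \<in> H \<Longrightarrow> hnorm (h - taylor n h) \<le> hnorm h"
  unfolding taylor_def by (rule hnorm_oproj_le) (auto simp: mon_nonzero mon_orth)

lemma taylor_span: "taylor n h \<in> cfun.span (mon ` multi_upto n)"
  unfolding taylor_def oproj_def
  by (intro cfun.span_sum cfun.span_scale cfun.span_base) auto

text \<open>By Pythagoras the left side is k(x, x) minus the squared norm of the projection. The
  multinomial theorem sums the latter to the partial sum of the series of
  \<open>exp (rad x)\<close>, so the difference is a remainder of that series.\<close>

lemma kernel_taylor:
  "(hnorm (exp_kernel \<sigma> p x - taylor n (exp_kernel \<sigma> p x)))\<^sup>2 \<le> tail n x"
proof -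
  let ?k = "exp_kernel \<sigma> p x"
  have "complex_of_real ((hnorm ?k)\<^sup>2) = ?k x"
    by (simp add: ip_self[OF kernel_in, symmetric] reproducing kernel_in del: of_real_power)
  also have "\<dots> = complex_of_real (exp (rad x))"
    by (simp add: exp_kernel_def rad_def power2_norm_eq_inner)
  finally have k: "(hnorm ?k)\<^sup>2 = exp (rad x)" unfolding of_real_eq_iff .
  have "cmod (ip ?k (mon \<alpha>)) = cmod (mon \<alpha> x)" for \<alpha>
    using ip_commute[OF kernel_in mon_in, of x \<alpha>] by (simp add: reproducing)
  then have term_eq: "(cmod (ip ?k (mon \<alpha>)))\<^sup>2 / (hnorm (mon \<alpha>))\<^sup>2
      = (\<Prod>i\<in>UNIV. ((x $ i - p $ i)\<^sup>2 / \<sigma>\<^sup>2) ^ \<alpha> i / fact (\<alpha> i))" for \<alpha>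
  proof -
    have "(cmod (ip ?k (mon \<alpha>)))\<^sup>2 = (\<Prod>i\<in>UNIV. (x $ i - p $ i) ^ \<alpha> i)\<^sup>2"
      unfolding \<open>cmod (ip ?k (mon \<alpha>)) = cmod (mon \<alpha> x)\<close> shifted_monomial_def norm_of_real power2_abs ..
    also have "\<dots> = (\<Prod>i\<in>UNIV. ((x $ i - p $ i)\<^sup>2) ^ \<alpha> i)"
      by (simp add: prod_power_distrib mult.commute flip: power_mult)
    finally have "(cmod (ip ?k (mon \<alpha>)))\<^sup>2 / (hnorm (mon \<alpha>))\<^sup>2
        = (\<Prod>i\<in>UNIV. ((x $ i - p $ i)\<^sup>2) ^ \<alpha> i) / (\<Prod>i\<in>UNIV. fact (\<alpha> i) * (\<sigma>\<^sup>2) ^ \<alpha> i)"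
      by (simp only: hnorm_mon mon_sq_def mdeg_def power_sum prod.distrib)
    also have "\<dots> = (\<Prod>i\<in>UNIV. ((x $ i - p $ i)\<^sup>2) ^ \<alpha> i / (fact (\<alpha> i) * (\<sigma>\<^sup>2) ^ \<alpha> i))"
      by (simp only: prod_dividef)
    also have "\<dots> = (\<Prod>i\<in>UNIV. ((x $ i - p $ i)\<^sup>2 / \<sigma>\<^sup>2) ^ \<alpha> i / fact (\<alpha> i))"
      by (simp only: power_divide divide_divide_eq_left mult.commute)
    finally show ?thesis .
  qed
  have "(norm (x - p))\<^sup>2 = (\<Sum>i\<in>UNIV. (x $ i - p $ i)\<^sup>2)"
    unfolding power2_norm_eq_inner by (simp add: inner_vec_def power2_eq_square)
  then have "rad x = (\<Sum>i\<in>UNIV. (x $ i - p $ i)\<^sup>2 / \<sigma>\<^sup>2)"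
    by (simp only: rad_def sum_divide_distrib)
  then have "(hnorm (taylor n ?k))\<^sup>2 = (\<Sum>j\<le>n. rad x ^ j / fact j)"
    unfolding taylor_def
    by (subst hnorm_oproj_sq) (auto simp: mon_nonzero mon_orth kernel_in term_eq sum_multi_upto)
  moreover have "(hnorm (?k - taylor n ?k))\<^sup>2 = (hnorm ?k)\<^sup>2 - (hnorm (taylor n ?k))\<^sup>2"
    unfolding taylor_def by (rule hnorm_oproj) (auto simp: mon_nonzero mon_orth kernel_in)
  ultimately show ?thesis
    using exp_remainder_le[OF rad_nonneg, of x n] by (simp add: k tail_def)
qed

text \<open>Since \<open>u\<close> is orthogonal to the projection of the kernel section, u(x) is
  its inner product with the projection error alone. This yields the Taylor error, and also that
  \<open>u\<close> vanishes at \<open>p\<close> to order n + 1.\<close>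

lemma eval_perp:
  assumes "u \<in> H" "\<And>\<alpha>. \<alpha> \<in> multi_upto n \<Longrightarrow> ip u (mon \<alpha>) = 0"
  shows "cmod (u x) \<le> hnorm u * sqrt (tail n x)"
proof -
  let ?k = "exp_kernel \<sigma> p x"
  have "ip u (taylor n ?k) = (\<Sum>\<alpha>\<in>multi_upto n. cnj (ip ?k (mon \<alpha>) / ip (mon \<alpha>) (mon \<alpha>)) * ip u (mon \<alpha>))"
    unfolding taylor_def oproj_def using assms(1) by (simp add: ip_sum_right ip_scale_right)
  also have "\<dots> = 0" using assms(2) by simp
  finally have "u x = ip u (?k - taylor n ?k)"
    using assms(1) by (simp add: ip_diff_right kernel_in reproducing)
  then have "cmod (u x) \<le> hnorm u * hnorm (?k - taylor n ?k)"
    using cauchy_schwarz[OF assms(1), of "?k - taylor n ?k"] by (simp add: kernel_in)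
  also have "\<dots> \<le> hnorm u * sqrt (tail n x)"
    using assms(1) kernel_taylor by (intro mult_left_mono real_le_rsqrt) auto
  finally show ?thesis .
qed

lemma taylor_error:
  assumes "h \<in> H"
  shows "cmod (h x - taylor n h x) \<le> hnorm h * sqrt (tail n x)"
proof -
  have "cmod ((h - taylor n h) x) \<le> hnorm (h - taylor n h) * sqrt (tail n x)"
    using assms by (intro eval_perp[of "h - taylor n h" n x]) (auto simp: ip_diff ip_taylor)
  also have "\<dots> \<le> hnorm h * sqrt (tail n x)"
    using assms by (intro mult_right_mono hnorm_taylor_le) auto
  finally show ?thesis by simp
qed

lemma tail_tendsto: "(\<lambda>n. tail n x * b ^ n) \<longlonglongrightarrow> 0"
proof -
  have "(\<lambda>n. (rad x * b) ^ Suc n / fact (Suc n)) \<longlonglongrightarrow> 0"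
    using LIMSEQ_Suc[OF summable_LIMSEQ_zero[OF summable_exp[of "rad x * b"]]]
    by (simp add: field_simps)
  show ?thesis
  proof (cases "b = 0")
    case True
    \<comment> \<open>The index is shifted because \<open>b ^ 0\<close> is 1 even for
      \<open>b = 0\<close>.\<close>
    then have "(\<lambda>n. tail (Suc n) x * b ^ Suc n) = (\<lambda>_. 0)" by auto
    then show ?thesis using LIMSEQ_imp_Suc[of "\<lambda>n. tail n x * b ^ n" 0] by simp
  next
    case False
    have "(\<lambda>n. exp (rad x) / b * ((rad x * b) ^ Suc n / fact (Suc n))) \<longlonglongrightarrow> exp (rad x) / b * 0"
      by (intro tendsto_intros) fact
    moreover have "exp (rad x) / b * ((rad x * b) ^ Suc n / fact (Suc n)) = tail n x * b ^ n" for n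
      using False by (simp add: tail_def power_mult_distrib)
    ultimately show ?thesis by simp
  qed
qed

text \<open>The monomials are total in \<open>H\<close>: \<open>eval_perp\<close> applies for every
  degree, and the tail tends to 0.\<close>

lemma eq_0_if_perp:
  assumes "u \<in> H" "\<And>\<alpha>. ip u (mon \<alpha>) = 0"
  shows "u = 0"
proof
  fix x
  have "(\<lambda>n. hnorm u * sqrt (tail n x)) \<longlonglongrightarrow> hnorm u * sqrt 0"
    using tail_tendsto[of x 1] by (intro tendsto_intros) simp
  then have "cmod (u x) \<le> hnorm u * sqrt 0"
    by (rule tendsto_lowerbound) (auto intro!: always_eventually eval_perp assms)
  then show "u x = 0 x" by simp
qed

end

section \<open>Jet spaces\<close>

text \<open>Differentiation in x only produces a factor that depends on y. The constant
  \<open>c\<close> lets the rule be iterated.\<close>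

lemma partial_deriv_exp_kernel:
  "partial_deriv i (\<lambda>x. c * exp_kernel \<sigma> p x y)
    = (\<lambda>x. c * complex_of_real ((y $ i - p $ i) / \<sigma>\<^sup>2) * exp_kernel \<sigma> p x y)"
proof
  fix x
  let ?e = "\<lambda>t. exp ((x - p) \<bullet> (y - p) / \<sigma>\<^sup>2 + t * ((y $ i - p $ i) / \<sigma>\<^sup>2))"
  have eq: "c * exp_kernel \<sigma> p (x + t *\<^sub>R axis i 1) y = ?e t *\<^sub>R c" for t
  proof -
    have "(x + t *\<^sub>R axis i 1 - p) \<bullet> (y - p) = ((x - p) + t *\<^sub>R axis i 1) \<bullet> (y - p)"
      by (simp add: algebra_simps)
    also have "\<dots> = (x - p) \<bullet> (y - p) + t * (y $ i - p $ i)"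
      by (simp only: inner_add_left inner_scaleR_left inner_axis') simp
    finally show ?thesis
      by (simp add: exp_kernel_def scaleR_conv_of_real add_divide_distrib)
  qed
  have "((\<lambda>t. exp (a + t * b)) has_field_derivative exp (a + 0 * b) * b) (at 0)" for a b :: real
    by (auto intro!: derivative_eq_intros)
  then have "(?e has_field_derivative ?e 0 * ((y $ i - p $ i) / \<sigma>\<^sup>2)) (at 0)" .
  from has_vector_derivative_scaleR[OF this has_vector_derivative_const[of c]]
  have "((\<lambda>t. ?e t *\<^sub>R c) has_vector_derivative (?e 0 * ((y $ i - p $ i) / \<sigma>\<^sup>2)) *\<^sub>R c) (at 0)"
    by simp
  then have "vector_derivative (\<lambda>t. ?e t *\<^sub>R c) (at 0) = (?e 0 * ((y $ i - p $ i) / \<sigma>\<^sup>2)) *\<^sub>R c"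
    by (rule vector_derivative_at)
  then show "partial_deriv i (\<lambda>x. c * exp_kernel \<sigma> p x y) x
      = c * complex_of_real ((y $ i - p $ i) / \<sigma>\<^sup>2) * exp_kernel \<sigma> p x y"
    unfolding partial_deriv_def eq by (simp add: exp_kernel_def scaleR_conv_of_real mult_ac)
qed

lemma partial_deriv_funpow_exp_kernel:
  "(partial_deriv i ^^ n) (\<lambda>x. c * exp_kernel \<sigma> p x y)
    = (\<lambda>x. c * complex_of_real (((y $ i - p $ i) / \<sigma>\<^sup>2) ^ n) * exp_kernel \<sigma> p x y)"
  by (induction n) (simp_all only: funpow.simps o_apply id_apply partial_deriv_exp_kernel, simp_all add: mult_ac)

lemma foldr_partial_deriv_exp_kernel:
  "foldr (\<lambda>i. partial_deriv i ^^ \<alpha> i) js (\<lambda>x. exp_kernel \<sigma> p x y)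
    = (\<lambda>x. complex_of_real (\<Prod>i\<leftarrow>js. ((y $ i - p $ i) / \<sigma>\<^sup>2) ^ \<alpha> i) * exp_kernel \<sigma> p x y)"
  by (induction js) (simp_all only: foldr.simps o_apply id_apply partial_deriv_funpow_exp_kernel, simp_all add: mult_ac)

text \<open>The factors produced by the derivatives commute, so the chosen enumeration of the
  coordinates is immaterial; the kernel itself equals 1 at x = p.\<close>

lemma multi_deriv_exp_kernel:
  fixes p :: "real ^ 'd::finite"
  shows "multi_deriv \<alpha> (\<lambda>x. exp_kernel \<sigma> p x y) p
    = complex_of_real (1 / (\<sigma>\<^sup>2) ^ mdeg \<alpha>) * shifted_monomial p \<alpha> y"
proof -
  define js :: "'d list" where "js = (SOME is. distinct is \<and> set is = UNIV)"
  have "\<exists>is. distinct is \<and> set is = (UNIV :: 'd set)"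
    using finite_distinct_list[OF finite] by metis
  from someI_ex[OF this] have js: "distinct js \<and> set js = UNIV"
    unfolding js_def .
  have "(\<Prod>i\<leftarrow>js. ((y $ i - p $ i) / \<sigma>\<^sup>2) ^ \<alpha> i) = (\<Prod>i\<in>UNIV. ((y $ i - p $ i) / \<sigma>\<^sup>2) ^ \<alpha> i)"
    using prod.distinct_set_conv_list[OF conjunct1[OF js], of "\<lambda>i. ((y $ i - p $ i) / \<sigma>\<^sup>2) ^ \<alpha> i"]
    unfolding conjunct2[OF js] by (rule sym)
  also have "\<dots> = 1 / (\<sigma>\<^sup>2) ^ mdeg \<alpha> * (\<Prod>i\<in>UNIV. (y $ i - p $ i) ^ \<alpha> i)"
    by (simp only: mdeg_def power_divide prod_dividef power_sum) simp
  finally have *: "(\<Prod>i\<leftarrow>js. ((y $ i - p $ i) / \<sigma>\<^sup>2) ^ \<alpha> i)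
     = 1 / (\<sigma>\<^sup>2) ^ mdeg \<alpha> * (\<Prod>i\<in>UNIV. (y $ i - p $ i) ^ \<alpha> i)" .
  show ?thesis
    unfolding multi_deriv_def js_def[symmetric] foldr_partial_deriv_exp_kernel * shifted_monomial_def
      of_real_mult by (simp add: exp_kernel_def)
qed

lemma jet_space_eq:
  assumes "\<sigma> > 0"
  shows "jet_space (exp_kernel \<sigma> p) p n = cfun.span (shifted_monomial p ` multi_upto n)"
proof -
  let ?c = "\<lambda>\<alpha>. complex_of_real (1 / (\<sigma>\<^sup>2) ^ mdeg \<alpha>)"
  have set_eq: "{\<lambda>y. multi_deriv \<alpha> (\<lambda>x. exp_kernel \<sigma> p x y) p |\<alpha>. sum \<alpha> UNIV \<le> n}
      = (\<lambda>\<alpha>. cscale (?c \<alpha>) (shifted_monomial p \<alpha>)) ` multi_upto n"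
    by (auto simp: multi_deriv_exp_kernel cscale_def multi_upto_def mdeg_def)
  show ?thesis
    unfolding jet_space_def set_eq
  proof (rule antisym)
    show "cfun.span ((\<lambda>\<alpha>. cscale (?c \<alpha>) (shifted_monomial p \<alpha>)) ` multi_upto n)
        \<subseteq> cfun.span (shifted_monomial p ` multi_upto n)"
      by (rule cfun.span_minimal[OF _ cfun.subspace_span])
        (intro image_subsetI cfun.span_scale cfun.span_base imageI)
    have "shifted_monomial p \<alpha> \<in> cfun.span ((\<lambda>\<alpha>. cscale (?c \<alpha>) (shifted_monomial p \<alpha>)) ` multi_upto n)"
      if "\<alpha> \<in> multi_upto n" for \<alpha>
    proof -
      have "shifted_monomial p \<alpha> = cscale (complex_of_real ((\<sigma>\<^sup>2) ^ mdeg \<alpha>)) (cscale (?c \<alpha>) (shifted_monomial p \<alpha>))"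
        using assms by simp
      moreover have "cscale (?c \<alpha>) (shifted_monomial p \<alpha>)
          \<in> cfun.span ((\<lambda>\<alpha>. cscale (?c \<alpha>) (shifted_monomial p \<alpha>)) ` multi_upto n)"
        using that by (intro cfun.span_base imageI)
      ultimately show ?thesis
        using cfun.span_scale[of "cscale (?c \<alpha>) (shifted_monomial p \<alpha>)" _ "complex_of_real ((\<sigma>\<^sup>2) ^ mdeg \<alpha>)"]
        by simp
    qed
    then show "cfun.span (shifted_monomial p ` multi_upto n)
        \<subseteq> cfun.span ((\<lambda>\<alpha>. cscale (?c \<alpha>) (shifted_monomial p \<alpha>)) ` multi_upto n)"
      by (intro cfun.span_minimal[OF _ cfun.subspace_span] image_subsetI)
  qed
qed

section \<open>The adjoint of the composition operator on jets\<close>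

lemma partial_deriv_segment_bound:
  fixes f :: "real ^ 'd \<Rightarrow> 'b::real_normed_vector"
  assumes diff: "\<And>x. (\<lambda>t::real. f (x + t *\<^sub>R axis j 1)) differentiable (at 0)"
    and B: "\<And>s. s \<in> closed_segment 0 u \<Longrightarrow> norm (partial_deriv j f (q + s *\<^sub>R axis j 1)) \<le> B"
  shows "norm (f (q + u *\<^sub>R axis j 1) - f q) \<le> B * \<bar>u\<bar>"
proof -
  define \<phi> where "\<phi> s = f (q + s *\<^sub>R axis j 1)" for s
  define D where "D s = partial_deriv j f (q + s *\<^sub>R axis j 1)" for s
  \<comment> \<open>\<open>partial_deriv\<close> differentiates at parameter 0 of a line, so the
    base point is moved to \<open>q + s *\<^sub>R axis j 1\<close> and the parameter shifted back by
    the chain rule.\<close>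
  have vd: "(\<phi> has_vector_derivative D s) (at s)" for s
  proof -
    have "((\<lambda>t. f ((q + s *\<^sub>R axis j 1) + t *\<^sub>R axis j 1)) has_vector_derivative D s) (at 0)"
      using diff unfolding D_def partial_deriv_def by (simp only: vector_derivative_works[symmetric])
    then have "((\<lambda>t. f ((q + s *\<^sub>R axis j 1) + t *\<^sub>R axis j 1)) has_vector_derivative D s) (at (s - s))"
      by simp
    moreover have "((\<lambda>r. r - s) has_vector_derivative 1) (at s)"
      by (auto intro!: derivative_eq_intros)
    ultimately have "((\<lambda>t. f ((q + s *\<^sub>R axis j 1) + t *\<^sub>R axis j 1)) \<circ> (\<lambda>r. r - s)
        has_vector_derivative 1 *\<^sub>R D s) (at s)"
      by (intro vector_diff_chain_at)
    moreover have "(\<lambda>t. f ((q + s *\<^sub>R axis j 1) + t *\<^sub>R axis j 1)) \<circ> (\<lambda>r. r - s) = \<phi>"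
      by (auto simp: \<phi>_def fun_eq_iff algebra_simps)
    ultimately show ?thesis by simp
  qed
  have "norm (\<phi> u - \<phi> 0) \<le> B * norm (u - 0)"
  proof (rule differentiable_bound[where S = "closed_segment 0 u" and f' = "\<lambda>s h. h *\<^sub>R D s"])
    show "(\<phi> has_derivative (\<lambda>h. h *\<^sub>R D s)) (at s within closed_segment 0 u)" for s
      using vd[of s] unfolding has_vector_derivative_def by (rule has_derivative_at_withinI)
    show "onorm (\<lambda>h. h *\<^sub>R D s) \<le> B" if "s \<in> closed_segment 0 u" for s
      using mult_right_mono[OF B[OF that] abs_ge_zero]
      by (intro onorm_le) (simp add: D_def mult.commute)
  qed auto
  then show ?thesis by (simp add: \<phi>_def)
qed

text \<open>\<open>C_diff\<close> speaks of partial derivatives only. Hence the point on the ray is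
  reached from \<open>p\<close> by moving one coordinate at a time, with the mean value inequality
  on each segment.\<close>

lemma C_diff_bound_along_ray:
  fixes f :: "real ^ 'd::finite \<Rightarrow> 'b::real_normed_vector"
  assumes "C_diff (Suc 0) f"
  obtains B where "B \<ge> 0" "\<And>t. \<lbrakk>0 \<le> t; t \<le> 1\<rbrakk> \<Longrightarrow> norm (f (p + t *\<^sub>R w) - f p) \<le> B * t"
proof -
  \<comment> \<open>The path along the axes stays within the l1-length of \<open>w\<close> from
    \<open>p\<close>, as t is at most 1; on this compact ball the partial derivatives are
    bounded.\<close>
  define R where "R = (\<Sum>i\<in>UNIV. \<bar>w $ i\<bar>)"
  have diff: "\<And>i x. (\<lambda>t::real. f (x + t *\<^sub>R axis i 1)) differentiable (at 0)"
    and cont: "\<And>i. continuous_on UNIV (partial_deriv i f)"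
    using assms by auto
  have "continuous_on (cball p R) (\<lambda>x. \<Sum>i\<in>UNIV. norm (partial_deriv i f x))"
    by (intro continuous_intros continuous_on_subset[OF cont]) auto
  then have "bounded ((\<lambda>x. \<Sum>i\<in>UNIV. norm (partial_deriv i f x)) ` cball p R)"
    by (intro compact_imp_bounded compact_continuous_image) auto
  then obtain B where "\<forall>x\<in>cball p R. norm (\<Sum>i\<in>UNIV. norm (partial_deriv i f x)) \<le> B"
    unfolding bounded_iff by blast
  then have B: "(\<Sum>i\<in>UNIV. norm (partial_deriv i f x)) \<le> B" if "x \<in> cball p R" for x
    using that by (metis abs_le_D1 real_norm_def)
  have Bi: "norm (partial_deriv i f x) \<le> B" if "x \<in> cball p R" for i x
  proof -
    have "norm (partial_deriv i f x) \<le> (\<Sum>i\<in>UNIV. norm (partial_deriv i f x))"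
      by (rule member_le_sum) auto
    then show ?thesis using B[OF that] by linarith
  qed
  have B0: "B \<ge> 0"
    using order_trans[OF norm_ge_zero Bi[of p undefined]] by (simp add: R_def sum_nonneg)
  have main: "norm (f (p + (\<Sum>i\<in>A. (t * w $ i) *\<^sub>R axis i 1)) - f p) \<le> B * (t * (\<Sum>i\<in>A. \<bar>w $ i\<bar>))"
    if t: "0 \<le> t" "t \<le> 1" and "finite A" for t A
    using \<open>finite A\<close>
  proof (induction A rule: finite_induct)
    case empty
    then show ?case by simp
  next
    case (insert j A)
    define q where "q = p + (\<Sum>i\<in>A. (t * w $ i) *\<^sub>R axis i 1)"
    have "norm (f (q + (t * w $ j) *\<^sub>R axis j 1) - f q) \<le> B * \<bar>t * w $ j\<bar>"
    proof (rule partial_deriv_segment_bound[OF diff Bi])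
      fix s assume "s \<in> closed_segment 0 (t * w $ j)"
      then have s: "\<bar>s\<bar> \<le> \<bar>t * w $ j\<bar>"
        by (auto simp: closed_segment_eq_real_ivl split: if_splits)
      have w: "\<bar>t * w $ i\<bar> \<le> \<bar>w $ i\<bar>" for i
        using t mult_right_mono[of t 1 "\<bar>w $ i\<bar>"] by (simp add: abs_mult)
      have "dist p (q + s *\<^sub>R axis j 1) = norm ((\<Sum>i\<in>A. (t * w $ i) *\<^sub>R axis i (1::real)) + s *\<^sub>R axis j 1)"
        by (subst dist_commute) (simp add: q_def dist_norm)
      also have "\<dots> \<le> (\<Sum>i\<in>A. norm ((t * w $ i) *\<^sub>R axis i (1::real))) + norm (s *\<^sub>R axis j (1::real))"
        by (intro norm_triangle_mono norm_sum order_refl)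
      also have "\<dots> \<le> (\<Sum>i\<in>A. \<bar>w $ i\<bar>) + \<bar>w $ j\<bar>"
        using w order_trans[OF s w[of j]] by (intro add_mono sum_mono) auto
      also have "\<dots> = (\<Sum>i\<in>insert j A. \<bar>w $ i\<bar>)"
        using insert.hyps by simp
      also have "\<dots> \<le> R"
        unfolding R_def by (rule sum_mono2) auto
      finally show "q + s *\<^sub>R axis j 1 \<in> cball p R" by simp
    qed
    moreover have "norm (f q - f p) \<le> B * (t * (\<Sum>i\<in>A. \<bar>w $ i\<bar>))"
      using insert.IH by (simp add: q_def)
    moreover have "norm (f (q + (t * w $ j) *\<^sub>R axis j 1) - f p)
        \<le> norm (f (q + (t * w $ j) *\<^sub>R axis j 1) - f q) + norm (f q - f p)"
      using norm_triangle_ineq[of "f (q + (t * w $ j) *\<^sub>R axis j 1) - f q" "f q - f p"] by simp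
    ultimately have "norm (f (q + (t * w $ j) *\<^sub>R axis j 1) - f p)
        \<le> B * \<bar>t * w $ j\<bar> + B * (t * (\<Sum>i\<in>A. \<bar>w $ i\<bar>))"
      by linarith
    also have "\<dots> = B * (t * (\<Sum>i\<in>insert j A. \<bar>w $ i\<bar>))"
      using insert.hyps t by (simp add: abs_mult algebra_simps)
    finally show ?case
      using insert.hyps by (simp add: q_def add.commute add.left_commute)
  qed
  have "(\<Sum>i\<in>UNIV. (t * w $ i) *\<^sub>R axis i 1) = t *\<^sub>R w" for t
    using basis_expansion[of "t *\<^sub>R w"] by (simp add: scalar_mult_eq_scaleR)
  then have "norm (f (p + t *\<^sub>R w) - f p) \<le> (B * R) * t" if "0 \<le> t" "t \<le> 1" for t
    using main[OF that, of UNIV] by (simp add: R_def mult_ac)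
  moreover have "B * R \<ge> 0" using B0 by (simp add: R_def sum_nonneg)
  ultimately show ?thesis using that by blast
qed

section \<open>Composition with f and its adjoint on polynomials\<close>

context exp_rkhs
begin

text \<open>On the difference grid of step t the values of \<open>u \<circ> f\<close> are
  O(t^(m+1)), while \<open>mdiff\<close> divides by a power of t of exponent at most m. The
  quotients are therefore O(t), and their limit is the inner product up to a nonzero factor.\<close>

lemma comp_perp:
  assumes f: "C_diff (Suc 0) f" "f p = p"
    and u: "u \<in> H" "u \<circ> f \<in> H" "\<And>\<alpha>. \<alpha> \<in> multi_upto m \<Longrightarrow> ip u (mon \<alpha>) = 0"
    and \<beta>: "\<beta> \<in> multi_upto m"
  shows "ip (u \<circ> f) (mon \<beta>) = 0"
proof -
  have "\<exists>C. \<forall>n. cmod (u (f (grid_pt p (step n) s))) \<le> C * step n ^ Suc m" for s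
  proof -
    obtain B where B: "B \<ge> 0"
      "\<And>t. \<lbrakk>0 \<le> t; t \<le> 1\<rbrakk> \<Longrightarrow> norm (f (p + t *\<^sub>R (\<chi> i. real (s i))) - f p) \<le> B * t"
      by (rule C_diff_bound_along_ray[OF f(1), of p "\<chi> i. real (s i)"]) blast
    \<comment> \<open>The image of the grid point has \<open>rad\<close> at most b t^2, hence also
      at most b. The first bound gives the power of t in the tail, the second bounds its exponential
      factor.\<close>
    define b where "b = B\<^sup>2 / \<sigma>\<^sup>2"
    define C where "C = sqrt (exp b * b ^ Suc m / fact (Suc m))"
    have "sqrt (tail m (f (grid_pt p (step n) s))) \<le> C * step n ^ Suc m" for n
    proof -
      let ?y = "f (grid_pt p (step n) s)" and ?t = "step n"
      have t: "0 \<le> ?t" "?t \<le> 1" by (simp_all add: step_def)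
      have "norm (?y - p) \<le> B * ?t"
        using B(2)[OF t] f(2) by (simp add: grid_pt_def)
      then have "rad ?y \<le> (B * ?t)\<^sup>2 / \<sigma>\<^sup>2"
        unfolding rad_def by (intro divide_right_mono power_mono) auto
      also have "\<dots> = b * ?t\<^sup>2" by (simp add: b_def power_mult_distrib)
      finally have r: "rad ?y \<le> b * ?t\<^sup>2" .
      also have "b * ?t\<^sup>2 \<le> b * 1"
        using t by (intro mult_left_mono power_le_one) (auto simp: b_def)
      finally have r1: "rad ?y \<le> b" by simp
      have "tail m ?y \<le> exp b * (b * ?t\<^sup>2) ^ Suc m / fact (Suc m)"
        unfolding tail_def using r r1
        by (intro divide_right_mono mult_mono power_mono) auto
      also have "\<dots> = (exp b * b ^ Suc m / fact (Suc m)) * (?t ^ Suc m)\<^sup>2"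
        by (simp only: power_mult_distrib times_divide_eq_left mult.assoc flip: power_mult)
          (simp only: mult.commute)
      finally have "sqrt (tail m ?y) \<le> sqrt ((exp b * b ^ Suc m / fact (Suc m)) * (?t ^ Suc m)\<^sup>2)"
        by (rule real_sqrt_le_mono)
      also have "\<dots> = C * ?t ^ Suc m"
        unfolding C_def real_sqrt_mult[of _ "(?t ^ Suc m)\<^sup>2"] using t
        by (simp only: real_sqrt_abs abs_of_nonneg zero_le_power)
      finally show ?thesis .
    qed
    then have "hnorm u * sqrt (tail m (f (grid_pt p (step n) s))) \<le> hnorm u * (C * step n ^ Suc m)" for n
      using u(1) by (intro mult_left_mono) auto
    then have "cmod (u (f (grid_pt p (step n) s))) \<le> (hnorm u * C) * step n ^ Suc m" for n
      using eval_perp[OF u(1,3), where x = "f (grid_pt p (step n) s)"] by (simp only: mult.assoc) (blast intro: order_trans)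
    then show ?thesis by blast
  qed
  then have "\<exists>C. \<forall>s n. cmod (u (f (grid_pt p (step n) s))) \<le> C s * step n ^ Suc m"
    by (intro choice allI)
  then obtain C where C: "\<And>s n. cmod (u (f (grid_pt p (step n) s))) \<le> C s * step n ^ Suc m"
    by blast
  define E where "E = (\<Sum>s \<in> PiE UNIV (\<lambda>i. {..\<beta> i}). \<bar>mdiff_weight \<beta> s\<bar> * C s)"
  have E0: "E \<ge> 0"
    \<comment> \<open>At index 0 the step is 1, where the bound reads \<open>C s\<close> directly
      and shows that it is nonnegative.\<close>
    unfolding E_def using C[of 0] step_pos(1)[of 0]
    by (intro sum_nonneg mult_nonneg_nonneg) (auto simp: step_def intro: order_trans[OF norm_ge_zero])
  have bound: "cmod (mdiff p (step n) \<beta> (u \<circ> f)) \<le> E * step n" for n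
  proof -
    let ?t = "step n"
    have t: "0 < ?t" "?t \<le> 1" by (simp_all add: step_def)
    have tk: "0 < ?t ^ k" for k using t(1) by (rule zero_less_power)
    have deg: "mdeg \<beta> \<le> m" using \<beta> by (simp add: multi_upto_def)
    have "cmod (mdiff p ?t \<beta> (u \<circ> f)) = 1 / ?t ^ mdeg \<beta> *
        cmod (\<Sum>s \<in> PiE UNIV (\<lambda>i. {..\<beta> i}). complex_of_real (mdiff_weight \<beta> s) * u (f (grid_pt p ?t s)))"
      unfolding mdiff_def norm_mult norm_of_real comp_def using tk by (simp add: abs_of_pos)
    also have "\<dots> \<le> 1 / ?t ^ mdeg \<beta> * (E * ?t ^ Suc m)"
    proof (rule mult_left_mono)
      have "cmod (\<Sum>s \<in> PiE UNIV (\<lambda>i. {..\<beta> i}). complex_of_real (mdiff_weight \<beta> s) * u (f (grid_pt p ?t s)))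
          \<le> (\<Sum>s \<in> PiE UNIV (\<lambda>i. {..\<beta> i}). \<bar>mdiff_weight \<beta> s\<bar> * (C s * ?t ^ Suc m))"
        by (intro sum_norm_le) (simp only: norm_mult norm_of_real mult_left_mono[OF C abs_ge_zero])
      then show "cmod (\<Sum>s \<in> PiE UNIV (\<lambda>i. {..\<beta> i}). complex_of_real (mdiff_weight \<beta> s) * u (f (grid_pt p ?t s)))
          \<le> E * ?t ^ Suc m"
        by (simp only: E_def sum_distrib_right mult.assoc)
    qed (use less_imp_le[OF tk] in simp)
    also have "\<dots> = E * (?t ^ Suc m / ?t ^ mdeg \<beta>)"
      by (simp only: times_divide_eq_left times_divide_eq_right mult_1)
    also have "?t ^ Suc m / ?t ^ mdeg \<beta> = ?t ^ (Suc m - mdeg \<beta>)"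
      using deg t by (intro power_diff[symmetric]) auto
    also have "E * ?t ^ (Suc m - mdeg \<beta>) \<le> E * ?t ^ 1"
      using deg t E0 by (intro mult_left_mono power_decreasing) (auto intro: less_imp_le)
    finally show ?thesis by (simp add: comp_def)
  qed
  have "(\<lambda>n. mdiff p (step n) \<beta> (u \<circ> f)) \<longlonglongrightarrow> 0"
    by (rule tendsto_0_le[OF step_tendsto, where K = E])
      (use bound in \<open>auto intro!: always_eventually simp: mult.commute abs_of_pos\<close>)
  then have "ip (u \<circ> f) (mon \<beta>) / (\<sigma>\<^sup>2) ^ mdeg \<beta> = 0"
    using LIMSEQ_unique[OF ip_mon_tendsto[OF u(2), of \<beta>]] by blast
  then show ?thesis using sigma_pos by simp
qed

lemma span_mon_in: "g \<in> cfun.span (mon ` I) \<Longrightarrow> g \<in> H"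
  using span_in[of "mon ` I"] by (auto simp: image_subset_iff)

lemma ip_span_eq_0:
  assumes "u \<in> H" "\<And>\<alpha>. \<alpha> \<in> I \<Longrightarrow> ip u (mon \<alpha>) = 0" "g \<in> cfun.span (mon ` I)"
  shows "ip u g = 0"
proof -
  have "cfun.span (mon ` I) \<subseteq> {g \<in> H. ip u g = 0}"
  proof (rule cfun.span_minimal)
    show "cfun.subspace {g \<in> H. ip u g = 0}"
      using assms(1) by (auto simp: cfun.subspace_def ip_add_right ip_scale_right)
  qed (use assms(2) in auto)
  then show ?thesis using assms(3) by auto
qed

text \<open>The hypothesis concerns powers of f, whereas \<open>mon \<alpha> \<circ> f\<close> is a
  power of f - p; the binomial theorem in each coordinate expands the latter into the
  former.\<close>

lemma mon_comp_in:
  assumes "\<And>\<alpha> :: 'd \<Rightarrow> nat. (\<lambda>x. complex_of_real (\<Prod>i\<in>UNIV. (f x $ i) ^ \<alpha> i)) \<in> H"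
  shows "mon \<alpha> \<circ> f \<in> H"
proof -
  have "mon \<alpha> (f x) = (\<Sum>s \<in> PiE UNIV (\<lambda>i. {..\<alpha> i}).
      cscale (complex_of_real (\<Prod>i\<in>UNIV. real (\<alpha> i choose s i) * (- p $ i) ^ (\<alpha> i - s i)))
        (\<lambda>x. complex_of_real (\<Prod>i\<in>UNIV. (f x $ i) ^ s i))) x" for x
  proof -
    have "(\<Prod>i\<in>UNIV. (f x $ i - p $ i) ^ \<alpha> i)
        = (\<Prod>i\<in>UNIV. \<Sum>a\<le>\<alpha> i. real (\<alpha> i choose a) * (f x $ i) ^ a * (- p $ i) ^ (\<alpha> i - a))"
      by (simp flip: binomial_ring)
    also have "\<dots> = (\<Sum>s \<in> PiE UNIV (\<lambda>i. {..\<alpha> i}). \<Prod>i\<in>UNIV.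
        real (\<alpha> i choose s i) * (f x $ i) ^ s i * (- p $ i) ^ (\<alpha> i - s i))"
      by (rule prod_sum_PiE) auto
    also have "\<dots> = (\<Sum>s \<in> PiE UNIV (\<lambda>i. {..\<alpha> i}).
        (\<Prod>i\<in>UNIV. real (\<alpha> i choose s i) * (- p $ i) ^ (\<alpha> i - s i)) * (\<Prod>i\<in>UNIV. (f x $ i) ^ s i))"
      by (intro sum.cong refl) (simp only: prod.distrib mult_ac)
    finally show ?thesis
      unfolding shifted_monomial_def sum_fun_apply cscale_def of_real_mult[symmetric] of_real_sum[symmetric]
      by (rule arg_cong)
  qed
  then have "mon \<alpha> \<circ> f = (\<Sum>s \<in> PiE UNIV (\<lambda>i. {..\<alpha> i}).
      cscale (complex_of_real (\<Prod>i\<in>UNIV. real (\<alpha> i choose s i) * (- p $ i) ^ (\<alpha> i - s i)))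
        (\<lambda>x. complex_of_real (\<Prod>i\<in>UNIV. (f x $ i) ^ s i)))"
    by (simp add: fun_eq_iff comp_def)
  also have "\<dots> \<in> H" by (intro sum_in scale_in assms)
  finally show ?thesis .
qed

context
  fixes f :: "real ^ 'd \<Rightarrow> real ^ 'd"
  assumes f_diff: "C_diff (Suc 0) f" and f_fix: "f p = p"
    and mon_comp: "\<And>\<alpha>. mon \<alpha> \<circ> f \<in> H"
begin

lemma span_comp_in:
  assumes "h \<in> cfun.span (range mon)"
  shows "h \<circ> f \<in> H"
proof -
  have "cfun.span (range mon) \<subseteq> {h. h \<circ> f \<in> H}"
  proof (rule cfun.span_minimal)
    have "(0 :: real ^ 'd \<Rightarrow> complex) \<circ> f = 0" "\<And>g h :: real ^ 'd \<Rightarrow> complex. (g + h) \<circ> f = (g \<circ> f) + (h \<circ> f)"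
      "\<And>c h. cscale c h \<circ> f = cscale c (h \<circ> f)"
      by (auto simp: fun_eq_iff cscale_def)
    then show "cfun.subspace {h. h \<circ> f \<in> H}"
      by (auto simp: cfun.subspace_def)
  qed (use mon_comp in auto)
  then show ?thesis using assms by auto
qed

text \<open>Split \<open>u\<close> into its Taylor polynomial of degree \<open>m\<close> and a
  remainder. By \<open>comp_perp\<close> the remainder contributes nothing to
  \<open>ip (u \<circ> f) g\<close>, so the functional sees only finitely many coefficients of
  \<open>u\<close> and is represented by a polynomial. The representer is unique because the
  monomials lie in the domain and are total.\<close>

lemma adjoint_jet:
  assumes g: "g \<in> cfun.span (mon ` multi_upto m)"
  defines "A \<equiv> adjoint_op H ip (comp_dom H f) (comp_op f) g"
  shows "A \<in> cfun.span (mon ` multi_upto m)"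
    and "\<And>u. u \<in> H \<Longrightarrow> u \<circ> f \<in> H \<Longrightarrow> ip (u \<circ> f) g = ip u A"
proof -
  \<comment> \<open>The coefficients are forced by testing with monomials, which gives
    \<open>ip (mon \<alpha>) h = ip (mon \<alpha> \<circ> f) g\<close>; the conjugate compensates
    the antilinear second argument.\<close>
  define h where "h = (\<Sum>\<alpha>\<in>multi_upto m. cscale (cnj (ip (mon \<alpha> \<circ> f) g) / mon_sq \<alpha>) (mon \<alpha>))"
  have hs: "h \<in> cfun.span (mon ` multi_upto m)"
    unfolding h_def by (intro cfun.span_sum cfun.span_scale cfun.span_base) auto
  have gH: "g \<in> H" using g by (rule span_mon_in)
  have hH: "h \<in> H" using hs by (rule span_mon_in)
  have key: "ip (u \<circ> f) g = ip u h" if u: "u \<in> H" "u \<circ> f \<in> H" for u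
  proof -
    define T where "T = taylor m u"
    have T: "T = (\<Sum>\<alpha>\<in>multi_upto m. cscale (ip u (mon \<alpha>) / mon_sq \<alpha>) (mon \<alpha>))"
      unfolding T_def taylor_def oproj_def ip_mon_self ..
    have "T \<in> cfun.span (range mon)"
      using taylor_span[of m u] cfun.span_mono[of "mon ` multi_upto m" "range mon"] unfolding T_def by blast
    then have TfH: "T \<circ> f \<in> H" by (rule span_comp_in)
    have Tf: "T \<circ> f = (\<Sum>\<alpha>\<in>multi_upto m. cscale (ip u (mon \<alpha>) / mon_sq \<alpha>) (mon \<alpha> \<circ> f))"
      unfolding T by (simp add: fun_eq_iff sum_fun_apply cscale_def)
    have diff: "(u - T) \<circ> f = (u \<circ> f) - (T \<circ> f)" by (simp add: fun_eq_iff)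
    have "ip ((u - T) \<circ> f) g = 0"
    proof (rule ip_span_eq_0[OF _ _ g])
      show "(u - T) \<circ> f \<in> H" unfolding diff using u TfH by simp
      then show "ip ((u - T) \<circ> f) (mon \<alpha>) = 0" if "\<alpha> \<in> multi_upto m" for \<alpha>
        using u that by (intro comp_perp[OF f_diff f_fix, of _ m]) (auto simp: T_def ip_diff ip_taylor)
    qed
    then have "ip (u \<circ> f) g = ip (T \<circ> f) g"
      unfolding diff using u TfH gH by (simp add: ip_diff)
    also have "\<dots> = (\<Sum>\<alpha>\<in>multi_upto m. ip u (mon \<alpha>) / mon_sq \<alpha> * ip (mon \<alpha> \<circ> f) g)"
      unfolding Tf using gH mon_comp by (simp add: ip_sum ip_scale)
    also have "\<dots> = ip u h"
      unfolding h_def using u by (simp add: ip_sum_right ip_scale_right mult_ac)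
    finally show ?thesis .
  qed
  have "A = h"
    unfolding A_def adjoint_op_def
  proof (rule the_equality)
    show "h \<in> H \<and> (\<forall>u\<in>comp_dom H f. ip (comp_op f u) g = ip u h)"
      using hH key by (auto simp: comp_dom_def comp_op_def)
    fix h' assume h': "h' \<in> H \<and> (\<forall>u\<in>comp_dom H f. ip (comp_op f u) g = ip u h')"
    have "ip (mon \<alpha>) h' = ip (mon \<alpha>) h" for \<alpha>
      using h' key[OF mon_in mon_comp] mon_comp by (auto simp: comp_dom_def comp_op_def)
    then have "ip (mon \<alpha>) (h' - h) = 0" for \<alpha>
      using h' hH by (simp add: ip_diff_right)
    then have "ip (h' - h) (mon \<alpha>) = 0" for \<alpha>
      using ip_commute[of "h' - h" "mon \<alpha>"] h' hH by simp
    then have "h' - h = 0"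
      using h' hH by (intro eq_0_if_perp) auto
    then show "h' = h" by simp
  qed
  then show "A \<in> cfun.span (mon ` multi_upto m)"
    "\<And>u. u \<in> H \<Longrightarrow> u \<circ> f \<in> H \<Longrightarrow> ip (u \<circ> f) g = ip u A"
    using hs key by auto
qed

end

end

lemma representation_span_image:
  assumes "inj_on e I" "finite I" "cfun.independent (e ` I)" "i \<in> I"
    and h: "h = (\<Sum>i\<in>I. cscale (c i) (e i))"
  shows "cfun.representation (e ` I) h (e i) = c i"
proof -
  have e: "e j \<in> cfun.span (e ` I)" if "j \<in> I" for j
    using that by (intro cfun.span_base imageI)
  have "cfun.representation (e ` I) h b = (\<Sum>j\<in>I. cfun.representation (e ` I) (cscale (c j) (e j)) b)" for b
    unfolding h using cfun.representation_sum[OF assms(3), of I "\<lambda>j. cscale (c j) (e j)"]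
      cfun.span_scale[OF e] by simp
  then have "cfun.representation (e ` I) h (e i) = (\<Sum>j\<in>I. c j * cfun.representation (e ` I) (e j) (e i))"
    by (simp add: cfun.representation_scale[OF assms(3) e])
  also have "\<dots> = (\<Sum>j\<in>I. if j = i then c j else 0)"
    using assms by (intro sum.cong refl) (auto simp: cfun.representation_basis inj_on_eq_iff)
  finally show ?thesis using assms by simp
qed

section \<open>Coefficients of polynomials controlled by their mean\<close>

lemma power_le_exp_fact:
  fixes x :: real
  assumes "0 \<le> x"
  shows "x ^ n / fact n \<le> exp x"
proof -
  have "(\<lambda>n. x ^ n /\<^sub>R fact n) sums exp x" by (rule exp_converges)
  then have "summable (\<lambda>n. x ^ n /\<^sub>R fact n)" "exp x = (\<Sum>n. x ^ n /\<^sub>R fact n)"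
    by (simp_all add: sums_iff)
  then have "sum (\<lambda>n. x ^ n /\<^sub>R fact n) {n} \<le> exp x"
    using assms sum_le_suminf[of "\<lambda>n. x ^ n /\<^sub>R fact n" "{n}"] by simp
  then show ?thesis by (simp add: field_simps)
qed

text \<open>A bound for the coefficients of the \<open>l\<close>-th Lagrange basis polynomial of degree \<open>n\<close> for equispaced
  nodes in \<open>[-R, R]\<close> with spacing \<open>\<delta> / (n + 1)\<close>.\<close>

definition lagrange_bound :: "real \<Rightarrow> real \<Rightarrow> nat \<Rightarrow> nat \<Rightarrow> real" where
  "lagrange_bound R \<delta> n l = ((1 + R) * (real n + 1) / \<delta>) ^ n / (fact l * fact (n - l))"

lemma lagrange_bound_nonneg: "0 \<le> R \<Longrightarrow> 0 < \<delta> \<Longrightarrow> 0 \<le> lagrange_bound R \<delta> n l"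
  by (simp add: lagrange_bound_def)

text \<open>The factorials sum to 2^n / n!, and (n + 1)^n / n! is a single term of the series of
  e^(n + 1). The growth is therefore geometric.\<close>

lemma sum_lagrange_bound:
  assumes "0 \<le> R" "0 < \<delta>"
  shows "\<exists>A\<ge>1. \<forall>n. (\<Sum>l\<le>n. lagrange_bound R \<delta> n l) \<le> A ^ Suc n"
proof -
  define Q where "Q = (1 + R) / \<delta>"
  have Q: "Q \<ge> 0" using assms by (simp add: Q_def)
  define A where "A = exp 1 * max 1 (2 * Q)"
  have "1 * 1 \<le> A" unfolding A_def by (intro mult_mono) auto
  then have "A \<ge> 1" by simp
  moreover have "(\<Sum>l\<le>n. lagrange_bound R \<delta> n l) \<le> A ^ Suc n" for n
  proof -
    have "(\<Sum>l\<le>n. lagrange_bound R \<delta> n l) = (\<Sum>l\<le>n. Q ^ n * (real n + 1) ^ n / fact n * real (n choose l))"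
    proof (intro sum.cong refl)
      fix l assume "l \<in> {..n}"
      then have "real (n choose l) = fact n / (fact l * fact (n - l))"
        by (simp add: binomial_fact)
      moreover have "(1 + R) * (real n + 1) / \<delta> = Q * (real n + 1)" by (simp add: Q_def)
      ultimately show "lagrange_bound R \<delta> n l = Q ^ n * (real n + 1) ^ n / fact n * real (n choose l)"
        unfolding lagrange_bound_def by (simp add: power_mult_distrib)
    qed
    also have "\<dots> = Q ^ n * (real n + 1) ^ n / fact n * 2 ^ n"
      unfolding sum_distrib_left[symmetric] of_nat_sum[symmetric] choose_row_sum by simp
    also have "\<dots> = (2 * Q) ^ n * ((real n + 1) ^ n / fact n)"
      by (simp add: power_mult_distrib)
    also have "\<dots> \<le> max 1 (2 * Q) ^ Suc n * exp (real n + 1)"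
    proof (rule mult_mono)
      have "(2 * Q) ^ n \<le> max 1 (2 * Q) ^ n" using Q by (intro power_mono) auto
      also have "\<dots> \<le> max 1 (2 * Q) ^ Suc n" by (intro power_increasing) auto
      finally show "(2 * Q) ^ n \<le> max 1 (2 * Q) ^ Suc n" .
    qed (auto intro: power_le_exp_fact)
    also have "exp (real n + 1) = exp 1 ^ Suc n"
      using exp_of_nat_mult[of "Suc n" "1 :: real"] by (simp add: add.commute)
    also have "max 1 (2 * Q) ^ Suc n * exp 1 ^ Suc n = A ^ Suc n"
      by (simp only: A_def power_mult_distrib mult.commute)
    finally show ?thesis .
  qed
  ultimately show ?thesis by blast
qed

text \<open>Multiplication by X - x raises the largest absolute coefficient by a factor of at most 1
  + |x|.\<close>

lemma coeff_prod_linear_le: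
  fixes x :: "'i \<Rightarrow> real"
  shows "finite A \<Longrightarrow> \<bar>coeff (\<Prod>k\<in>A. [:- x k, 1:]) a\<bar> \<le> (\<Prod>k\<in>A. 1 + \<bar>x k\<bar>)"
proof (induction A arbitrary: a rule: finite_induct)
  case empty
  then show ?case by (cases a) auto
next
  case (insert j A)
  define q where "q = (\<Prod>k\<in>A. [:- x k, 1:])"
  define C where "C = (\<Prod>k\<in>A. 1 + \<bar>x k\<bar>)"
  have IH: "\<bar>coeff q a\<bar> \<le> C" for a using insert.IH by (simp add: q_def C_def)
  have C0: "C \<ge> 0" by (simp add: C_def prod_nonneg)
  have "coeff ([:- x j, 1:] * q) a = - x j * coeff q a + (case a of 0 \<Rightarrow> 0 | Suc a' \<Rightarrow> coeff q a')"
    by (simp add: coeff_pCons split: nat.split)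
  then have "\<bar>coeff ([:- x j, 1:] * q) a\<bar> \<le> \<bar>x j\<bar> * \<bar>coeff q a\<bar> + \<bar>case a of 0 \<Rightarrow> 0 | Suc a' \<Rightarrow> coeff q a'\<bar>"
    using abs_triangle_ineq[of "- x j * coeff q a"] by (simp add: abs_mult)
  also have "\<dots> \<le> \<bar>x j\<bar> * C + C"
    using IH C0 by (intro add_mono mult_left_mono) (auto split: nat.split)
  finally show ?case
    using insert.hyps by (simp add: q_def C_def algebra_simps)
qed

lemma prod_abs_diff_fact:
  assumes "l \<le> n"
  shows "(\<Prod>k\<in>{..n} - {l}. \<bar>real l - real k\<bar>) = fact l * fact (n - l)"
proof -
  have split: "{..n} - {l} = {..<l} \<union> {l<..n}" using assms by auto
  have "(\<Prod>k\<in>{..n} - {l}. \<bar>real l - real k\<bar>)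
      = (\<Prod>k<l. \<bar>real l - real k\<bar>) * (\<Prod>k\<in>{l<..n}. \<bar>real l - real k\<bar>)"
    unfolding split by (rule prod.union_disjoint) auto
  also have "(\<Prod>k<l. \<bar>real l - real k\<bar>) = (\<Prod>k=1..l. real k)"
    by (rule prod.reindex_bij_witness[of _ "\<lambda>k. l - k" "\<lambda>k. l - k"]) (auto simp: of_nat_diff)
  also have "(\<Prod>k\<in>{l<..n}. \<bar>real l - real k\<bar>) = (\<Prod>k=1..n - l. real k)"
    by (rule prod.reindex_bij_witness[of _ "\<lambda>k. k + l" "\<lambda>k. k - l"]) (auto simp: of_nat_diff)
  finally show ?thesis by (simp add: fact_prod)
qed

text \<open>\<open>w l\<close> is the coefficient of X^a in the Lagrange basis polynomial of node
  \<open>l\<close>. Interpolation reproduces X^b for b at most n, so the weighted sum of node values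
  reads off the coefficient of X^a.\<close>

lemma lagrange_weights:
  fixes s \<delta> R :: real
  assumes "\<delta> > 0" "\<bar>s\<bar> + \<delta> \<le> R"
  shows "\<exists>w. (\<forall>b\<le>n. (\<Sum>l\<le>n. w l * (s + \<delta> / (real n + 1) * real l) ^ b) = (if b = a then 1 else 0)) \<and>
    (\<forall>l\<le>n. \<bar>w l\<bar> \<le> lagrange_bound R \<delta> n l)"
proof -
  \<comment> \<open>With this spacing the nodes 0, ..., n stay within distance \<delta> of
    \<open>s\<close> for every \<open>n\<close>.\<close>
  define h where "h = \<delta> / (real n + 1)"
  have h: "h > 0" using assms by (simp add: h_def)
  define x where "x l = s + h * real l" for l :: nat
  have x_inj: "inj_on x {..n}" using h by (auto simp: inj_on_def x_def)
  have x_bd: "\<bar>x l\<bar> \<le> R" if "l \<le> n" for l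
  proof -
    have "h * real l \<le> h * (real n + 1)" using that h by (intro mult_left_mono) auto
    then have "\<bar>h * real l\<bar> \<le> \<delta>" using h assms by (simp add: h_def)
    then show ?thesis using assms abs_triangle_ineq[of s "h * real l"] by (simp add: x_def)
  qed
  define q where "q l = (\<Prod>k\<in>{..n} - {l}. [:- x k, 1:])" for l
  define d where "d l = (\<Prod>k\<in>{..n} - {l}. x l - x k)" for l
  have d: "d l \<noteq> 0" if "l \<le> n" for l
    using that x_inj by (auto simp: d_def inj_on_def)
  have poly_q: "poly (q l) (x j) = (if j = l then d l else 0)" if "l \<le> n" "j \<le> n" for l j
    using that by (auto simp: q_def d_def poly_prod)
  have deg_q: "degree (q l) \<le> n" if "l \<le> n" for l
  proof -
    have "degree (q l) \<le> sum (degree \<circ> (\<lambda>k. [:- x k, 1:])) ({..n} - {l})"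
      unfolding q_def by (rule degree_prod_sum_le) auto
    then show ?thesis using that by (simp add: comp_def)
  qed
  define w where "w l = coeff (q l) a / d l" for l
  show ?thesis
  proof (intro exI[of _ w] conjI allI impI)
    fix b assume b: "b \<le> n"
    have "monom 1 b = (\<Sum>l\<le>n. Polynomial.smult (x l ^ b / d l) (q l))"
    proof (rule poly_eqI_degree[where A = "x ` {..n}"])
      show "poly (monom 1 b) z = poly (\<Sum>l\<le>n. Polynomial.smult (x l ^ b / d l) (q l)) z" if z: "z \<in> x ` {..n}" for z
      proof -
        obtain j where "j \<in> {..n}" "z = x j" using z by blast
        then have j: "j \<le> n" "z = x j" by simp_all
        have "poly (\<Sum>l\<le>n. Polynomial.smult (x l ^ b / d l) (q l)) z = (\<Sum>l\<le>n. if l = j then x j ^ b else 0)"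
          unfolding poly_sum j(2) using j d by (intro sum.cong) (auto simp: poly_q)
        then show ?thesis using j by (simp add: poly_monom)
      qed
      show "card (x ` {..n}) > degree (monom (1::real) b)"
        using b by (simp add: card_image[OF x_inj] degree_monom_eq)
      have "degree (\<Sum>l\<le>n. Polynomial.smult (x l ^ b / d l) (q l)) \<le> n"
      proof (rule degree_sum_le)
        show "degree (Polynomial.smult (x l ^ b / d l) (q l)) \<le> n" if "l \<in> {..n}" for l
          using that by (intro order_trans[OF degree_smult_le deg_q]) simp
      qed simp
      then show "card (x ` {..n}) > degree (\<Sum>l\<le>n. Polynomial.smult (x l ^ b / d l) (q l))"
        by (simp add: card_image[OF x_inj])
    qed
    then have "coeff (monom 1 b) a = (\<Sum>l\<le>n. x l ^ b / d l * coeff (q l) a)"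
      by (simp add: coeff_sum)
    then show "(\<Sum>l\<le>n. w l * (s + \<delta> / (real n + 1) * real l) ^ b) = (if b = a then 1 else 0)"
      by (simp add: w_def x_def h_def mult_ac)
  next
    fix l assume l: "l \<le> n"
    have card: "card ({..n} - {l}) = n" using l by simp
    have "\<bar>coeff (q l) a\<bar> \<le> (\<Prod>k\<in>{..n} - {l}. 1 + \<bar>x k\<bar>)"
      unfolding q_def by (rule coeff_prod_linear_le) auto
    also have "\<dots> \<le> (\<Prod>k\<in>{..n} - {l}. 1 + R)"
      using x_bd by (intro prod_mono) auto
    also have "\<dots> = (1 + R) ^ n" by (simp only: prod_constant card)
    finally have num: "\<bar>coeff (q l) a\<bar> \<le> (1 + R) ^ n" .
    have "\<bar>d l\<bar> = (\<Prod>k\<in>{..n} - {l}. h * \<bar>real l - real k\<bar>)"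
      unfolding d_def abs_prod using h
      by (intro prod.cong) (auto simp: x_def abs_mult simp flip: right_diff_distrib)
    also have "\<dots> = h ^ n * (fact l * fact (n - l))"
      by (simp only: prod.distrib prod_constant card prod_abs_diff_fact[OF l])
    finally have den: "\<bar>d l\<bar> = h ^ n * (fact l * fact (n - l))" .
    have "\<bar>w l\<bar> \<le> (1 + R) ^ n / (h ^ n * (fact l * fact (n - l)))"
      unfolding w_def abs_divide den using num h by (intro divide_right_mono) auto
    also have "\<dots> = lagrange_bound R \<delta> n l"
      unfolding lagrange_bound_def h_def by (simp add: power_divide power_mult_distrib)
    finally show "\<bar>w l\<bar> \<le> lagrange_bound R \<delta> n l" .
  qed
qed

section \<open>Interpolation on product grids and averaging over their translates\<close>

definition mpoly_of :: "real ^ 'd::finite \<Rightarrow> nat \<Rightarrow> (('d \<Rightarrow> nat) \<Rightarrow> complex) \<Rightarrow> real ^ 'd \<Rightarrow> complex" where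
  "mpoly_of p n c x = (\<Sum>\<beta>\<in>multi_upto n. c \<beta> * shifted_monomial p \<beta> x)"

lemma continuous_shifted_monomial: "continuous_on S (shifted_monomial p \<alpha>)"
  unfolding shifted_monomial_def by (intro continuous_intros)

lemma continuous_mpoly_of: "continuous_on S (mpoly_of p n c)"
  unfolding mpoly_of_def by (intro continuous_intros continuous_shifted_monomial)

lemma le_mdeg: "\<alpha> i \<le> mdeg \<alpha>"
  unfolding mdeg_def by (rule member_le_sum) auto

text \<open>Products of one-dimensional weights extract one multi-index. Total degree at most n
  bounds each exponent by n, so the one-dimensional exactness applies in every coordinate. The grid
  starts at \<open>y\<close>, the monomials are centred at \<open>p\<close>.\<close>

lemma coeff_le_grid_sum:
  fixes p y :: "real ^ 'd::finite"
  assumes \<delta>: "\<delta> > 0" and R: "\<And>i. \<bar>y $ i - p $ i\<bar> + \<delta> \<le> R" and \<alpha>: "\<alpha> \<in> multi_upto n"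
  shows "cmod (c \<alpha>) \<le> (\<Sum>l \<in> PiE UNIV (\<lambda>_. {..n}). (\<Prod>i\<in>UNIV. lagrange_bound R \<delta> n (l i)) *
    cmod (mpoly_of p n c (grid_pt y (\<delta> / (real n + 1)) l)))"
proof -
  let ?h = "\<delta> / (real n + 1)"
  have "\<exists>w. \<forall>i. (\<forall>b\<le>n. (\<Sum>l\<le>n. w i l * ((y $ i - p $ i) + ?h * real l) ^ b) = (if b = \<alpha> i then 1 else 0)) \<and>
    (\<forall>l\<le>n. \<bar>w i l\<bar> \<le> lagrange_bound R \<delta> n l)"
    by (intro choice allI lagrange_weights \<delta> R)
  then obtain w where w: "\<And>i b. b \<le> n \<Longrightarrow>
      (\<Sum>l\<le>n. w i l * ((y $ i - p $ i) + ?h * real l) ^ b) = (if b = \<alpha> i then 1 else 0)"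
    and wb: "\<And>i l. l \<le> n \<Longrightarrow> \<bar>w i l\<bar> \<le> lagrange_bound R \<delta> n l"
    by blast
  define W where "W l = (\<Prod>i\<in>UNIV. w i (l i))" for l :: "'d \<Rightarrow> nat"
  have mono: "(\<Sum>l \<in> PiE UNIV (\<lambda>_. {..n}). complex_of_real (W l) * shifted_monomial p \<beta> (grid_pt y ?h l))
      = (if \<beta> = \<alpha> then 1 else 0)" if \<beta>: "\<beta> \<in> multi_upto n" for \<beta>
  proof -
    have "(\<Sum>l \<in> PiE UNIV (\<lambda>_. {..n}). complex_of_real (W l) * shifted_monomial p \<beta> (grid_pt y ?h l))
        = complex_of_real (\<Sum>l \<in> PiE UNIV (\<lambda>_. {..n}).
            \<Prod>i\<in>UNIV. w i (l i) * ((y $ i - p $ i) + ?h * real (l i)) ^ \<beta> i)"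
      by (simp add: W_def shifted_monomial_def grid_pt_def prod.distrib algebra_simps)
    also have "(\<Sum>l \<in> PiE UNIV (\<lambda>_. {..n}).
            \<Prod>i\<in>UNIV. w i (l i) * ((y $ i - p $ i) + ?h * real (l i)) ^ \<beta> i)
        = (\<Prod>i\<in>UNIV. \<Sum>l\<le>n. w i l * ((y $ i - p $ i) + ?h * real l) ^ \<beta> i)"
      by (rule prod_sum_PiE[symmetric]) auto
    also have "\<dots> = (\<Prod>i\<in>UNIV. if \<beta> i = \<alpha> i then 1 else 0)"
      using \<beta> le_mdeg[of \<beta>] by (intro prod.cong refl w) (auto simp: multi_upto_def intro: order_trans)
    also have "\<dots> = (if \<beta> = \<alpha> then 1 else 0)"
      by (auto simp: fun_eq_iff)
    finally show ?thesis by simp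
  qed
  have "(\<Sum>l \<in> PiE UNIV (\<lambda>_. {..n}). complex_of_real (W l) * mpoly_of p n c (grid_pt y ?h l))
      = (\<Sum>\<beta>\<in>multi_upto n. c \<beta> * (\<Sum>l \<in> PiE UNIV (\<lambda>_. {..n}).
          complex_of_real (W l) * shifted_monomial p \<beta> (grid_pt y ?h l)))"
    unfolding mpoly_of_def sum_distrib_left by (subst sum.swap) (simp only: mult_ac)
  also have "\<dots> = (\<Sum>\<beta>\<in>multi_upto n. if \<beta> = \<alpha> then c \<alpha> else 0)"
    by (intro sum.cong refl) (simp add: mono)
  also have "\<dots> = c \<alpha>" using \<alpha> by simp
  finally have "cmod (c \<alpha>) = cmod (\<Sum>l \<in> PiE UNIV (\<lambda>_. {..n}). complex_of_real (W l) * mpoly_of p n c (grid_pt y ?h l))"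
    by simp
  also have "\<dots> \<le> (\<Sum>l \<in> PiE UNIV (\<lambda>_. {..n}). (\<Prod>i\<in>UNIV. lagrange_bound R \<delta> n (l i)) *
    cmod (mpoly_of p n c (grid_pt y ?h l)))"
  proof (rule sum_norm_le)
    fix l :: "'d \<Rightarrow> nat" assume "l \<in> PiE UNIV (\<lambda>_. {..n})"
    then have "\<bar>W l\<bar> \<le> (\<Prod>i\<in>UNIV. lagrange_bound R \<delta> n (l i))"
      unfolding W_def abs_prod by (intro prod_mono) (auto intro!: wb)
    then show "cmod (complex_of_real (W l) * mpoly_of p n c (grid_pt y ?h l))
        \<le> (\<Prod>i\<in>UNIV. lagrange_bound R \<delta> n (l i)) * cmod (mpoly_of p n c (grid_pt y ?h l))"
      unfolding norm_mult norm_of_real by (intro mult_right_mono) auto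
  qed
  finally show ?thesis .
qed

lemma nn_integral_lborel_translate:
  fixes F :: "'a::euclidean_space \<Rightarrow> ennreal"
  assumes [measurable]: "F \<in> borel_measurable borel"
  shows "(\<integral>\<^sup>+y. F (y + v) \<partial>lborel) = (\<integral>\<^sup>+y. F y \<partial>lborel)"
proof -
  have "(\<integral>\<^sup>+y. F y \<partial>lborel) = (\<integral>\<^sup>+y. F y \<partial>distr lborel borel ((+) v))"
    by (simp only: lborel_distr_plus)
  also have "\<dots> = (\<integral>\<^sup>+y. F (v + y) \<partial>lborel)"
    by (rule nn_integral_distr) auto
  finally show ?thesis by (simp add: add.commute)
qed

lemma cbox_in_open:
  fixes U :: "(real ^ 'd::finite) set"
  assumes "open U" "U \<noteq> {}"
  shows "\<exists>\<delta>>0. \<exists>c0. \<forall>y. (\<forall>i. c0 $ i \<le> y $ i \<and> y $ i \<le> c0 $ i + 2 * \<delta>) \<longrightarrow> y \<in> U"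
proof -
  obtain c0 where "c0 \<in> U" using assms by blast
  then obtain e where e: "e > 0" "ball c0 e \<subseteq> U" using assms open_contains_ball by blast
  \<comment> \<open>A point of the box is at l1-distance at most 2 \<delta> times the dimension from
    \<open>c0\<close>, which is e / 2.\<close>
  define \<delta> where "\<delta> = e / (4 * real CARD('d))"
  show ?thesis
  proof (intro exI[of _ \<delta>] exI[of _ c0] conjI allI impI)
    show "\<delta> > 0" using e by (simp add: \<delta>_def)
    fix y assume "\<forall>i. c0 $ i \<le> y $ i \<and> y $ i \<le> c0 $ i + 2 * \<delta>"
    then have y: "\<And>i. c0 $ i \<le> y $ i \<and> y $ i \<le> c0 $ i + 2 * \<delta>" by blast
    have yi: "\<bar>(y - c0) $ i\<bar> \<le> 2 * \<delta>" for i using y[of i] by (simp add: abs_le_iff)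
    have "norm (y - c0) \<le> (\<Sum>i\<in>UNIV. \<bar>(y - c0) $ i\<bar>)" by (rule norm_le_l1_cart)
    also have "\<dots> \<le> (\<Sum>i\<in>(UNIV :: 'd set). 2 * \<delta>)" by (intro sum_mono yi)
    also have "\<dots> = e / 2" by (simp add: \<delta>_def)
    also have "\<dots> < e" using e by simp
    finally have "y \<in> ball c0 e" by (simp add: dist_norm norm_minus_commute)
    then show "y \<in> U" using e by blast
  qed
qed

text \<open>The grid inequality is integrated over the starting point y in a cube of side \<delta>.
  All grid points stay in the cube of side 2 \<delta> inside U, so by translation invariance each
  grid term is bounded by the same integral, and there Lebesgue measure is dominated by the law up
  to 1 / \<epsilon>.\<close>

lemma coeff_le_mean:
  fixes p :: "real ^ 'd::finite" and \<rho> :: "real ^ 'd \<Rightarrow> real"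
  assumes U: "open U" "U \<noteq> {}" and \<epsilon>: "\<epsilon> > 0" "AE x in lborel. x \<in> U \<longrightarrow> \<epsilon> \<le> \<rho> x"
    and [measurable]: "(\<lambda>x. ennreal (\<rho> x)) \<in> borel_measurable lborel"
  obtains B A where "B \<ge> 0" "A \<ge> 1"
    "\<And>n c \<alpha>. \<alpha> \<in> multi_upto n \<Longrightarrow> ennreal (cmod (c \<alpha>))
       \<le> ennreal (B * A ^ Suc n) * (\<integral>\<^sup>+x. ennreal (cmod (mpoly_of p n c x)) \<partial>density lborel (\<lambda>x. ennreal (\<rho> x)))"
proof -
  obtain c0 \<delta> where \<delta>: "\<delta> > 0" and box: "\<forall>y. (\<forall>i. c0 $ i \<le> y $ i \<and> y $ i \<le> c0 $ i + 2 * \<delta>) \<longrightarrow> y \<in> U"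
    using cbox_in_open[OF U] by blast
  \<comment> \<open>One \<delta> accounts for the starting point in the small cube, the other for
    the extent of the grid.\<close>
  define R where "R = (\<Sum>i\<in>UNIV. \<bar>c0 $ i - p $ i\<bar>) + 2 * \<delta>"
  have R0: "0 \<le> R" using \<delta> by (simp add: R_def sum_nonneg)
  obtain A0 where A0: "A0 \<ge> 1" "\<And>n. (\<Sum>l\<le>n. lagrange_bound R \<delta> n l) \<le> A0 ^ Suc n"
    using sum_lagrange_bound[OF R0 \<delta>] by blast
  define S where "S = cbox c0 (c0 + (\<chi> i. \<delta>))"
  define S' where "S' = cbox c0 (c0 + (\<chi> i. 2 * \<delta>))"
  have [measurable]: "S \<in> sets borel" "S' \<in> sets borel" by (simp_all add: S_def S'_def)
  have S: "y \<in> S \<longleftrightarrow> (\<forall>i. c0 $ i \<le> y $ i \<and> y $ i \<le> c0 $ i + \<delta>)"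
    and S': "y \<in> S' \<longleftrightarrow> (\<forall>i. c0 $ i \<le> y $ i \<and> y $ i \<le> c0 $ i + 2 * \<delta>)" for y
    by (simp_all add: S_def S'_def mem_box_cart)
  have "emeasure lborel S = ennreal (\<Prod>b\<in>Basis. ((c0 + (\<chi> i. \<delta>)) - c0) \<bullet> b)"
    unfolding S_def using \<delta> by (intro emeasure_lborel_cbox) (auto simp: Basis_vec_def inner_axis)
  also have "(\<Prod>b\<in>(Basis :: (real ^ 'd) set). ((c0 + (\<chi> i. \<delta>)) - c0) \<bullet> b) = \<delta> ^ DIM(real ^ 'd)"
    by (subst prod_constant[symmetric], rule prod.cong) (auto simp: Basis_vec_def inner_axis)
  finally have V: "emeasure lborel S = ennreal (\<delta> ^ DIM(real ^ 'd))" .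
  define V where "V = \<delta> ^ DIM(real ^ 'd)"
  have V0: "V > 0" using \<delta> by (simp add: V_def)
  \<comment> \<open>The sum of the product weights factors into one sum per coordinate.\<close>
  define A where "A = A0 ^ CARD('d)"
  \<comment> \<open>The volume comes from integrating the constant left side over the small cube,
    \<epsilon> from replacing Lebesgue measure by the law.\<close>
  define B where "B = 1 / (V * \<epsilon>)"
  have est: "ennreal (cmod (c \<alpha>))
       \<le> ennreal (B * A ^ Suc n) * (\<integral>\<^sup>+x. ennreal (cmod (mpoly_of p n c x)) \<partial>density lborel (\<lambda>x. ennreal (\<rho> x)))"
    if \<alpha>: "\<alpha> \<in> multi_upto n" for n c \<alpha>
  proof -
    let ?h = "\<delta> / (real n + 1)"
    define G where "G x = ennreal (cmod (mpoly_of p n c x))" for x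
    \<comment> \<open>Cutting off at the large cube allows the translations to act on integrals over
      the whole space.\<close>
    define F where "F x = indicator S' x * G x" for x
    define W where "W l = (\<Prod>i\<in>UNIV. lagrange_bound R \<delta> n (l i))" for l :: "'d \<Rightarrow> nat"
    have W0: "W l \<ge> 0" for l unfolding W_def using R0 \<delta> by (intro prod_nonneg lagrange_bound_nonneg ballI)
    have [measurable]: "mpoly_of p n c \<in> borel_measurable borel"
      by (intro borel_measurable_continuous_onI continuous_mpoly_of)
    have [measurable]: "G \<in> borel_measurable borel" "F \<in> borel_measurable borel"
      unfolding G_def F_def by measurable
    have pt: "indicator S y * ennreal (cmod (c \<alpha>))
        \<le> (\<Sum>l \<in> PiE UNIV (\<lambda>_. {..n}). ennreal (W l) * F (y + ?h *\<^sub>R (\<chi> i. real (l i))))" for y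
    proof (cases "y \<in> S")
      case True
      have "\<bar>y $ i - p $ i\<bar> + \<delta> \<le> R" for i
      proof -
        have "\<bar>c0 $ i - p $ i\<bar> \<le> (\<Sum>i\<in>UNIV. \<bar>c0 $ i - p $ i\<bar>)" by (rule member_le_sum) auto
        moreover have "c0 $ i \<le> y $ i \<and> y $ i \<le> c0 $ i + \<delta>" using True S by blast
        ultimately show ?thesis unfolding R_def by linarith
      qed
      then have "cmod (c \<alpha>) \<le> (\<Sum>l \<in> PiE UNIV (\<lambda>_. {..n}). W l * cmod (mpoly_of p n c (grid_pt y ?h l)))"
        unfolding W_def by (rule coeff_le_grid_sum[OF \<delta> _ \<alpha>])
      then have "ennreal (cmod (c \<alpha>))
          \<le> ennreal (\<Sum>l \<in> PiE UNIV (\<lambda>_. {..n}). W l * cmod (mpoly_of p n c (grid_pt y ?h l)))"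
        by (rule ennreal_leI)
      also have "\<dots> = (\<Sum>l \<in> PiE UNIV (\<lambda>_. {..n}). ennreal (W l) * G (grid_pt y ?h l))"
        using W0 by (subst sum_ennreal[symmetric]) (auto simp: ennreal_mult G_def)
      also have "\<dots> = (\<Sum>l \<in> PiE UNIV (\<lambda>_. {..n}). ennreal (W l) * F (y + ?h *\<^sub>R (\<chi> i. real (l i))))"
      proof (intro sum.cong refl)
        fix l :: "'d \<Rightarrow> nat" assume l: "l \<in> PiE UNIV (\<lambda>_. {..n})"
        have "grid_pt y ?h l \<in> S'"
          unfolding S'
        proof
          fix i
          have "l i \<le> n" using l by auto
          then have "?h * real (l i) \<le> ?h * (real n + 1)" using \<delta> by (intro mult_left_mono) auto
          also have "\<dots> = \<delta>" by simp
          finally have "?h * real (l i) \<le> \<delta>" .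
          moreover have "0 \<le> ?h * real (l i)" using \<delta> by simp
          moreover have "c0 $ i \<le> y $ i \<and> y $ i \<le> c0 $ i + \<delta>" using True S by blast
          moreover have "grid_pt y ?h l $ i = y $ i + ?h * real (l i)" by (simp add: grid_pt_def)
          ultimately show "c0 $ i \<le> grid_pt y ?h l $ i \<and> grid_pt y ?h l $ i \<le> c0 $ i + 2 * \<delta>"
            by linarith
        qed
        then show "ennreal (W l) * G (grid_pt y ?h l) = ennreal (W l) * F (y + ?h *\<^sub>R (\<chi> i. real (l i)))"
          by (simp add: F_def grid_pt_def)
      qed
      finally show ?thesis using True by simp
    qed simp
    have "ennreal V * ennreal (cmod (c \<alpha>)) = (\<integral>\<^sup>+y. indicator S y * ennreal (cmod (c \<alpha>)) \<partial>lborel)"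
      by (subst nn_integral_multc) (auto simp: V V_def)
    also have "\<dots> \<le> (\<integral>\<^sup>+y. (\<Sum>l \<in> PiE UNIV (\<lambda>_. {..n}). ennreal (W l) * F (y + ?h *\<^sub>R (\<chi> i. real (l i)))) \<partial>lborel)"
      by (intro nn_integral_mono pt)
    also have "\<dots> = (\<Sum>l \<in> PiE UNIV (\<lambda>_. {..n}). ennreal (W l) * (\<integral>\<^sup>+y. F y \<partial>lborel))"
      by (subst nn_integral_sum) (auto simp: nn_integral_cmult nn_integral_lborel_translate)
    also have "\<dots> = ennreal (\<Sum>l \<in> PiE UNIV (\<lambda>_. {..n}). W l) * (\<integral>\<^sup>+y. F y \<partial>lborel)"
      by (simp only: sum_distrib_right[symmetric] sum_ennreal[OF W0])
    also have "(\<Sum>l \<in> PiE UNIV (\<lambda>_. {..n}). W l) = (\<Prod>i\<in>(UNIV :: 'd set). \<Sum>l\<le>n. lagrange_bound R \<delta> n l)"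
      unfolding W_def by (rule prod_sum_PiE[symmetric]) auto
    also have "ennreal (\<Prod>i\<in>(UNIV :: 'd set). \<Sum>l\<le>n. lagrange_bound R \<delta> n l) * (\<integral>\<^sup>+y. F y \<partial>lborel)
        \<le> ennreal (A ^ Suc n) * (\<integral>\<^sup>+y. F y \<partial>lborel)"
    proof (intro mult_right_mono ennreal_leI)
      have "(\<Prod>i\<in>(UNIV :: 'd set). \<Sum>l\<le>n. lagrange_bound R \<delta> n l) \<le> (\<Prod>i\<in>(UNIV :: 'd set). A0 ^ Suc n)"
        using A0 lagrange_bound_nonneg[OF R0 \<delta>] by (intro prod_mono) (auto intro: sum_nonneg)
      also have "\<dots> = A ^ Suc n" unfolding A_def prod_constant power_mult[symmetric] by (simp only: mult.commute)
      finally show "(\<Prod>i\<in>(UNIV :: 'd set). \<Sum>l\<le>n. lagrange_bound R \<delta> n l) \<le> A ^ Suc n" .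
    qed simp
    finally have 1: "ennreal V * ennreal (cmod (c \<alpha>)) \<le> ennreal (A ^ Suc n) * (\<integral>\<^sup>+y. F y \<partial>lborel)" .
    have "ennreal \<epsilon> * (\<integral>\<^sup>+y. F y \<partial>lborel) = (\<integral>\<^sup>+y. ennreal \<epsilon> * F y \<partial>lborel)"
      by (rule nn_integral_cmult[symmetric]) simp
    also have "\<dots> \<le> (\<integral>\<^sup>+y. ennreal (\<rho> y) * G y \<partial>lborel)"
    proof (rule nn_integral_mono_AE)
      show "AE y in lborel. ennreal \<epsilon> * F y \<le> ennreal (\<rho> y) * G y"
        using \<epsilon>(2)
      proof eventually_elim
        case (elim y)
        show ?case
        proof (cases "y \<in> S'")
          case True
          then have "y \<in> U" using box S' by blast
          then have "ennreal \<epsilon> \<le> ennreal (\<rho> y)" using elim by (auto intro: ennreal_leI)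
          then show ?thesis using True by (simp add: F_def mult_right_mono)
        qed (simp add: F_def)
      qed
    qed
    also have "\<dots> = (\<integral>\<^sup>+y. G y \<partial>density lborel (\<lambda>x. ennreal (\<rho> x)))"
      by (rule nn_integral_density[symmetric]) auto
    finally have 2: "ennreal \<epsilon> * (\<integral>\<^sup>+y. F y \<partial>lborel) \<le> (\<integral>\<^sup>+y. G y \<partial>density lborel (\<lambda>x. ennreal (\<rho> x)))" .
    have "ennreal (cmod (c \<alpha>)) = ennreal B * (ennreal \<epsilon> * (ennreal V * ennreal (cmod (c \<alpha>))))"
      using V0 \<epsilon>(1) by (simp add: B_def flip: ennreal_mult)
    also have "\<dots> \<le> ennreal B * (ennreal \<epsilon> * (ennreal (A ^ Suc n) * (\<integral>\<^sup>+y. F y \<partial>lborel)))"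
      by (intro mult_left_mono 1) auto
    also have "\<dots> = ennreal B * ennreal (A ^ Suc n) * (ennreal \<epsilon> * (\<integral>\<^sup>+y. F y \<partial>lborel))"
      by (simp only: mult_ac)
    also have "\<dots> \<le> ennreal B * ennreal (A ^ Suc n) * (\<integral>\<^sup>+y. G y \<partial>density lborel (\<lambda>x. ennreal (\<rho> x)))"
      by (intro mult_left_mono 2) auto
    also have "ennreal B * ennreal (A ^ Suc n) = ennreal (B * A ^ Suc n)"
      using V0 \<epsilon>(1) A0(1) by (subst ennreal_mult) (auto simp: B_def A_def)
    finally show ?thesis unfolding G_def .
  qed
  show ?thesis
  proof (rule that[OF _ _ est])
    show "B \<ge> 0" using V0 \<epsilon>(1) by (simp add: B_def)
    show "A \<ge> 1" using A0(1) by (simp add: A_def)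
  qed
qed

section \<open>The strong law for continuous functions of compactly supported samples\<close>

text \<open>Hoeffding's inequality bounds the deviation probabilities by a geometric sequence;
  Borel-Cantelli then applies to each fixed \<epsilon>, and countably many values of \<epsilon>
  suffice.\<close>

lemma (in prob_space) bounded_strong_law:
  fixes Y :: "nat \<Rightarrow> 'a \<Rightarrow> real"
  assumes indep: "indep_vars (\<lambda>_. borel) Y UNIV"
    and distr: "\<And>i. distr M borel (Y i) = distr M borel (Y 0)"
    and bdd: "AE \<omega> in M. Y 0 \<omega> \<in> {a..b}"
  shows "AE \<omega> in M. (\<lambda>N. (\<Sum>i<N. Y i \<omega>) / real N) \<longlonglongrightarrow> expectation (Y 0)"
proof -
  \<comment> \<open>The interval is enlarged to positive length, as its length is divided by in
    Hoeffding's bound.\<close>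
  define b' where "b' = max b (a + 1)"
  have ab: "a < b'" by (simp add: b'_def)
  have bdd': "AE \<omega> in M. Y 0 \<omega> \<in> {a..b'}"
    using bdd by eventually_elim (auto simp: b'_def)
  have [measurable]: "Y i \<in> borel_measurable M" for i
    using indep unfolding indep_vars_def by blast
  define \<mu> where "\<mu> = expectation (Y 0)"
  have dev: "AE \<omega> in M. \<forall>\<^sub>F N in sequentially. \<bar>(\<Sum>i<N. Y i \<omega>) - real N * \<mu>\<bar> < real N * \<epsilon>"
    if \<epsilon>: "\<epsilon> > 0" for \<epsilon>
  proof -
    define D where "D N = {\<omega> \<in> space M. \<bar>(\<Sum>i<N. Y i \<omega>) - real N * \<mu>\<bar> \<ge> real N * \<epsilon>}" for N
    define q where "q = exp (- 2 * \<epsilon>\<^sup>2 / (b' - a)\<^sup>2)"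
    have q: "0 < q" "q < 1" using \<epsilon> ab by (auto simp: q_def)
    have D_le: "prob (D N) \<le> 2 * q ^ N" if N: "N \<ge> 1" for N
    proof -
      interpret Hf: Hoeffding_ineq_iid M "{..<N}" Y "Y 0" a b' \<mu>
      proof unfold_locales
        show "indep_vars (\<lambda>_. borel) Y {..<N}" by (rule indep_vars_subset[OF indep]) simp
        show "AE x in M. Y 0 x \<in> {a..b'}" by (rule bdd')
        show "distr M borel (Y i) = distr M borel (Y 0)" for i by (rule distr)
      qed (auto simp: \<mu>_def)
      have "prob (D N) \<le> 2 * exp (- 2 * (real N * \<epsilon>)\<^sup>2 / (real N * (b' - a)\<^sup>2))"
        using Hf.Hoeffding_ineq_abs_ge[of "real N * \<epsilon>"] \<epsilon> ab N by (simp add: D_def lessThan_empty_iff)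
      also have "- 2 * (real N * \<epsilon>)\<^sup>2 / (real N * (b' - a)\<^sup>2) = real N * (- 2 * \<epsilon>\<^sup>2 / (b' - a)\<^sup>2)"
        using N by (simp add: power2_eq_square)
      also have "exp (real N * (- 2 * \<epsilon>\<^sup>2 / (b' - a)\<^sup>2)) = q ^ N"
        unfolding q_def by (rule exp_of_nat_mult)
      finally show ?thesis .
    qed
    have "summable (\<lambda>N. 2 * q ^ N)"
      using q by (intro summable_mult summable_geometric) auto
    then have "summable (\<lambda>N. prob (D N))"
      by (rule summable_comparison_test'[where N = 1]) (use D_le in auto)
    then have "AE \<omega> in M. \<forall>\<^sub>F N in sequentially. \<omega> \<in> space M - D N"
      by (intro borel_cantelli_AE1) (auto simp: D_def emeasure_eq_measure)
    then show ?thesis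
      by eventually_elim (auto elim!: eventually_mono simp: D_def not_le)
  qed
  have "AE \<omega> in M. \<forall>k. \<forall>\<^sub>F N in sequentially.
      \<bar>(\<Sum>i<N. Y i \<omega>) - real N * \<mu>\<bar> < real N * (1 / real (Suc k))"
    by (subst AE_all_countable) (intro allI dev, simp)
  then show ?thesis
  proof eventually_elim
    case (elim \<omega>)
    show ?case
    proof (rule tendstoI)
      fix e :: real assume "e > 0"
      then obtain k where k: "1 / real (Suc k) < e"
        using nat_approx_posE by blast
      have "\<forall>\<^sub>F N in sequentially. N \<ge> 1" by (rule eventually_ge_at_top)
      with elim[rule_format, of k]
      show "\<forall>\<^sub>F N in sequentially. dist ((\<Sum>i<N. Y i \<omega>) / real N) (expectation (Y 0)) < e"
      proof eventually_elim
        case (elim N)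
        then have N: "real N > 0" by simp
        have "dist ((\<Sum>i<N. Y i \<omega>) / real N) \<mu> = \<bar>(\<Sum>i<N. Y i \<omega>) - real N * \<mu>\<bar> / real N"
        proof -
          have "(\<Sum>i<N. Y i \<omega>) / real N - \<mu> = ((\<Sum>i<N. Y i \<omega>) - real N * \<mu>) / real N"
            using N by (simp add: diff_divide_distrib)
          then show ?thesis using N by (simp add: dist_real_def)
        qed
        also have "\<dots> < 1 / real (Suc k)"
          using elim(1) N by (simp add: pos_divide_less_eq mult.commute)
        finally show ?case using k by (simp add: \<mu>_def)
      qed
    qed
  qed
qed

section \<open>Empirical averages of continuous functions\<close>

locale iid_compact_samples = prob_space M for M :: "'w measure" +
  fixes X :: "nat \<Rightarrow> 'w \<Rightarrow> real ^ 'd::finite" and \<mu> :: "(real ^ 'd) measure" and K :: "(real ^ 'd) set"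
  assumes indep: "indep_vars (\<lambda>_. borel) X UNIV"
    and law: "\<And>i. distr M borel (X i) = \<mu>"
    and compact: "compact K"
    and supp: "AE x in \<mu>. x \<in> K"
begin

lemma measurable_X [measurable]: "X i \<in> borel_measurable M"
  using indep unfolding indep_vars_def by blast

lemma sets_law [measurable_cong, simp]: "sets \<mu> = sets borel"
  using law[of 0] by auto

lemma prob_law: "prob_space \<mu>"
  using prob_space_distr[of "X 0" borel] law[of 0] by simp

lemma bounded_on_K:
  fixes \<phi> :: "real ^ 'd \<Rightarrow> 'b::real_normed_vector"
  assumes "continuous_on UNIV \<phi>"
  obtains B where "AE x in \<mu>. norm (\<phi> x) \<le> B"
proof -
  have "bounded (\<phi> ` K)"
    by (intro compact_imp_bounded compact_continuous_image compact continuous_on_subset[OF assms]) auto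
  then obtain B where "\<forall>x\<in>K. norm (\<phi> x) \<le> B" unfolding bounded_iff by blast
  then have "AE x in \<mu>. norm (\<phi> x) \<le> B"
    using supp by (auto elim: eventually_mono)
  then show ?thesis by (rule that)
qed

lemma integrable_continuous:
  fixes \<phi> :: "real ^ 'd \<Rightarrow> 'b::{banach, second_countable_topology}"
  assumes "continuous_on UNIV \<phi>"
  shows "integrable \<mu> \<phi>"
proof -
  interpret \<mu>: prob_space \<mu> by (rule prob_law)
  obtain B where B: "AE x in \<mu>. norm (\<phi> x) \<le> B"
    by (rule bounded_on_K[OF assms])
  have [measurable]: "\<phi> \<in> borel_measurable borel"
    by (rule borel_measurable_continuous_onI[OF assms])
  show ?thesis by (rule \<mu>.integrable_const_bound[OF B]) simp
qed

lemma strong_law_real: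
  fixes \<phi> :: "real ^ 'd \<Rightarrow> real"
  assumes "continuous_on UNIV \<phi>"
  shows "AE \<omega> in M. (\<lambda>N. (\<Sum>i<N. \<phi> (X i \<omega>)) / real N) \<longlonglongrightarrow> (\<integral>x. \<phi> x \<partial>\<mu>)"
proof -
  have [measurable]: "\<phi> \<in> borel_measurable borel"
    by (rule borel_measurable_continuous_onI[OF assms])
  obtain B where B: "AE x in \<mu>. norm (\<phi> x) \<le> B"
    by (rule bounded_on_K[OF assms])
  have "AE \<omega> in M. (\<lambda>N. (\<Sum>i<N. \<phi> (X i \<omega>)) / real N) \<longlonglongrightarrow> expectation (\<lambda>\<omega>. \<phi> (X 0 \<omega>))"
  proof (rule bounded_strong_law)
    show "indep_vars (\<lambda>_. borel) (\<lambda>i \<omega>. \<phi> (X i \<omega>)) UNIV"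
      by (rule indep_vars_compose2[OF indep]) simp
    have "distr M borel (\<lambda>\<omega>. \<phi> (X i \<omega>)) = distr \<mu> borel \<phi>" for i
      unfolding law[of i, symmetric] by (subst distr_distr) (auto simp: comp_def)
    then show "distr M borel (\<lambda>\<omega>. \<phi> (X i \<omega>)) = distr M borel (\<lambda>\<omega>. \<phi> (X 0 \<omega>))" for i
      by simp
    have "AE x in distr M borel (X 0). norm (\<phi> x) \<le> B" unfolding law by (rule B)
    then have "AE \<omega> in M. norm (\<phi> (X 0 \<omega>)) \<le> B"
      by (subst (asm) AE_distr_iff) auto
    then show "AE \<omega> in M. \<phi> (X 0 \<omega>) \<in> {-B..B}"
      by eventually_elim (auto simp: abs_le_iff)
  qed
  also have "expectation (\<lambda>\<omega>. \<phi> (X 0 \<omega>)) = (\<integral>x. \<phi> x \<partial>\<mu>)"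
    unfolding law[of 0, symmetric] by (rule integral_distr[symmetric]) auto
  finally show ?thesis .
qed

lemma strong_law_complex:
  fixes \<phi> :: "real ^ 'd \<Rightarrow> complex"
  assumes "continuous_on UNIV \<phi>"
  shows "AE \<omega> in M. (\<lambda>N. (\<Sum>i<N. \<phi> (X i \<omega>)) / of_nat N) \<longlonglongrightarrow> (\<integral>x. \<phi> x \<partial>\<mu>)"
proof -
  have c: "continuous_on UNIV (\<lambda>x. Re (\<phi> x))" "continuous_on UNIV (\<lambda>x. Im (\<phi> x))"
    using assms by (auto intro: continuous_intros)
  have i: "integrable \<mu> \<phi>" by (rule integrable_continuous[OF assms])
  from strong_law_real[OF c(1)] strong_law_real[OF c(2)] show ?thesis
  proof eventually_elim
    case (elim \<omega>)
    then show ?case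
      using i by (simp add: tendsto_complex_iff Re_divide_of_nat Im_divide_of_nat)
  qed
qed

end

section \<open>Limits of the estimator\<close>

lemma mat_adjoint_carrier [simp]: "A \<in> carrier_mat n m \<Longrightarrow> mat_adjoint A \<in> carrier_mat m n"
  by (auto simp: mat_adjoint_def)

lemma mat_adjoint_index:
  fixes A :: "complex mat"
  assumes "A \<in> carrier_mat n m" "i < m" "j < n"
  shows "mat_adjoint A $$ (i, j) = cnj (A $$ (j, i))"
  using assms by (auto simp: mat_adjoint_def mat_of_rows_index)

lemma mult_index:
  fixes A :: "complex mat"
  assumes "A \<in> carrier_mat n k" "B \<in> carrier_mat k m" "i < n" "j < m"
  shows "(A * B) $$ (i, j) = (\<Sum>l<k. A $$ (i, l) * B $$ (l, j))"
  using assms by (auto simp: scalar_prod_def atLeast0LessThan)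

lemma smult_index:
  assumes "A \<in> carrier_mat n m" "i < n" "j < m"
  shows "(c \<cdot>\<^sub>m A) $$ (i, j) = c * A $$ (i, j)"
  using assms by auto

lemma smult_smult: "a \<cdot>\<^sub>m (b \<cdot>\<^sub>m A) = (a * b :: complex) \<cdot>\<^sub>m A"
  by (rule eq_matI) auto

lemma one_smult: "(1 :: complex) \<cdot>\<^sub>m A = A"
  by (rule eq_matI) auto

lemma left_right_inverse_eq:
  fixes S :: "'a::comm_ring_1 mat"
  assumes "S \<in> carrier_mat n n" "B \<in> carrier_mat n n" "C \<in> carrier_mat n n"
    and "C * S = 1\<^sub>m n" "S * B = 1\<^sub>m n"
  shows "C = B"
proof -
  have "C = C * (S * B)" using assms(3,5) by simp
  also have "\<dots> = (C * S) * B" by (rule assoc_mult_mat[OF assms(3,1,2), symmetric])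
  also have "\<dots> = B" using assms(2,4) by simp
  finally show ?thesis .
qed

lemma mat_adjoint_mult:
  fixes A :: "complex mat"
  assumes "A \<in> carrier_mat n k" "B \<in> carrier_mat k m"
  shows "mat_adjoint (A * B) = mat_adjoint B * mat_adjoint A"
proof (rule eq_matI)
  have AB: "A * B \<in> carrier_mat n m" using assms by simp
  have c: "mat_adjoint B * mat_adjoint A \<in> carrier_mat m n" "mat_adjoint (A * B) \<in> carrier_mat m n"
    using assms AB by (meson mat_adjoint_carrier mult_carrier_mat)+
  then show "dim_row (mat_adjoint (A * B)) = dim_row (mat_adjoint B * mat_adjoint A)"
    "dim_col (mat_adjoint (A * B)) = dim_col (mat_adjoint B * mat_adjoint A)"
    by auto
  fix i j assume "i < dim_row (mat_adjoint B * mat_adjoint A)" "j < dim_col (mat_adjoint B * mat_adjoint A)"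
  then have ij: "i < m" "j < n" using c by auto
  have "mat_adjoint (A * B) $$ (i, j) = (\<Sum>l<k. cnj (A $$ (j, l)) * cnj (B $$ (l, i)))"
    using ij by (simp add: mat_adjoint_index[OF AB] mult_index[OF assms])
  also have "\<dots> = (\<Sum>l<k. mat_adjoint B $$ (i, l) * mat_adjoint A $$ (l, j))"
    using ij by (intro sum.cong) (auto simp: mat_adjoint_index[OF assms(1)] mat_adjoint_index[OF assms(2)])
  also have "\<dots> = (mat_adjoint B * mat_adjoint A) $$ (i, j)"
    using ij assms by (subst mult_index[of _ m k _ n]) auto
  finally show "mat_adjoint (A * B) $$ (i, j) = (mat_adjoint B * mat_adjoint A) $$ (i, j)" .
qed

lemma mat_adjoint_adjoint [simp]:
  fixes A :: "complex mat"
  assumes "A \<in> carrier_mat n m"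
  shows "mat_adjoint (mat_adjoint A) = A"
proof (rule eq_matI)
  have A': "mat_adjoint A \<in> carrier_mat m n" using assms by simp
  have A'': "mat_adjoint (mat_adjoint A) \<in> carrier_mat n m" using A' by simp
  show "dim_row (mat_adjoint (mat_adjoint A)) = dim_row A" "dim_col (mat_adjoint (mat_adjoint A)) = dim_col A"
    by (simp_all only: carrier_matD[OF A''] carrier_matD[OF assms])
  fix i j assume "i < dim_row A" "j < dim_col A"
  then have ij: "i < n" "j < m" using assms by auto
  show "mat_adjoint (mat_adjoint A) $$ (i, j) = A $$ (i, j)"
    using ij by (simp add: mat_adjoint_index[OF A'] mat_adjoint_index[OF assms])
qed

lemma mat_adjoint_one [simp]: "mat_adjoint (1\<^sub>m n :: complex mat) = 1\<^sub>m n"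
proof (rule eq_matI)
  have c: "mat_adjoint (1\<^sub>m n :: complex mat) \<in> carrier_mat n n" by simp
  show "dim_row (mat_adjoint (1\<^sub>m n :: complex mat)) = dim_row (1\<^sub>m n :: complex mat)"
    "dim_col (mat_adjoint (1\<^sub>m n :: complex mat)) = dim_col (1\<^sub>m n :: complex mat)"
    by (simp_all only: carrier_matD[OF c] index_one_mat)
  fix i j assume "i < dim_row (1\<^sub>m n :: complex mat)" "j < dim_col (1\<^sub>m n :: complex mat)"
  then show "mat_adjoint (1\<^sub>m n :: complex mat) $$ (i, j) = (1\<^sub>m n) $$ (i, j)"
    by (simp add: mat_adjoint_index[of _ n n])
qed

text \<open>With full row rank the candidate is a right inverse of \<open>A\<close>, and the
  remaining Penrose equation follows since \<open>T\<close>, the inverse of a Hermitian matrix, is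
  Hermitian. Uniqueness is proved as well, because \<open>pseudo_inverse\<close> is a definite
  description.\<close>

lemma pseudo_inverse_full_rank:
  fixes A :: "complex mat"
  assumes A: "A \<in> carrier_mat r N" and T: "T \<in> carrier_mat r r"
    and inv: "(A * mat_adjoint A) * T = 1\<^sub>m r" "T * (A * mat_adjoint A) = 1\<^sub>m r"
  shows "pseudo_inverse A = mat_adjoint A * T"
proof -
  define A' where "A' = mat_adjoint A"
  define S where "S = A * A'"
  have A': "A' \<in> carrier_mat N r" using A by (simp add: A'_def)
  have S: "S \<in> carrier_mat r r" using A A' by (simp add: S_def)
  have ST: "S * T = 1\<^sub>m r" "T * S = 1\<^sub>m r" using inv by (simp_all add: S_def A'_def)
  have adjA': "mat_adjoint A' = A" using A by (simp add: A'_def)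
  have adjS: "mat_adjoint S = S"
    unfolding S_def mat_adjoint_mult[OF A A'] adjA' by (simp add: A'_def)
  have T': "mat_adjoint T \<in> carrier_mat r r" using T by simp
  have "mat_adjoint T * S = mat_adjoint (S * T)"
    by (simp add: mat_adjoint_mult[OF S T] adjS)
  then have "mat_adjoint T * S = 1\<^sub>m r" by (simp add: ST)
  then have adjT: "mat_adjoint T = T"
    by (rule left_right_inverse_eq[OF S T T' _ ST(1)])
  define B where "B = A' * T"
  have B: "B \<in> carrier_mat N r" using A' T by (simp add: B_def)
  have AB: "A * B = 1\<^sub>m r"
    using ST assoc_mult_mat[OF A A' T] by (simp add: B_def S_def)
  have BA: "B * A \<in> carrier_mat N N" using A B by simp
  have "mat_adjoint (B * A) = A' * (mat_adjoint T * A)"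
  proof -
    have "mat_adjoint (B * A) = A' * mat_adjoint B"
      unfolding mat_adjoint_mult[OF B A] A'_def ..
    also have "mat_adjoint B = mat_adjoint T * A"
      unfolding B_def mat_adjoint_mult[OF A' T] adjA' ..
    finally show ?thesis .
  qed
  also have "\<dots> = B * A" using adjT assoc_mult_mat[OF A' T A] by (simp add: B_def)
  finally have adjBA: "mat_adjoint (B * A) = B * A" .
  have dims: "dim_col A = N" "dim_row A = r" using A by auto
  show ?thesis
    unfolding pseudo_inverse_def dims A'_def[symmetric] B_def[symmetric]
  proof (rule the_equality, intro conjI)
    show "A * B * A = A" using AB A by simp
    show "B * A * B = B" using AB A B by (simp add: assoc_mult_mat[OF B A B])
    show "mat_adjoint (A * B) = A * B" by (simp add: AB)
  next
    fix C assume "C \<in> carrier_mat N r \<and> A * C * A = A \<and> C * A * C = C \<and>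
      mat_adjoint (A * C) = A * C \<and> mat_adjoint (C * A) = C * A"
    then have C: "C \<in> carrier_mat N r" and 1: "A * C * A = A" and 2: "C * A * C = C"
      and 3: "mat_adjoint (C * A) = C * A" by auto
    have AC: "A * C \<in> carrier_mat r r" using A C by simp
    have "A * C = A * C * (A * B)" unfolding AB by (rule right_mult_one_mat[OF AC, symmetric])
    also have "\<dots> = A * C * A * B" by (rule assoc_mult_mat[OF AC A B, symmetric])
    also have "\<dots> = 1\<^sub>m r" using 1 AB by simp
    finally have AC1: "A * C = 1\<^sub>m r" .
    have C': "mat_adjoint C \<in> carrier_mat r N" using C by simp
    define Z where "Z = mat_adjoint C * C"
    have Z: "Z \<in> carrier_mat r r" unfolding Z_def by (rule mult_carrier_mat[OF C' C])
    \<comment> \<open>The Penrose equations put \<open>C\<close> into the form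
      \<open>A' * Z\<close>; then \<open>A * C = 1\<^sub>m r\<close> reads
      \<open>S * Z = 1\<^sub>m r\<close>, which leaves only the inverse \<open>T\<close>.\<close>
    have "C = mat_adjoint (C * A) * C" using 2 3 by simp
    also have "\<dots> = A' * mat_adjoint C * C" by (simp add: mat_adjoint_mult[OF C A] A'_def)
    also have "\<dots> = A' * Z" unfolding Z_def by (rule assoc_mult_mat[OF A' C' C])
    finally have CZ: "C = A' * Z" .
    have "S * Z = 1\<^sub>m r" using AC1 assoc_mult_mat[OF A A' Z] by (simp add: CZ[symmetric] S_def)
    then have "Z = T" by (rule left_right_inverse_eq[OF S Z T ST(2), symmetric])
    then show "C = B" using CZ by (simp add: B_def)
  qed (use B adjBA in auto)
qed

section \<open>Continuity of matrix inversion and the limit in N\<close>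

lemma det_tendsto:
  fixes A :: "nat \<Rightarrow> complex mat"
  assumes "\<And>N. A N \<in> carrier_mat n n" "L \<in> carrier_mat n n"
    and "\<And>i j. i < n \<Longrightarrow> j < n \<Longrightarrow> (\<lambda>N. A N $$ (i, j)) \<longlonglongrightarrow> L $$ (i, j)"
  shows "(\<lambda>N. Determinant.det (A N)) \<longlonglongrightarrow> Determinant.det L"
proof -
  have "(\<lambda>N. \<Sum>q\<in>{q. q permutes {0..<n}}. signof q * (\<Prod>i = 0..<n. A N $$ (i, q i)))
     \<longlonglongrightarrow> (\<Sum>q\<in>{q. q permutes {0..<n}}. signof q * (\<Prod>i = 0..<n. L $$ (i, q i)))"
    by (intro tendsto_intros assms(3)) (auto simp: permutes_in_image)
  then show ?thesis
    unfolding Determinant.det_def'[OF assms(1)] Determinant.det_def'[OF assms(2)] .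
qed

text \<open>Inverses are handled as adjugate over determinant: both are polynomial in the entries,
  so entrywise limits pass through.\<close>

lemma adj_mat_tendsto:
  fixes A :: "nat \<Rightarrow> complex mat"
  assumes A: "\<And>N. A N \<in> carrier_mat n n" and L: "L \<in> carrier_mat n n"
    and lim: "\<And>i j. i < n \<Longrightarrow> j < n \<Longrightarrow> (\<lambda>N. A N $$ (i, j)) \<longlonglongrightarrow> L $$ (i, j)"
    and ij: "i < n" "j < n"
  shows "(\<lambda>N. adj_mat (A N) $$ (i, j)) \<longlonglongrightarrow> adj_mat L $$ (i, j)"
proof -
  have "(\<lambda>N. Determinant.det (mat_delete (A N) j i)) \<longlonglongrightarrow> Determinant.det (mat_delete L j i)"
  proof (rule det_tendsto[where n = "n - 1"])
    show "mat_delete (A N) j i \<in> carrier_mat (n - 1) (n - 1)" for N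
      using A[of N] by (rule mat_delete_carrier)
    show "mat_delete L j i \<in> carrier_mat (n - 1) (n - 1)"
      using L by (rule mat_delete_carrier)
    fix a b assume "a < n - 1" "b < n - 1"
    then show "(\<lambda>N. mat_delete (A N) j i $$ (a, b)) \<longlonglongrightarrow> mat_delete L j i $$ (a, b)"
      using L ij carrier_matD[OF A] by (auto simp: mat_delete_def intro!: lim)
  qed
  moreover have "adj_mat (A N) $$ (i, j) = (-1) ^ (j + i) * Determinant.det (mat_delete (A N) j i)" for N
    using A[of N] ij by (auto simp: adj_mat_def cofactor_def)
  moreover have "adj_mat L $$ (i, j) = (-1) ^ (j + i) * Determinant.det (mat_delete L j i)"
    using L ij by (auto simp: adj_mat_def cofactor_def)
  ultimately show ?thesis by (simp add: tendsto_mult_left)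
qed

lemma C_hat_tendsto:
  fixes v :: "nat \<Rightarrow> 'a \<Rightarrow> complex"
  assumes S: "S \<in> carrier_mat rn rn" and detS: "Determinant.det S \<noteq> 0"
    and B: "B \<in> carrier_mat rm rn" and rm: "rm \<le> rn"
    and limS: "\<And>i j. i < rn \<Longrightarrow> j < rn \<Longrightarrow>
      (\<lambda>N. (\<Sum>l<N. cnj (v i (x l)) * v j (x l)) / of_nat N) \<longlonglongrightarrow> S $$ (i, j)"
    and limR: "\<And>i j. i < rm \<Longrightarrow> j < rn \<Longrightarrow>
      (\<lambda>N. (\<Sum>l<N. cnj (v i (y l)) * v j (x l)) / of_nat N) \<longlonglongrightarrow> (B * S) $$ (i, j)"
    and ij: "i < rm" "j < rm"
  shows "(\<lambda>N. C_hat v rm rn N x y $$ (i, j)) \<longlonglongrightarrow> B $$ (i, j)"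
proof -
  define F where "F N = feature_matrix v rn N x" for N
  define G where "G N = feature_matrix v rm N y" for N
  have F: "F N \<in> carrier_mat rn N" and G: "G N \<in> carrier_mat rm N" for N
    by (simp_all add: F_def G_def feature_matrix_def)
  have F': "mat_adjoint (F N) \<in> carrier_mat N rn" for N using F by simp
  define S1 where "S1 N = (1 / of_nat N :: complex) \<cdot>\<^sub>m (F N * mat_adjoint (F N))" for N
  define R1 where "R1 N = (1 / of_nat N :: complex) \<cdot>\<^sub>m (G N * mat_adjoint (F N))" for N
  have FF: "F N * mat_adjoint (F N) \<in> carrier_mat rn rn" and GF: "G N * mat_adjoint (F N) \<in> carrier_mat rm rn" for N
    using F[of N] G[of N] F'[of N] by simp_all
  have S1: "S1 N \<in> carrier_mat rn rn" and R1: "R1 N \<in> carrier_mat rm rn" for N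
    using FF GF by (simp_all add: S1_def R1_def)
  have S1_lim: "(\<lambda>N. S1 N $$ (a, b)) \<longlonglongrightarrow> S $$ (a, b)" if "a < rn" "b < rn" for a b
  proof -
    have "S1 N $$ (a, b) = (\<Sum>l<N. cnj (v a (x l)) * v b (x l)) / of_nat N" for N
    proof -
      have "S1 N $$ (a, b) = 1 / of_nat N * (F N * mat_adjoint (F N)) $$ (a, b)"
        unfolding S1_def by (rule smult_index[OF FF that])
      also have "(F N * mat_adjoint (F N)) $$ (a, b) = (\<Sum>l<N. F N $$ (a, l) * mat_adjoint (F N) $$ (l, b))"
        by (rule mult_index[OF F F' that])
      also have "\<dots> = (\<Sum>l<N. cnj (v a (x l)) * v b (x l))"
        using that by (intro sum.cong) (auto simp: mat_adjoint_index[OF F], auto simp: F_def feature_matrix_def)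
      finally show ?thesis by simp
    qed
    then show ?thesis using limS[OF that] by simp
  qed
  have R1_lim: "(\<lambda>N. R1 N $$ (a, b)) \<longlonglongrightarrow> (B * S) $$ (a, b)" if "a < rm" "b < rn" for a b
  proof -
    have "R1 N $$ (a, b) = (\<Sum>l<N. cnj (v a (y l)) * v b (x l)) / of_nat N" for N
    proof -
      have "R1 N $$ (a, b) = 1 / of_nat N * (G N * mat_adjoint (F N)) $$ (a, b)"
        unfolding R1_def by (rule smult_index[OF GF that])
      also have "(G N * mat_adjoint (F N)) $$ (a, b) = (\<Sum>l<N. G N $$ (a, l) * mat_adjoint (F N) $$ (l, b))"
        by (rule mult_index[OF G F' that])
      also have "\<dots> = (\<Sum>l<N. cnj (v a (y l)) * v b (x l))"
        using that by (intro sum.cong) (auto simp: mat_adjoint_index[OF F], auto simp: F_def G_def feature_matrix_def)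
      finally show ?thesis by simp
    qed
    then show ?thesis using limR[OF that] by simp
  qed
  have det_lim: "(\<lambda>N. Determinant.det (S1 N)) \<longlonglongrightarrow> Determinant.det S"
    by (rule det_tendsto[OF S1 S S1_lim])
  have adj: "adj_mat (S1 N) \<in> carrier_mat rn rn" for N by (rule adj_mat(1)[OF S1])
  have entry: "C_hat v rm rn N x y $$ (i, j)
      = (\<Sum>k<rn. R1 N $$ (i, k) * adj_mat (S1 N) $$ (k, j)) / Determinant.det (S1 N)"
    if N: "N \<ge> 1" and d: "Determinant.det (S1 N) \<noteq> 0" for N
  proof -
    let ?c = "1 / of_nat N :: complex" and ?d = "1 / Determinant.det (S1 N)"
    \<comment> \<open>The inverse of F F^*: one factor inverts N, the other turns the adjugate of
      the normalised Gram matrix into its inverse.\<close>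
    define T where "T = (?c * ?d) \<cdot>\<^sub>m adj_mat (S1 N)"
    have T: "T \<in> carrier_mat rn rn" using adj by (simp add: T_def)
    have FFeq: "F N * mat_adjoint (F N) = (of_nat N :: complex) \<cdot>\<^sub>m S1 N"
      using N FF[of N] by (auto simp: S1_def intro!: eq_matI)
    have one: "(of_nat N * (?c * ?d) * Determinant.det (S1 N)) \<cdot>\<^sub>m 1\<^sub>m rn = 1\<^sub>m rn"
      using N d by (simp add: one_smult)
    have "(F N * mat_adjoint (F N)) * T = (of_nat N * (?c * ?d)) \<cdot>\<^sub>m (S1 N * adj_mat (S1 N))"
      unfolding FFeq T_def using S1[of N] adj[of N]
      by (simp only: mult_smult_distrib[OF smult_carrier_mat[OF S1] adj] mult_smult_assoc_mat[OF S1 adj] smult_smult mult.commute)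
    also have "\<dots> = 1\<^sub>m rn"
      unfolding adj_mat(2)[OF S1] smult_smult by (rule one)
    finally have 1: "(F N * mat_adjoint (F N)) * T = 1\<^sub>m rn" .
    have "T * (F N * mat_adjoint (F N)) = (of_nat N * (?c * ?d)) \<cdot>\<^sub>m (adj_mat (S1 N) * S1 N)"
      unfolding FFeq T_def using S1[of N] adj[of N]
      by (simp only: mult_smult_distrib[OF smult_carrier_mat[OF adj] S1] mult_smult_assoc_mat[OF adj S1] smult_smult mult.commute)
    also have "\<dots> = 1\<^sub>m rn"
      unfolding adj_mat(3)[OF S1] smult_smult by (rule one)
    finally have 2: "T * (F N * mat_adjoint (F N)) = 1\<^sub>m rn" .
    have P: "pseudo_inverse (F N) = mat_adjoint (F N) * T"
      by (rule pseudo_inverse_full_rank[OF F T 1 2])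
    have "G N * (mat_adjoint (F N) * T) = (G N * mat_adjoint (F N)) * T"
      by (rule assoc_mult_mat[OF G F' T, symmetric])
    moreover have "(G N * mat_adjoint (F N)) * T \<in> carrier_mat rm rn" using GF T by (rule mult_carrier_mat)
    ultimately have "C_hat v rm rn N x y $$ (i, j) = ((G N * mat_adjoint (F N)) * T) $$ (i, j)"
      unfolding C_hat_def F_def[symmetric] G_def[symmetric] P first_columns_def using ij by auto
    also have "\<dots> = (\<Sum>k<rn. (G N * mat_adjoint (F N)) $$ (i, k) * T $$ (k, j))"
      using ij rm by (intro mult_index[OF GF T]) auto
    also have "\<dots> = (\<Sum>k<rn. R1 N $$ (i, k) * adj_mat (S1 N) $$ (k, j)) / Determinant.det (S1 N)"
      unfolding sum_divide_distrib
    proof (intro sum.cong refl)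
      fix k assume "k \<in> {..<rn}"
      then have "k < rn" "j < rn" using ij rm by auto
      then have "R1 N $$ (i, k) = ?c * (G N * mat_adjoint (F N)) $$ (i, k)"
        unfolding R1_def by (intro smult_index[OF GF ij(1)])
      moreover have "T $$ (k, j) = ?c * ?d * adj_mat (S1 N) $$ (k, j)"
        unfolding T_def using \<open>k < rn\<close> \<open>j < rn\<close> by (rule smult_index[OF adj])
      ultimately show "(G N * mat_adjoint (F N)) $$ (i, k) * T $$ (k, j)
          = R1 N $$ (i, k) * adj_mat (S1 N) $$ (k, j) / Determinant.det (S1 N)"
        by simp
    qed
    finally show ?thesis .
  qed
  have lim: "(\<lambda>N. (\<Sum>k<rn. R1 N $$ (i, k) * adj_mat (S1 N) $$ (k, j)) / Determinant.det (S1 N))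
      \<longlonglongrightarrow> (\<Sum>k<rn. (B * S) $$ (i, k) * adj_mat S $$ (k, j)) / Determinant.det S"
    using ij rm detS by (intro tendsto_intros R1_lim det_lim adj_mat_tendsto[OF S1 S S1_lim]) auto
  have BS: "B * S \<in> carrier_mat rm rn" using B S by (rule mult_carrier_mat)
  have aS: "adj_mat S \<in> carrier_mat rn rn" by (rule adj_mat(1)[OF S])
  have "(\<Sum>k<rn. (B * S) $$ (i, k) * adj_mat S $$ (k, j)) = ((B * S) * adj_mat S) $$ (i, j)"
    using ij rm by (intro mult_index[OF BS aS, symmetric]) auto
  also have "(B * S) * adj_mat S = B * (S * adj_mat S)" by (rule assoc_mult_mat[OF B S aS])
  also have "\<dots> = Determinant.det S \<cdot>\<^sub>m B"
    unfolding adj_mat(2)[OF S] mult_smult_distrib[OF B one_carrier_mat] using B by simp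
  also have "\<dots> $$ (i, j) = Determinant.det S * B $$ (i, j)" using B ij rm by auto
  finally have val: "(\<Sum>k<rn. (B * S) $$ (i, k) * adj_mat S $$ (k, j)) / Determinant.det S = B $$ (i, j)"
    using detS by simp
  have "\<forall>\<^sub>F N in sequentially. Determinant.det (S1 N) \<noteq> 0"
    by (rule tendsto_imp_eventually_ne[OF det_lim detS])
  moreover have "\<forall>\<^sub>F N in sequentially. N \<ge> 1" by (rule eventually_ge_at_top)
  ultimately have "\<forall>\<^sub>F N in sequentially. (\<Sum>k<rn. R1 N $$ (i, k) * adj_mat (S1 N) $$ (k, j)) / Determinant.det (S1 N)
      = C_hat v rm rn N x y $$ (i, j)"
    by eventually_elim (simp add: entry)
  from Lim_transform_eventually[OF lim this] show ?thesis unfolding val .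
qed

section \<open>Convergence of the estimator\<close>

lemma diag_mat_inverse:
  fixes g :: "nat \<Rightarrow> complex"
  assumes "\<And>i. i < r \<Longrightarrow> g i \<noteq> 0"
  shows "the (mat_inverse (Matrix.mat r r (\<lambda>(i, j). if i = j then g i else 0)))
    = Matrix.mat r r (\<lambda>(i, j). if i = j then 1 / g i else 0)"
proof -
  define G where "G = Matrix.mat r r (\<lambda>(i, j). if i = j then g i else 0)"
  define D where "D = Matrix.mat r r (\<lambda>(i, j). if i = j then 1 / g i else 0)"
  have G: "G \<in> carrier_mat r r" and D: "D \<in> carrier_mat r r" by (simp_all add: G_def D_def)
  have "(G * D) $$ (i, j) = (if i = j then 1 else 0)" "(D * G) $$ (i, j) = (if i = j then 1 else 0)"
    if ij: "i < r" "j < r" for i j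
  proof -
    have "(G * D) $$ (i, j) = (\<Sum>l<r. if l = i then g i * D $$ (i, j) else 0)"
      unfolding mult_index[OF G D ij] using ij by (intro sum.cong) (auto simp: G_def)
    then show "(G * D) $$ (i, j) = (if i = j then 1 else 0)" using ij assms by (auto simp: D_def)
    have "(D * G) $$ (i, j) = (\<Sum>l<r. if l = i then 1 / g i * G $$ (i, j) else 0)"
      unfolding mult_index[OF D G ij] using ij by (intro sum.cong) (auto simp: D_def)
    then show "(D * G) $$ (i, j) = (if i = j then 1 else 0)" using ij assms by (auto simp: G_def)
  qed
  then have GD: "G * D = 1\<^sub>m r" and DG: "D * G = 1\<^sub>m r"
    using G D by (auto intro!: eq_matI)
  have "G \<in> Units (ring_mat TYPE(complex) r ())"
    using G D GD DG by (auto simp: Units_def ring_mat_def)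
  then obtain B where B: "mat_inverse G = Some B"
    using mat_inverse(1)[OF G, where b = "()"] by (cases "mat_inverse G") auto
  then have "G * B = 1\<^sub>m r" "B \<in> carrier_mat r r" using mat_inverse(2)[OF G B] by auto
  then have "D = B" using left_right_inverse_eq[OF G _ D DG] by blast
  then show ?thesis using B by (simp add: G_def D_def)
qed

lemma diag_conjugate_index:
  fixes g :: "nat \<Rightarrow> complex"
  assumes C: "C \<in> carrier_mat r r" and nz: "\<And>i. i < r \<Longrightarrow> g i \<noteq> 0" and ij: "i < r" "j < r"
  defines "G \<equiv> Matrix.mat r r (\<lambda>(i, j). if i = j then g i else 0)"
  shows "(G * C * the (mat_inverse G)) $$ (i, j) = g i * C $$ (i, j) / g j"
proof -
  define D where "D = Matrix.mat r r (\<lambda>(i, j). if i = j then 1 / g i else 0)"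
  have G: "G \<in> carrier_mat r r" and D: "D \<in> carrier_mat r r" by (simp_all add: G_def D_def)
  have GC: "G * C \<in> carrier_mat r r" using G C by (rule mult_carrier_mat)
  have "the (mat_inverse G) = D" unfolding G_def D_def by (rule diag_mat_inverse[OF nz])
  then have "(G * C * the (mat_inverse G)) $$ (i, j) = (\<Sum>l<r. (G * C) $$ (i, l) * D $$ (l, j))"
    using mult_index[OF GC D ij] by simp
  also have "\<dots> = (\<Sum>l<r. if l = j then (G * C) $$ (i, j) / g j else 0)"
    using ij by (intro sum.cong) (auto simp: D_def)
  also have "\<dots> = (G * C) $$ (i, j) / g j" using ij by simp
  also have "(G * C) $$ (i, j) = (\<Sum>l<r. if l = i then g i * C $$ (i, j) else 0)"
    unfolding mult_index[OF G C ij] using ij by (intro sum.cong) (auto simp: G_def)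
  also have "\<dots> = g i * C $$ (i, j)" using ij by simp
  finally show ?thesis .
qed

lemma frobenius_norm_tendsto:
  fixes A :: "nat \<Rightarrow> complex mat"
  assumes A: "\<And>N. A N \<in> carrier_mat n m" and L: "L \<in> carrier_mat n m" and T: "T \<in> carrier_mat n m"
    and lim: "\<And>i j. i < n \<Longrightarrow> j < m \<Longrightarrow> (\<lambda>N. A N $$ (i, j)) \<longlonglongrightarrow> L $$ (i, j)"
  shows "(\<lambda>N. frobenius_norm (A N - T)) \<longlonglongrightarrow> frobenius_norm (L - T)"
proof -
  have eq: "frobenius_norm (B - T) = sqrt (\<Sum>i<n. \<Sum>j<m. (cmod (B $$ (i, j) - T $$ (i, j)))\<^sup>2)"
    if "B \<in> carrier_mat n m" for B
  proof -
    have "frobenius_norm (B - T) = sqrt (\<Sum>i<n. \<Sum>j<m. (cmod ((B - T) $$ (i, j)))\<^sup>2)"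
      using T by (auto simp: frobenius_norm_def)
    also have "(\<Sum>i<n. \<Sum>j<m. (cmod ((B - T) $$ (i, j)))\<^sup>2) = (\<Sum>i<n. \<Sum>j<m. (cmod (B $$ (i, j) - T $$ (i, j)))\<^sup>2)"
      using T that by (intro sum.cong refl) auto
    finally show ?thesis .
  qed
  show ?thesis unfolding eq[OF A] eq[OF L]
    by (intro tendsto_intros lim) auto
qed

text \<open>The density is represented only by the coefficient estimate \<open>coeff_bound\<close>,
  and jet spaces appear as spans of monomials.\<close>

locale edmd = exp_rkhs \<sigma> p H ip + iid_compact_samples M X \<mu> K
  for \<sigma> and p :: "real ^ 'd::finite" and H ip and M :: "'w measure" and X
    and \<mu> :: "(real ^ 'd) measure" and K +
  fixes f :: "real ^ 'd \<Rightarrow> real ^ 'd" and v :: "nat \<Rightarrow> real ^ 'd \<Rightarrow> complex" and r :: "nat \<Rightarrow> nat"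
    and Cb Ab :: real
  assumes f_cont: "continuous_on UNIV f" and f_diff: "C_diff (Suc 0) f" and f_fix: "f p = p"
    and mon_comp: "\<And>\<alpha>. shifted_monomial p \<alpha> \<circ> f \<in> H"
    and v_basis: "\<And>n. is_basis v {..<r n} (cfun.span (shifted_monomial p ` multi_upto n))"
    and v_inj: "inj v" and v_indep: "cfun.independent (range v)"
    and v_orth: "\<And>i j. i \<noteq> j \<Longrightarrow> ip (v i) (v j) = 0"
    and coeff_consts: "0 \<le> Cb" "1 \<le> Ab"
    and coeff_bound: "\<And>n c \<alpha>. \<alpha> \<in> multi_upto n \<Longrightarrow> ennreal (cmod (c \<alpha>))
       \<le> ennreal (Cb * Ab ^ Suc n) * (\<integral>\<^sup>+x. ennreal (cmod (mpoly_of p n c x)) \<partial>\<mu>)"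
begin

section \<open>Polynomials and their coordinates in the basis v\<close>

abbreviation polys :: "nat \<Rightarrow> (real ^ 'd \<Rightarrow> complex) set" where
  "polys n \<equiv> cfun.span (mon ` multi_upto n)"

lemma polys_mono: "m \<le> n \<Longrightarrow> polys m \<subseteq> polys n"
  by (intro cfun.span_mono image_mono multi_upto_mono)

lemma polys_in: "g \<in> polys n \<Longrightarrow> g \<in> H"
  by (rule span_mon_in)

lemma polys_eq_mpoly:
  assumes "g \<in> polys n"
  shows "g = mpoly_of p n (\<lambda>\<beta>. ip g (mon \<beta>) / mon_sq \<beta>)"
proof -
  have "g = (\<Sum>\<beta>\<in>multi_upto n. cscale (ip g (mon \<beta>) / ip (mon \<beta>) (mon \<beta>)) (mon \<beta>))"
    by (rule oproj_span[OF _ _ _ _ assms]) (auto simp: mon_orth mon_nonzero)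
  then have "g x = (\<Sum>\<beta>\<in>multi_upto n. cscale (ip g (mon \<beta>) / ip (mon \<beta>) (mon \<beta>)) (mon \<beta>)) x" for x
    by (rule fun_cong)
  then show ?thesis
    by (simp add: fun_eq_iff mpoly_of_def sum_fun_apply cscale_def ip_mon_self)
qed

lemma continuous_polys: "g \<in> polys n \<Longrightarrow> continuous_on S g"
  by (subst polys_eq_mpoly[of g n]) (assumption, rule continuous_mpoly_of)

lemma v_polys: "i < r n \<Longrightarrow> v i \<in> polys n"
  using v_basis[of n] cfun.span_base[of "v i" "v ` {..<r n}"] unfolding is_basis_def by blast

lemma v_in: "i < r n \<Longrightarrow> v i \<in> H"
  using v_polys polys_in by blast

lemma v_nonzero: "v i \<noteq> 0"
proof
  assume "v i = 0"
  then have "0 \<in> range v" by (metis rangeI)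
  then show False using v_indep cfun.dependent_zero[of "range v"] by simp
qed

lemma r_mono:
  assumes "m \<le> n"
  shows "r m \<le> r n"
proof -
  have "cfun.span (v ` {..<r n}) = polys n"
    using v_basis[of n] by (simp add: is_basis_def)
  moreover have "v i \<in> polys n" if "i < r m" for i
    using polys_mono[OF assms] v_polys[OF that] by (rule subsetD)
  ultimately have 1: "v ` {..<r m} \<subseteq> cfun.span (v ` {..<r n})"
    by (simp add: image_subset_iff)
  have 2: "cfun.independent (v ` {..<r m})"
    using v_basis[of m] by (simp add: is_basis_def)
  have "card (v ` {..<r m}) \<le> card (v ` {..<r n})"
    using cfun.independent_span_bound[OF _ 2 1] by simp
  moreover have "card (v ` {..<k}) = k" for k
    using v_inj by (subst card_image) (auto intro: inj_on_subset)
  ultimately show ?thesis by simp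
qed

lemma v_expand:
  assumes "g \<in> polys n"
  shows "g = (\<Sum>i<r n. cscale (ip g (v i) / ip (v i) (v i)) (v i))"
proof -
  have "g \<in> cfun.span (v ` {..<r n})" using assms v_basis[of n] by (simp add: is_basis_def)
  then show ?thesis
    by (intro oproj_span) (auto simp: v_in v_orth v_nonzero)
qed

lemma ip_v_self_nz: "i < r n \<Longrightarrow> ip (v i) (v i) \<noteq> 0"
  using ip_definite[OF v_in, of i n] v_nonzero[of i] by blast

section \<open>Mean squares under the sampling law\<close>

definition msq :: "(real ^ 'd \<Rightarrow> complex) \<Rightarrow> real" where
  "msq g = (\<integral>x. (cmod (g x))\<^sup>2 \<partial>\<mu>)"

text \<open>The variance of |g| under a probability measure is nonnegative.\<close>

lemma nn_integral_le_msq: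
  assumes g: "continuous_on UNIV g"
  shows "(\<integral>\<^sup>+x. ennreal (cmod (g x)) \<partial>\<mu>) \<le> ennreal (sqrt (msq g))"
proof -
  interpret \<mu>: prob_space \<mu> by (rule prob_law)
  have i1: "integrable \<mu> (\<lambda>x. cmod (g x))" and i2: "integrable \<mu> (\<lambda>x. (cmod (g x))\<^sup>2)"
    by (intro integrable_continuous continuous_intros g)+
  have "0 \<le> \<mu>.variance (\<lambda>x. cmod (g x))" by (rule \<mu>.variance_positive)
  also have "\<dots> = msq g - (\<integral>x. cmod (g x) \<partial>\<mu>)\<^sup>2"
    unfolding msq_def by (rule \<mu>.variance_eq[OF i1 i2])
  finally have "(\<integral>x. cmod (g x) \<partial>\<mu>) \<le> sqrt (msq g)"
    by (intro real_le_rsqrt) simp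
  moreover have "(\<integral>\<^sup>+x. ennreal (cmod (g x)) \<partial>\<mu>) = ennreal (\<integral>x. cmod (g x) \<partial>\<mu>)"
    by (rule nn_integral_eq_integral[OF i1]) simp
  ultimately show ?thesis by (simp add: ennreal_leI)
qed

lemma ip_mon_le_msq:
  assumes "g \<in> polys n" "\<beta> \<in> multi_upto n"
  shows "cmod (ip g (mon \<beta>)) \<le> mon_sq \<beta> * (Cb * Ab ^ Suc n * sqrt (msq g))"
proof -
  let ?c = "\<lambda>\<beta>. ip g (mon \<beta>) / mon_sq \<beta>"
  have "ennreal (cmod (?c \<beta>)) \<le> ennreal (Cb * Ab ^ Suc n) * (\<integral>\<^sup>+x. ennreal (cmod (mpoly_of p n ?c x)) \<partial>\<mu>)"
    by (rule coeff_bound[OF assms(2), of ?c])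
  also have "mpoly_of p n ?c = g" using polys_eq_mpoly[OF assms(1)] by simp
  also have "ennreal (Cb * Ab ^ Suc n) * (\<integral>\<^sup>+x. ennreal (cmod (g x)) \<partial>\<mu>)
      \<le> ennreal (Cb * Ab ^ Suc n) * ennreal (sqrt (msq g))"
    by (intro mult_left_mono nn_integral_le_msq continuous_polys[OF assms(1)]) auto
  also have "\<dots> = ennreal (Cb * Ab ^ Suc n * sqrt (msq g))"
    using coeff_consts by (intro ennreal_mult[symmetric]) (auto simp: msq_def)
  finally have "cmod (?c \<beta>) \<le> Cb * Ab ^ Suc n * sqrt (msq g)"
    using coeff_consts by (subst (asm) ennreal_le_iff) (auto simp: msq_def)
  moreover have "cmod (?c \<beta>) = cmod (ip g (mon \<beta>)) / mon_sq \<beta>"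
    by (simp add: norm_divide abs_of_pos)
  ultimately show ?thesis
    by (simp add: pos_divide_le_eq mult.commute)
qed

text \<open>Expanding \<open>q\<close> in its fixed finite set of monomials keeps \<open>D\<close>
  independent of \<open>n\<close>; the degree of \<open>g\<close> enters only through the power of
  \<open>Ab\<close>.\<close>

lemma ip_poly_le_msq:
  assumes q: "q \<in> polys m"
  shows "\<exists>D\<ge>0. \<forall>n\<ge>m. \<forall>g\<in>polys n. cmod (ip g q) \<le> D * Ab ^ Suc n * sqrt (msq g)"
proof -
  define b where "b \<beta> = ip q (mon \<beta>) / mon_sq \<beta>" for \<beta>
  define D where "D = (\<Sum>\<beta>\<in>multi_upto m. cmod (b \<beta>) * mon_sq \<beta>) * Cb"
  have q_eq: "q = (\<Sum>\<beta>\<in>multi_upto m. cscale (b \<beta>) (mon \<beta>))"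
    using oproj_span[OF _ _ _ _ q] by (auto simp: mon_orth mon_nonzero b_def ip_mon_self)
  have "cmod (ip g q) \<le> D * Ab ^ Suc n * sqrt (msq g)" if n: "n \<ge> m" and g: "g \<in> polys n" for n g
  proof -
    have "ip g q = (\<Sum>\<beta>\<in>multi_upto m. cnj (b \<beta>) * ip g (mon \<beta>))"
      unfolding q_eq using polys_in[OF g] by (simp add: ip_sum_right ip_scale_right)
    then have "cmod (ip g q) \<le> (\<Sum>\<beta>\<in>multi_upto m. cmod (b \<beta>) * cmod (ip g (mon \<beta>)))"
      by (simp add: sum_norm_le norm_mult)
    also have "\<dots> \<le> (\<Sum>\<beta>\<in>multi_upto m. cmod (b \<beta>) * (mon_sq \<beta> * (Cb * Ab ^ Suc n * sqrt (msq g))))"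
      using multi_upto_mono[OF n] by (intro sum_mono mult_left_mono ip_mon_le_msq g) auto
    also have "\<dots> = D * Ab ^ Suc n * sqrt (msq g)"
      unfolding D_def sum_distrib_right by (simp only: mult_ac)
    finally show ?thesis .
  qed
  moreover have "D \<ge> 0"
    unfolding D_def using coeff_consts by (intro mult_nonneg_nonneg sum_nonneg) (auto intro: less_imp_le)
  ultimately show ?thesis by blast
qed

text \<open>The tail increases with \<open>rad\<close>, so a maximiser of \<open>rad\<close> on the
  compact set \<open>K\<close> serves all degrees at once.\<close>

lemma uniform_tail: "\<exists>x0. \<forall>n. \<forall>x\<in>K. tail n x \<le> tail n x0"
proof (cases "K = {}")
  case False
  have "continuous_on K rad" unfolding rad_def by (intro continuous_intros) (use sigma_pos in auto)
  then obtain x0 where x0: "x0 \<in> K" "\<forall>x\<in>K. rad x \<le> rad x0"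
    using continuous_attains_sup[OF compact False] by blast
  have "tail n x \<le> tail n x0" if "x \<in> K" for n x
    unfolding tail_def using x0(2) that by (intro divide_right_mono mult_mono power_mono) auto
  then show ?thesis by blast
qed auto

text \<open>Pythagoras in L2: h - T is the sum of h - P and the polynomial P - T, which are
  orthogonal by hypothesis.\<close>

lemma msq_projection_le:
  assumes h: "continuous_on UNIV h" and P: "P \<in> polys n" and T: "T \<in> polys n"
    and orth: "\<And>q. q \<in> polys n \<Longrightarrow> (\<integral>x. cnj (h x - P x) * q x \<partial>\<mu>) = 0"
  shows "msq (P - T) \<le> msq (h - T)"
proof -
  note cP = continuous_polys[OF P, of UNIV] and cT = continuous_polys[OF T, of UNIV]
  have "(\<integral>x. cnj (h x - P x) * (P - T) x \<partial>\<mu>) = 0"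
    using P T by (intro orth cfun.span_diff)
  moreover have "integrable \<mu> (\<lambda>x. cnj (h x - P x) * (P - T) x)"
    unfolding minus_apply by (intro integrable_continuous continuous_intros h cP cT)
  ultimately have cross: "(\<integral>x. Re (cnj (h x - P x) * (P - T) x) \<partial>\<mu>) = 0"
    by (simp only: integral_Re zero_complex.sel)
  have pt: "(cmod ((h - T) x))\<^sup>2
      = (cmod (h x - P x))\<^sup>2 + (cmod ((P - T) x))\<^sup>2 + 2 * Re (cnj (h x - P x) * (P - T) x)" for x
  proof -
    have "(cmod (a + b))\<^sup>2 = (cmod a)\<^sup>2 + (cmod b)\<^sup>2 + 2 * Re (cnj a * b)" for a b :: complex
      unfolding cmod_power2 by (simp add: power2_eq_square algebra_simps)
    from this[of "h x - P x" "(P - T) x"] show ?thesis by simp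
  qed
  have i: "integrable \<mu> (\<lambda>x. (cmod (h x - P x))\<^sup>2)" "integrable \<mu> (\<lambda>x. (cmod ((P - T) x))\<^sup>2)"
    "integrable \<mu> (\<lambda>x. 2 * Re (cnj (h x - P x) * (P - T) x))"
    unfolding minus_apply by (intro integrable_continuous continuous_intros h cP cT)+
  have "msq (h - T) = (\<integral>x. (cmod (h x - P x))\<^sup>2 \<partial>\<mu>) + msq (P - T)
      + 2 * (\<integral>x. Re (cnj (h x - P x) * (P - T) x) \<partial>\<mu>)"
    unfolding msq_def pt using i
    by (simp only: Bochner_Integration.integral_add Bochner_Integration.integrable_add integral_mult_right_zero)
  moreover have "0 \<le> (\<integral>x. (cmod (h x - P x))\<^sup>2 \<partial>\<mu>)" by simp
  ultimately show ?thesis using cross by simp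
qed

lemma msq_taylor_error:
  assumes h: "h \<in> H" "continuous_on UNIV h" and x0: "\<forall>n. \<forall>x\<in>K. tail n x \<le> tail n x0"
  shows "msq (h - taylor n h) \<le> (hnorm h)\<^sup>2 * tail n x0"
proof -
  interpret \<mu>: prob_space \<mu> by (rule prob_law)
  have c: "continuous_on UNIV (\<lambda>x. (cmod ((h - taylor n h) x))\<^sup>2)"
    unfolding minus_apply by (intro continuous_intros h(2) continuous_polys[OF taylor_span])
  have "AE x in \<mu>. (cmod ((h - taylor n h) x))\<^sup>2 \<le> (hnorm h)\<^sup>2 * tail n x0"
    using supp
  proof eventually_elim
    case (elim x)
    have "(cmod ((h - taylor n h) x))\<^sup>2 \<le> (hnorm h * sqrt (tail n x))\<^sup>2"
      using taylor_error[OF h(1), of x n] by (intro power_mono) auto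
    also have "\<dots> = (hnorm h)\<^sup>2 * tail n x" by (simp add: power_mult_distrib)
    also have "\<dots> \<le> (hnorm h)\<^sup>2 * tail n x0" using x0 elim by (intro mult_left_mono) auto
    finally show ?case .
  qed
  then have "msq (h - taylor n h) \<le> (\<integral>x. (hnorm h)\<^sup>2 * tail n x0 \<partial>\<mu>)"
    unfolding msq_def by (intro integral_mono_AE integrable_continuous c) auto
  then show ?thesis by (simp add: \<mu>.prob_space)
qed

lemma ip_taylor_poly:
  assumes "h \<in> H" "q \<in> polys n"
  shows "ip (taylor n h) q = ip h q"
proof -
  have "ip (h - taylor n h) q = 0"
    using assms by (intro ip_span_eq_0[OF _ _ assms(2)]) (auto simp: ip_diff ip_taylor)
  then show ?thesis using assms polys_in by (simp add: ip_diff)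
qed

text \<open>For n at least m, \<open>q\<close> cannot distinguish \<open>h\<close> from its Taylor
  polynomial of degree \<open>n\<close>. The error is thus a pairing of \<open>q\<close> with a
  polynomial of degree at most n, to which \<open>ip_poly_le_msq\<close> applies; a bare L2 bound on
  h minus its projection would not control it.\<close>

lemma projection_coeff_tendsto:
  assumes h: "h \<in> H" "continuous_on UNIV h" and q: "q \<in> polys m"
    and P: "\<And>n. n \<ge> m \<Longrightarrow> P n \<in> polys n"
    and orth: "\<And>n g. n \<ge> m \<Longrightarrow> g \<in> polys n \<Longrightarrow> (\<integral>x. cnj (h x - P n x) * g x \<partial>\<mu>) = 0"
  shows "(\<lambda>n. ip (P n) q) \<longlonglongrightarrow> ip h q"
proof -
  obtain x0 where x0: "\<forall>n. \<forall>x\<in>K. tail n x \<le> tail n x0" using uniform_tail by blast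
  obtain D where D: "D \<ge> 0" "\<forall>n\<ge>m. \<forall>g\<in>polys n. cmod (ip g q) \<le> D * Ab ^ Suc n * sqrt (msq g)"
    using ip_poly_le_msq[OF q] by blast
  have bound: "cmod (ip (P n) q - ip h q) \<le> (D * Ab * hnorm h) * sqrt (tail n x0 * (Ab\<^sup>2) ^ n)"
    if n: "n \<ge> m" for n
  proof -
    have qn: "q \<in> polys n" using q polys_mono[OF n] by blast
    have PT: "P n - taylor n h \<in> polys n"
      by (intro cfun.span_diff P n taylor_span)
    have "ip (P n) q - ip h q = ip (P n - taylor n h) q"
      using polys_in[OF P[OF n]] polys_in[OF q] by (simp add: ip_diff ip_taylor_poly[OF h(1) qn])
    then have "cmod (ip (P n) q - ip h q) \<le> D * Ab ^ Suc n * sqrt (msq (P n - taylor n h))"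
      using D(2) n PT by simp
    also have "msq (P n - taylor n h) \<le> msq (h - taylor n h)"
      by (rule msq_projection_le[OF h(2) P[OF n] taylor_span orth[OF n]])
    also have "msq (h - taylor n h) \<le> (hnorm h)\<^sup>2 * tail n x0"
      by (rule msq_taylor_error[OF h x0])
    also have "sqrt ((hnorm h)\<^sup>2 * tail n x0) = hnorm h * sqrt (tail n x0)"
      using h(1) by (simp add: real_sqrt_mult)
    also have "D * Ab ^ Suc n * (hnorm h * sqrt (tail n x0)) = (D * Ab * hnorm h) * (sqrt (tail n x0) * Ab ^ n)"
      by (simp add: mult_ac)
    \<comment> \<open>The geometric factor moves under the root so that \<open>tail_tendsto\<close>
      applies with base Ab^2.\<close>
    also have "sqrt (tail n x0) * Ab ^ n = sqrt (tail n x0 * (Ab\<^sup>2) ^ n)"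
    proof -
      have "(Ab\<^sup>2) ^ n = (Ab ^ n)\<^sup>2" by (simp add: mult.commute flip: power_mult)
      then show ?thesis using coeff_consts by (simp add: real_sqrt_mult)
    qed
    finally show ?thesis using D(1) coeff_consts by (simp add: mult_left_mono)
  qed
  have "(\<lambda>n. (D * Ab * hnorm h) * sqrt (tail n x0 * (Ab\<^sup>2) ^ n)) \<longlonglongrightarrow> (D * Ab * hnorm h) * sqrt 0"
    by (intro tendsto_intros tail_tendsto)
  then have "(\<lambda>n. (D * Ab * hnorm h) * sqrt (tail n x0 * (Ab\<^sup>2) ^ n)) \<longlonglongrightarrow> 0" by simp
  then have "(\<lambda>n. ip (P n) q - ip h q) \<longlonglongrightarrow> 0"
    by (rule Lim_null_comparison[rotated]) (use bound in \<open>auto simp: eventually_sequentially\<close>)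
  then show ?thesis by (simp add: LIM_zero_iff)
qed

section \<open>Population matrices and the normal equations\<close>

lemma integral_weighted_sum:
  fixes a :: "'i \<Rightarrow> complex"
  assumes "\<And>i. i \<in> I \<Longrightarrow> integrable \<mu> (\<phi> i)"
  shows "integrable \<mu> (\<lambda>x. \<Sum>i\<in>I. a i * \<phi> i x)"
    and "(\<integral>x. (\<Sum>i\<in>I. a i * \<phi> i x) \<partial>\<mu>) = (\<Sum>i\<in>I. a i * (\<integral>x. \<phi> i x \<partial>\<mu>))"
proof -
  have i: "\<And>i. i \<in> I \<Longrightarrow> integrable \<mu> (\<lambda>x. a i * \<phi> i x)"
    by (intro integrable_mult_right assms)
  show "integrable \<mu> (\<lambda>x. \<Sum>i\<in>I. a i * \<phi> i x)"
    by (intro Bochner_Integration.integrable_sum i)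
  have "(\<integral>x. (\<Sum>i\<in>I. a i * \<phi> i x) \<partial>\<mu>) = (\<Sum>i\<in>I. \<integral>x. a i * \<phi> i x \<partial>\<mu>)"
    by (intro Bochner_Integration.integral_sum i)
  then show "(\<integral>x. (\<Sum>i\<in>I. a i * \<phi> i x) \<partial>\<mu>) = (\<Sum>i\<in>I. a i * (\<integral>x. \<phi> i x \<partial>\<mu>))"
    by (simp only: integral_mult_right_zero)
qed

text \<open>The almost sure limit of the product of the feature matrix with its adjoint, divided by
  N. \<open>cross_cov\<close> is the analogue with the features of the images in the first
  factor.\<close>

definition cov :: "nat \<Rightarrow> complex mat" where
  "cov n = Matrix.mat (r n) (r n) (\<lambda>(i, j). \<integral>x. cnj (v i x) * v j x \<partial>\<mu>)"

definition cross_cov :: "nat \<Rightarrow> nat \<Rightarrow> complex mat" where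
  "cross_cov m n = Matrix.mat (r m) (r n) (\<lambda>(i, j). \<integral>x. cnj (v i (f x)) * v j x \<partial>\<mu>)"

lemma cov_carrier: "cov n \<in> carrier_mat (r n) (r n)"
  and cross_cov_carrier: "cross_cov m n \<in> carrier_mat (r m) (r n)"
  by (simp_all add: cov_def cross_cov_def)

lemma continuous_v: "i < r n \<Longrightarrow> continuous_on S (v i)"
  by (rule continuous_polys[OF v_polys])

lemma continuous_v_f: "i < r n \<Longrightarrow> continuous_on UNIV (\<lambda>x. v i (f x))"
  using continuous_on_compose2[OF continuous_v f_cont] by auto

text \<open>Monomials of every degree have to be tested, so \<open>g\<close> is regarded as a
  polynomial of a degree large enough for the monomial at hand.\<close>

lemma msq_eq_0:
  assumes g: "g \<in> polys n" and "msq g = 0"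
  shows "g = 0"
proof (rule eq_0_if_perp[OF polys_in[OF g]])
  fix \<alpha> :: "'d \<Rightarrow> nat"
  define k where "k = max n (mdeg \<alpha>)"
  have "g \<in> polys k" using g polys_mono[of n k] by (auto simp: k_def)
  moreover have "\<alpha> \<in> multi_upto k" by (simp add: multi_upto_def k_def)
  ultimately have "cmod (ip g (mon \<alpha>)) \<le> mon_sq \<alpha> * (Cb * Ab ^ Suc k * sqrt (msq g))"
    by (rule ip_mon_le_msq)
  then show "ip g (mon \<alpha>) = 0" using assms(2) by simp
qed

text \<open>A kernel vector \<open>w\<close> of \<open>cov\<close> gives the polynomial with
  coefficients \<open>w\<close>, whose mean square is the quadratic form of \<open>cov\<close> at
  \<open>w\<close> and hence 0.\<close>

lemma det_cov: "Determinant.det (cov n) \<noteq> 0"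
proof
  assume "Determinant.det (cov n) = 0"
  then obtain w where w: "w \<in> carrier_vec (r n)" "w \<noteq> 0\<^sub>v (r n)" "cov n *\<^sub>v w = 0\<^sub>v (r n)"
    using det_0_iff_vec_prod_zero[OF cov_carrier] by blast
  define c where "c j = vec_index w j" for j
  define g where "g = (\<Sum>j<r n. cscale (c j) (v j))"
  have g: "g \<in> polys n"
    unfolding g_def by (intro cfun.span_sum cfun.span_scale v_polys) auto
  have gx: "g x = (\<Sum>j<r n. c j * v j x)" for x
    by (simp add: g_def sum_fun_apply cscale_def)
  have int: "integrable \<mu> (\<lambda>x. cnj (v i x) * v j x)" if "i < r n" "j < r n" for i j
    by (intro integrable_continuous continuous_intros continuous_v[OF that(1)] continuous_v[OF that(2)])
  have row: "(\<Sum>j<r n. c j * (\<integral>x. cnj (v i x) * v j x \<partial>\<mu>)) = 0" if i: "i < r n" for i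
  proof -
    have "0 = vec_index (cov n *\<^sub>v w) i" using i w by simp
    also have "\<dots> = (\<Sum>j<r n. cov n $$ (i, j) * c j)"
      using i w(1) cov_carrier[of n] by (auto simp: scalar_prod_def c_def atLeast0LessThan intro!: sum.cong)
    finally show ?thesis using i by (simp add: cov_def mult.commute)
  qed
  have "complex_of_real (msq g) = (\<integral>x. cnj (g x) * g x \<partial>\<mu>)"
    unfolding msq_def integral_complex_of_real[symmetric]
    by (intro Bochner_Integration.integral_cong refl) (simp only: complex_norm_square mult.commute)
  also have "\<dots> = (\<integral>x. (\<Sum>i<r n. cnj (c i) * (\<Sum>j<r n. c j * (cnj (v i x) * v j x))) \<partial>\<mu>)"
    by (intro Bochner_Integration.integral_cong refl)
      (simp add: gx sum_distrib_left sum_distrib_right mult_ac sum_product)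
  also have "\<dots> = (\<Sum>i<r n. cnj (c i) * (\<Sum>j<r n. c j * (\<integral>x. cnj (v i x) * v j x \<partial>\<mu>)))"
  proof -
    have "(\<integral>x. (\<Sum>i<r n. cnj (c i) * (\<Sum>j<r n. c j * (cnj (v i x) * v j x))) \<partial>\<mu>)
        = (\<Sum>i<r n. cnj (c i) * (\<integral>x. (\<Sum>j<r n. c j * (cnj (v i x) * v j x)) \<partial>\<mu>))"
      using int by (intro integral_weighted_sum) auto
    also have "\<dots> = (\<Sum>i<r n. cnj (c i) * (\<Sum>j<r n. c j * (\<integral>x. cnj (v i x) * v j x \<partial>\<mu>)))"
      using int by (intro sum.cong refl arg_cong2[where f = "(*)"] integral_weighted_sum) auto
    finally show ?thesis .
  qed
  also have "\<dots> = 0" using row by simp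
  finally have "g = 0" using msq_eq_0[OF g] by simp
  have "c i = 0" if i: "i < r n" for i
  proof -
    have "c i * ip (v i) (v i) = ip g (v i)"
      unfolding g_def using i by (subst ip_comb) (auto simp: v_in v_orth v_nonzero)
    also have "\<dots> = 0" using \<open>g = 0\<close> v_in[OF i] by simp
    finally show ?thesis using ip_v_self_nz[OF i] by simp
  qed
  then have "w = 0\<^sub>v (r n)" using w(1) by (intro eq_vecI) (auto simp: c_def)
  then show False using w(2) by simp
qed

text \<open>\<open>cross_cov\<close> times the inverse of \<open>cov\<close>, the latter as adjugate
  over determinant.\<close>

definition est :: "nat \<Rightarrow> nat \<Rightarrow> complex mat" where
  "est m n = cross_cov m n * ((1 / Determinant.det (cov n)) \<cdot>\<^sub>m adj_mat (cov n))"

lemma est_carrier: "est m n \<in> carrier_mat (r m) (r n)"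
  unfolding est_def using adj_mat(1)[OF cov_carrier[of n]]
  by (intro mult_carrier_mat[OF cross_cov_carrier]) simp

lemma est_cov: "est m n * cov n = cross_cov m n"
proof -
  let ?d = "1 / Determinant.det (cov n)"
  have a: "adj_mat (cov n) \<in> carrier_mat (r n) (r n)" by (rule adj_mat(1)[OF cov_carrier])
  have "est m n * cov n = cross_cov m n * ((?d \<cdot>\<^sub>m adj_mat (cov n)) * cov n)"
    unfolding est_def by (rule assoc_mult_mat[OF cross_cov_carrier smult_carrier_mat[OF a] cov_carrier])
  also have "(?d \<cdot>\<^sub>m adj_mat (cov n)) * cov n = 1\<^sub>m (r n)"
    unfolding mult_smult_assoc_mat[OF a cov_carrier] adj_mat(3)[OF cov_carrier] smult_smult
    using det_cov[of n] by (simp add: one_smult)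
  also have "cross_cov m n * 1\<^sub>m (r n) = cross_cov m n" using cross_cov_carrier by (rule right_mult_one_mat)
  finally show ?thesis .
qed

lemma v_comp_in:
  assumes "i < r m"
  shows "v i \<circ> f \<in> H"
proof -
  have "polys m \<subseteq> cfun.span (range mon)" by (intro cfun.span_mono image_mono) simp
  then have "v i \<in> cfun.span (range mon)" using v_polys[OF assms] by (rule subsetD)
  then show ?thesis by (rule span_comp_in[OF f_diff f_fix mon_comp])
qed

text \<open>By \<open>est_cov\<close> the conjugated row \<open>i\<close> solves the normal
  equations, so \<open>P n\<close> is the L2-projection of \<open>v i \<circ> f\<close>. Its
  coefficient at \<open>v j\<close> is read off with the inner product of \<open>H\<close>, in which
  the basis is orthogonal.\<close>

lemma est_tendsto:
  assumes i: "i < r m" and j: "j < r m"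
  shows "(\<lambda>n. est m n $$ (i, j)) \<longlonglongrightarrow> cnj (ip (v i \<circ> f) (v j)) / ip (v j) (v j)"
proof -
  define h where "h = v i \<circ> f"
  have h: "h \<in> H" "continuous_on UNIV h"
    using v_comp_in[OF i] continuous_v_f[OF i] by (simp_all add: h_def comp_def)
  define P where "P n = (\<Sum>l<r n. cscale (cnj (est m n $$ (i, l))) (v l))" for n
  have P: "P n \<in> polys n" for n
    unfolding P_def by (intro cfun.span_sum cfun.span_scale v_polys) auto
  have orth: "(\<integral>x. cnj (h x - P n x) * g x \<partial>\<mu>) = 0" if g: "g \<in> polys n" for n g
  proof -
    have int: "integrable \<mu> (\<lambda>x. cnj (v l x) * v k x)" "integrable \<mu> (\<lambda>x. cnj (h x) * v k x)"
      if "l < r n" "k < r n" for l k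
      by (intro integrable_continuous continuous_intros continuous_v[OF that(1)] continuous_v[OF that(2)] h(2))+
    have basis: "(\<integral>x. cnj (h x - P n x) * v k x \<partial>\<mu>) = 0" if k: "k < r n" for k
    proof -
      have "(\<integral>x. cnj (h x - P n x) * v k x \<partial>\<mu>)
          = (\<integral>x. cnj (h x) * v k x - (\<Sum>l<r n. est m n $$ (i, l) * (cnj (v l x) * v k x)) \<partial>\<mu>)"
        by (intro Bochner_Integration.integral_cong refl)
          (simp add: P_def sum_fun_apply cscale_def left_diff_distrib sum_distrib_right mult.assoc)
      also have "\<dots> = (\<integral>x. cnj (h x) * v k x \<partial>\<mu>)
          - (\<integral>x. (\<Sum>l<r n. est m n $$ (i, l) * (cnj (v l x) * v k x)) \<partial>\<mu>)"
        using k int by (intro Bochner_Integration.integral_diff integral_weighted_sum) auto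
      also have "(\<integral>x. (\<Sum>l<r n. est m n $$ (i, l) * (cnj (v l x) * v k x)) \<partial>\<mu>)
          = (\<Sum>l<r n. est m n $$ (i, l) * (\<integral>x. cnj (v l x) * v k x \<partial>\<mu>))"
        using k int by (intro integral_weighted_sum) auto
      also have "\<dots> = (\<Sum>l<r n. est m n $$ (i, l) * cov n $$ (l, k))"
        using k by (intro sum.cong) (auto simp: cov_def)
      also have "\<dots> = (est m n * cov n) $$ (i, k)"
        by (rule mult_index[OF est_carrier cov_carrier i k, symmetric])
      also have "\<dots> = (\<integral>x. cnj (h x) * v k x \<partial>\<mu>)"
        unfolding est_cov using i k by (simp add: cross_cov_def h_def)
      finally show ?thesis by simp
    qed
    define a where "a k = ip g (v k) / ip (v k) (v k)" for k
    have gx: "g x = (\<Sum>k<r n. a k * v k x)" for x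
      using fun_cong[OF v_expand[OF g], of x] by (simp only: sum_fun_apply cscale_def a_def)
    have int': "integrable \<mu> (\<lambda>x. cnj (h x - P n x) * v k x)" if "k < r n" for k
      by (intro integrable_continuous continuous_intros continuous_v[OF that] h(2) continuous_polys[OF P])
    have "(\<integral>x. cnj (h x - P n x) * g x \<partial>\<mu>) = (\<integral>x. (\<Sum>k<r n. a k * (cnj (h x - P n x) * v k x)) \<partial>\<mu>)"
      by (intro Bochner_Integration.integral_cong refl) (simp only: gx sum_distrib_left mult_ac)
    also have "\<dots> = (\<Sum>k<r n. a k * (\<integral>x. cnj (h x - P n x) * v k x \<partial>\<mu>))"
      using int' by (intro integral_weighted_sum) auto
    finally show ?thesis using basis by simp
  qed
  have lim: "(\<lambda>n. ip (P n) (v j)) \<longlonglongrightarrow> ip h (v j)"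
    by (rule projection_coeff_tendsto[OF h v_polys[OF j] P orth])
  \<comment> \<open>Only for n at least m is \<open>j\<close> known to be a column index of
    \<open>est m n\<close>.\<close>
  have ev: "\<forall>\<^sub>F n in sequentially. cnj (ip (P n) (v j)) / cnj (ip (v j) (v j)) = est m n $$ (i, j)"
    using eventually_ge_at_top[of m]
  proof eventually_elim
    case (elim n)
    then have jn: "j < r n" using j r_mono[of m n] by linarith
    have "ip (P n) (v j) = cnj (est m n $$ (i, j)) * ip (v j) (v j)"
      unfolding P_def using jn by (subst ip_comb) (auto simp: v_in v_orth v_nonzero)
    then show ?case using ip_v_self_nz[OF jn] by simp
  qed
  have "(\<lambda>n. cnj (ip (P n) (v j)) / cnj (ip (v j) (v j))) \<longlonglongrightarrow> cnj (ip h (v j)) / cnj (ip (v j) (v j))"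
    using ip_v_self_nz[OF j] by (intro tendsto_intros lim) auto
  then have "(\<lambda>n. est m n $$ (i, j)) \<longlonglongrightarrow> cnj (ip h (v j)) / cnj (ip (v j) (v j))"
    by (rule Lim_transform_eventually[OF _ ev])
  then show ?thesis
    unfolding h_def ip_commute[OF v_in[OF j] v_in[OF j], symmetric] .
qed

section \<open>The target matrix\<close>

definition target :: "nat \<Rightarrow> complex mat" where
  "target m = gram_matrix ip v (r m)
     * matrix_in_basis v (r m) (adjoint_op H ip (comp_dom H f) (comp_op f))
     * the (mat_inverse (gram_matrix ip v (r m)))"

lemma gram_eq: "gram_matrix ip v k = Matrix.mat k k (\<lambda>(i, j). if i = j then ip (v i) (v i) else 0)"
  by (auto simp: gram_matrix_def v_orth intro!: eq_matI)

lemma target_carrier: "target m \<in> carrier_mat (r m) (r m)"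
proof -
  have "the (mat_inverse (gram_matrix ip v (r m))) \<in> carrier_mat (r m) (r m)"
    unfolding gram_eq by (subst diag_mat_inverse) (auto simp: ip_v_self_nz)
  then show ?thesis
    unfolding target_def by (intro mult_carrier_mat[of _ _ "r m"]) (auto simp: gram_matrix_def matrix_in_basis_def)
qed

text \<open>The coordinates of the adjoint image of \<open>v j\<close> are normalised by the row
  vector \<open>v i\<close>. Conjugation by the diagonal Gram matrix replaces this by the column
  vector \<open>v j\<close>, which is the normalisation in the limit of the estimator.\<close>

lemma target_index:
  assumes i: "i < r m" and j: "j < r m"
  shows "target m $$ (i, j) = cnj (ip (v i \<circ> f) (v j)) / ip (v j) (v j)"
proof -
  define A where "A = adjoint_op H ip (comp_dom H f) (comp_op f) (v j)"
  have A: "A \<in> polys m" "\<And>u. u \<in> H \<Longrightarrow> u \<circ> f \<in> H \<Longrightarrow> ip (u \<circ> f) (v j) = ip u A"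
    unfolding A_def using adjoint_jet[OF f_diff f_fix mon_comp v_polys[OF j]] by blast+
  have "cfun.representation (v ` {..<r m}) A (v i) = ip A (v i) / ip (v i) (v i)"
    using v_basis[of m] i
    by (intro representation_span_image[where c = "\<lambda>i. ip A (v i) / ip (v i) (v i)"] v_expand A(1)) (auto simp: is_basis_def)
  also have "ip A (v i) = cnj (ip (v i) A)" by (rule ip_commute[OF polys_in[OF A(1)] v_in[OF i]])
  also have "ip (v i) A = ip (v i \<circ> f) (v j)" using A(2) v_in[OF i] v_comp_in[OF i] by simp
  finally have rep: "matrix_in_basis v (r m) (adjoint_op H ip (comp_dom H f) (comp_op f)) $$ (i, j)
      = cnj (ip (v i \<circ> f) (v j)) / ip (v i) (v i)"
    using i j by (simp add: matrix_in_basis_def A_def)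
  have "target m $$ (i, j) = ip (v i) (v i)
      * matrix_in_basis v (r m) (adjoint_op H ip (comp_dom H f) (comp_op f)) $$ (i, j) / ip (v j) (v j)"
    unfolding target_def gram_eq
    by (rule diag_conjugate_index[OF _ _ i j]) (auto simp: matrix_in_basis_def ip_v_self_nz)
  then show ?thesis unfolding rep using ip_v_self_nz[OF i] by simp
qed

lemma est_norm_tendsto:
  "(\<lambda>n. frobenius_norm (first_columns (r m) (est m n) - target m)) \<longlonglongrightarrow> 0"
proof -
  have c: "first_columns (r m) (est m n) \<in> carrier_mat (r m) (r m)" for n
    using est_carrier[of m n] by (auto simp: first_columns_def)
  have "(\<lambda>n. frobenius_norm (first_columns (r m) (est m n) - target m))
      \<longlonglongrightarrow> frobenius_norm (target m - target m)"
  proof (rule frobenius_norm_tendsto[OF c target_carrier target_carrier])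
    fix i j assume ij: "i < r m" "j < r m"
    have "first_columns (r m) (est m n) $$ (i, j) = est m n $$ (i, j)" for n
      using ij est_carrier[of m n] by (auto simp: first_columns_def)
    then show "(\<lambda>n. first_columns (r m) (est m n) $$ (i, j)) \<longlonglongrightarrow> target m $$ (i, j)"
      using est_tendsto[OF ij] target_index[OF ij] by simp
  qed
  also have "frobenius_norm (target m - target m) = 0"
    using target_carrier[of m] by (auto simp: frobenius_norm_def)
  finally show ?thesis .
qed

text \<open>Countably many averages are involved, so one null set serves all degrees and the limit
  in n can be taken along a fixed sample path.\<close>

lemma AE_averages:
  "AE \<omega> in M. \<forall>n i j. i < r n \<longrightarrow> j < r n \<longrightarrow>
    (\<lambda>N. (\<Sum>l<N. cnj (v i (X l \<omega>)) * v j (X l \<omega>)) / of_nat N) \<longlonglongrightarrow> (\<integral>x. cnj (v i x) * v j x \<partial>\<mu>) \<and>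
    (\<lambda>N. (\<Sum>l<N. cnj (v i (f (X l \<omega>))) * v j (X l \<omega>)) / of_nat N) \<longlonglongrightarrow> (\<integral>x. cnj (v i (f x)) * v j x \<partial>\<mu>)"
proof -
  have *: "AE \<omega> in M. i < r n \<longrightarrow> j < r n \<longrightarrow>
    (\<lambda>N. (\<Sum>l<N. cnj (v i (X l \<omega>)) * v j (X l \<omega>)) / of_nat N) \<longlonglongrightarrow> (\<integral>x. cnj (v i x) * v j x \<partial>\<mu>) \<and>
    (\<lambda>N. (\<Sum>l<N. cnj (v i (f (X l \<omega>))) * v j (X l \<omega>)) / of_nat N) \<longlonglongrightarrow> (\<integral>x. cnj (v i (f x)) * v j x \<partial>\<mu>)"
    for n i j
  proof (cases "i < r n \<and> j < r n")
    case True
    then have ij: "i < r n" "j < r n" by auto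
    have "continuous_on UNIV (\<lambda>x. cnj (v i x) * v j x)" "continuous_on UNIV (\<lambda>x. cnj (v i (f x)) * v j x)"
      by (intro continuous_intros continuous_v[OF ij(1)] continuous_v_f[OF ij(1)] continuous_v[OF ij(2)])+
    from strong_law_complex[OF this(1)] strong_law_complex[OF this(2)] show ?thesis
      by eventually_elim simp
  qed auto
  show ?thesis unfolding AE_all_countable by (intro allI *)
qed

theorem C_hat_converges:
  "AE \<omega> in M. \<exists>L :: nat \<Rightarrow> real.
    (\<forall>n\<ge>m. (\<lambda>N. frobenius_norm
        (C_hat v (r m) (r n) N (\<lambda>i. X i \<omega>) (\<lambda>i. f (X i \<omega>)) - target m)) \<longlonglongrightarrow> L n)
    \<and> L \<longlonglongrightarrow> 0"
  using AE_averages
proof eventually_elim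
  case (elim \<omega>)
  have lim: "(\<lambda>N. frobenius_norm (C_hat v (r m) (r n) N (\<lambda>i. X i \<omega>) (\<lambda>i. f (X i \<omega>)) - target m))
      \<longlonglongrightarrow> frobenius_norm (first_columns (r m) (est m n) - target m)" if n: "n \<ge> m" for n
  proof (rule frobenius_norm_tendsto[OF _ _ target_carrier])
    show "C_hat v (r m) (r n) N (\<lambda>i. X i \<omega>) (\<lambda>i. f (X i \<omega>)) \<in> carrier_mat (r m) (r m)" for N
      by (auto simp: C_hat_def first_columns_def feature_matrix_def)
    show "first_columns (r m) (est m n) \<in> carrier_mat (r m) (r m)"
      using est_carrier[of m n] by (auto simp: first_columns_def)
    fix i j assume ij: "i < r m" "j < r m"
    have rmn: "r m \<le> r n" by (rule r_mono[OF n])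
    have "(\<lambda>N. C_hat v (r m) (r n) N (\<lambda>i. X i \<omega>) (\<lambda>i. f (X i \<omega>)) $$ (i, j)) \<longlonglongrightarrow> est m n $$ (i, j)"
    proof (rule C_hat_tendsto[OF cov_carrier det_cov est_carrier rmn _ _ ij])
      fix a b assume "a < r n" "b < r n"
      then show "(\<lambda>N. (\<Sum>l<N. cnj (v a (X l \<omega>)) * v b (X l \<omega>)) / of_nat N) \<longlonglongrightarrow> cov n $$ (a, b)"
        using elim[rule_format, where i = a and n = n and j = b] by (simp add: cov_def)
    next
      fix a b assume "a < r m" "b < r n"
      then show "(\<lambda>N. (\<Sum>l<N. cnj (v a (f (X l \<omega>))) * v b (X l \<omega>)) / of_nat N) \<longlonglongrightarrow> (est m n * cov n) $$ (a, b)"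
        using elim[rule_format, where i = a and n = n and j = b] rmn by (simp add: est_cov cross_cov_def)
    qed
    moreover have "first_columns (r m) (est m n) $$ (i, j) = est m n $$ (i, j)"
      using ij est_carrier[of m n] by (auto simp: first_columns_def)
    ultimately show "(\<lambda>N. C_hat v (r m) (r n) N (\<lambda>i. X i \<omega>) (\<lambda>i. f (X i \<omega>)) $$ (i, j))
        \<longlonglongrightarrow> first_columns (r m) (est m n) $$ (i, j)" by simp
  qed
  show ?case
    \<comment> \<open>The inner limits do not depend on the sample path: each is the distance of the
      population estimator from the target.\<close>
    by (intro exI[of _ "\<lambda>n. frobenius_norm (first_columns (r m) (est m n) - target m)"] conjI allI impI
        lim est_norm_tendsto)
qed

end

section \<open>From the hypotheses on the density to the abstract setting\<close>

lemma ess_inf_pos_lower_bound: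
  fixes \<rho> :: "'a::euclidean_space \<Rightarrow> real"
  assumes "open U" "0 < ess_inf (restrict_space lborel U) (\<lambda>x. ereal (\<rho> x))"
  shows "\<exists>\<epsilon>>0. AE x in lborel. x \<in> U \<longrightarrow> \<epsilon> \<le> \<rho> x"
proof -
  obtain c where c: "0 < c" "AE x in restrict_space lborel U. c \<le> ereal (\<rho> x)"
    using assms(2) unfolding ess_inf_def less_Sup_iff by blast
  \<comment> \<open>The lower bound \<open>c\<close> is an extended real and may be infinite, so a
    real number below it is chosen.\<close>
  obtain \<epsilon> :: real where \<epsilon>: "0 < ereal \<epsilon>" "ereal \<epsilon> < c"
    using ereal_dense2[OF c(1)] by blast
  have "AE x in lborel. x \<in> U \<longrightarrow> c \<le> ereal (\<rho> x)"
    using c(2) assms(1) by (subst (asm) AE_restrict_space_iff) auto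
  then have "AE x in lborel. x \<in> U \<longrightarrow> \<epsilon> \<le> \<rho> x"
  proof eventually_elim
    case (elim x)
    show ?case
    proof
      assume "x \<in> U"
      then have "ereal \<epsilon> < ereal (\<rho> x)" using elim \<epsilon>(2) by (blast intro: less_le_trans)
      then show "\<epsilon> \<le> \<rho> x" by simp
    qed
  qed
  then show ?thesis using \<epsilon>(1) by auto
qed

text \<open>The iterated limit is phrased through \<open>L\<close>, so that existence of every inner
  limit is part of the claim and not presupposed by a limit operator.\<close>

theorem theorem7p3:
  fixes \<sigma> :: real
    and p :: "real ^ 'd::finite"
    and f :: "real ^ 'd \<Rightarrow> real ^ 'd"
    and k :: "real ^ 'd \<Rightarrow> real ^ 'd \<Rightarrow> complex"
    and H :: "(real ^ 'd \<Rightarrow> complex) set"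
    and ip :: "(real ^ 'd \<Rightarrow> complex) \<Rightarrow> (real ^ 'd \<Rightarrow> complex) \<Rightarrow> complex"
    and v :: "nat \<Rightarrow> real ^ 'd \<Rightarrow> complex"
    and r :: "nat \<Rightarrow> nat"
    and M :: "'w measure"
    and X :: "nat \<Rightarrow> 'w \<Rightarrow> real ^ 'd"
    and \<rho> :: "real ^ 'd \<Rightarrow> real"
    and K U :: "(real ^ 'd) set"
    and m :: nat
  defines "k \<equiv> exp_kernel \<sigma> p"
    and "r \<equiv> jet_dim k p"
  assumes "\<sigma> > 0"
    and "C_infinity f"
    and "f p = p"
    and "rkhs k H ip"
    and "\<And>\<alpha> :: 'd \<Rightarrow> nat. (\<lambda>x. complex_of_real (\<Prod>i\<in>UNIV. (f x $ i) ^ \<alpha> i)) \<in> H"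
    and "is_basis v UNIV (\<Union>n. jet_space k p n)"
    and "\<And>i j. i \<noteq> j \<Longrightarrow> ip (v i) (v j) = 0"
    and "\<And>n. is_basis v {..<r n} (jet_space k p n)"
    and "prob_space M"
    and "prob_space.indep_vars M (\<lambda>_. borel) X UNIV"
    and "\<And>i. distributed M lborel (X i) (\<lambda>x. ennreal (\<rho> x))"
    and "AE x in lborel. 0 \<le> \<rho> x"
    and "compact K" and "AE x in lborel. x \<notin> K \<longrightarrow> \<rho> x = 0"
    and "open U" and "U \<noteq> {}"
    and "0 < ess_inf (restrict_space lborel U) (\<lambda>x. ereal (\<rho> x))"
  shows "AE \<omega> in M. \<exists>L :: nat \<Rightarrow> real.
    (\<forall>n\<ge>m. (\<lambda>N. frobenius_norm
        (C_hat v (r m) (r n) N (\<lambda>i. X i \<omega>) (\<lambda>i. f (X i \<omega>))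
         - gram_matrix ip v (r m)
           * matrix_in_basis v (r m) (adjoint_op H ip (comp_dom H f) (comp_op f))
           * the (mat_inverse (gram_matrix ip v (r m))))) \<longlonglongrightarrow> L n)
    \<and> L \<longlonglongrightarrow> 0"
proof -
  define \<mu> where "\<mu> = density lborel (\<lambda>x. ennreal (\<rho> x))"
  have rho_meas: "(\<lambda>x. ennreal (\<rho> x)) \<in> borel_measurable lborel"
    using \<open>\<And>i. distributed M lborel (X i) (\<lambda>x. ennreal (\<rho> x))\<close> by (rule distributed_borel_measurable)
  have C: "C_diff 0 f" "C_diff (Suc 0) f"
    using \<open>C_infinity f\<close> unfolding C_infinity_def by blast+
  interpret E: exp_rkhs \<sigma> p H ip
    using \<open>rkhs k H ip\<close> \<open>\<sigma> > 0\<close> unfolding k_def by (intro exp_rkhs.intro exp_rkhs_axioms.intro)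
  have jets: "jet_space k p n = cfun.span (shifted_monomial p ` multi_upto n)" for n
    unfolding k_def by (rule jet_space_eq[OF \<open>\<sigma> > 0\<close>])
  obtain \<epsilon> where \<epsilon>: "\<epsilon> > 0" "AE x in lborel. x \<in> U \<longrightarrow> \<epsilon> \<le> \<rho> x"
    using ess_inf_pos_lower_bound[OF \<open>open U\<close> \<open>0 < ess_inf (restrict_space lborel U) (\<lambda>x. ereal (\<rho> x))\<close>]
    by blast
  obtain B A where BA: "B \<ge> 0" "A \<ge> 1"
    "\<forall>n c \<alpha>. \<alpha> \<in> multi_upto n \<longrightarrow> ennreal (cmod (c \<alpha>))
       \<le> ennreal (B * A ^ Suc n) * (\<integral>\<^sup>+x. ennreal (cmod (mpoly_of p n c x)) \<partial>\<mu>)"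
    using coeff_le_mean[OF \<open>open U\<close> \<open>U \<noteq> {}\<close> \<epsilon> rho_meas, of p] unfolding \<mu>_def by blast
  interpret S: iid_compact_samples M X \<mu> K
  proof (intro iid_compact_samples.intro iid_compact_samples_axioms.intro)
    show "distr M borel (X i) = \<mu>" for i
    proof -
      \<comment> \<open>\<open>borel\<close> and \<open>lborel\<close> have the same measurable
        sets, and \<open>distr\<close> uses only those of its target.\<close>
      have "distr M borel (X i) = distr M lborel (X i)" by (rule distr_cong) auto
      also have "\<dots> = \<mu>"
        unfolding \<mu>_def
        by (rule distributed_distr_eq_density[OF \<open>\<And>i. distributed M lborel (X i) (\<lambda>x. ennreal (\<rho> x))\<close>])
      finally show ?thesis .
    qed
    show "AE x in \<mu>. x \<in> K"
      unfolding \<mu>_def AE_density[OF rho_meas] using \<open>AE x in lborel. x \<notin> K \<longrightarrow> \<rho> x = 0\<close>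
      by eventually_elim auto
  qed fact+
  interpret D: edmd \<sigma> p H ip M X \<mu> K f v r B A
  proof
    show "continuous_on UNIV f" using C(1) by simp
    show "shifted_monomial p \<alpha> \<circ> f \<in> H" for \<alpha> by (rule E.mon_comp_in) fact
    show "is_basis v {..<r n} (cfun.span (shifted_monomial p ` multi_upto n))" for n
      unfolding jets[symmetric] by fact
    show "inj v" "cfun.independent (range v)"
      using \<open>is_basis v UNIV (\<Union>n. jet_space k p n)\<close> by (simp_all add: is_basis_def)
    show "ennreal (cmod (c \<alpha>)) \<le> ennreal (B * A ^ Suc n) * (\<integral>\<^sup>+x. ennreal (cmod (mpoly_of p n c x)) \<partial>\<mu>)"
      if "\<alpha> \<in> multi_upto n" for n c \<alpha>
      using BA(3) that by blast
  qed (fact C BA assms)+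
  show ?thesis by (rule D.C_hat_converges[unfolded D.target_def])
qed

end
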